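(* Let $p$ be a prime and $G=\mathbb A_{\mathbb Q}/(\mathbb Q,+)$. The image in $\Gamma_{\mathbb Q}=P(\mathbb Q)\backslash\overline{P(\mathbb A_{\mathbb Q})}/\hat{\mathbb Z}^\times$ of the set of classes of matrices $\begin{pmatrix} y&x\\0&1\end{pmatrix}$ with $x\in\mathbb A_{\mathbb Q}$ arbitrary and the class of $y$ modulo $\hat{\mathbb Z}^\times$ in $\prod(p)$ is the compact space $$\Gamma(p):=p^{\mathbb Z}\backslash\big((\mathbb A_{\mathbb Q}/(\mathbb Q,+))\times\textstyle\prod(p)\big),$$ where $p^{\mathbb Z}$ acts by multiplication on both factors, and this space is the mapping torus of the homeomorphism $\psi:G\to G$ given by multiplication by $p$.
   Context: $\mathbb A_{\mathbb Q}$ denotes the adeles of $\mathbb Q$. For a commutative ring $R$, $\overline{P(R)}=\left\{\begin{pmatrix} a&b\\0&1\end{pmatrix}: a,b\in R\right\}$ and $P(R)$ is the group of those matrices with $a$ invertible. $P(\mathbb Q)$ acts on $\overline{P(\mathbb A_{\mathbb Q})}$ by left multiplication, $\begin{pmatrix} a&b\\0&1\end{pmatrix}\begin{pmatrix} y&x\\0&1\end{pmatrix}=\begin{pmatrix} ay&ax+b\\0&1\end{pmatrix}$, and $\hat{\mathbb Z}^\times$ acts on the right through $u\mapsto\begin{pmatrix} u&0\\0&1\end{pmatrix}$, i.e. by $y\mapsto uy$ at the finite places. $\prod(p)\subset\mathbb A_{\mathbb Q}/\hat{\mathbb Z}^\times$ is the set of classes modulo $\hat{\mathbb Z}^\times$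 of adeles $a=(a_v)$ with $a_v\in\mathbb Z_v^\times$ for all $v\notin\{p,\infty\}$, $a_p=0$, $a_\infty=\lambda>0$; such a class is determined by $\lambda$ and denoted $\pi(\lambda)$, so $\prod(p)\simeq\mathbb R_+^*$, with $p\cdot\pi(\lambda)=\pi(p\lambda)$. *)

theory Defs
  imports "HOL-Analysis.Analysis" "HOL-Algebra.QuotRing" "HOL-Computational_Algebra.Primes"
begin

section \<open>The \<open>p\<close>-adic absolute value on the rationals\<close>

definition padic_abs :: "nat \<Rightarrow> rat \<Rightarrow> real" where
  "padic_abs p q =
     (if q = 0 then 0
      else real p powi (int (multiplicity (int p) (snd (quotient_of q)))
                      - int (multiplicity (int p) (fst (quotient_of q)))))"

lemma padic_abs_fract:
  assumes p: "prime p" and a: "a \<noteq> 0" and b: "b \<noteq> 0"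
  shows "padic_abs p (of_int a / of_int b) =
     real p powi (int (multiplicity (int p) b) - int (multiplicity (int p) a))"
proof -
  let ?q = "of_int a / of_int b :: rat"
  obtain c d where cd: "quotient_of ?q = (c, d)" by (cases "quotient_of ?q") auto
  have d: "d > 0" using quotient_of_denom_pos[OF cd] .
  have q: "?q = of_int c / of_int d" using quotient_of_div[OF cd] .
  have q0: "?q \<noteq> 0" using a b by simp
  have c: "c \<noteq> 0" using q q0 by auto
  have "(of_int (a * d) :: rat) = of_int (c * b)"
    using q b d by (simp add: field_simps)
  then have eq: "a * d = c * b" by (simp only: of_int_eq_iff)
  have pe: "prime_elem (int p)" using p by auto
  have "multiplicity (int p) a + multiplicity (int p) d
      = multiplicity (int p) c + multiplicity (int p) b"
    using prime_elem_multiplicity_mult_distrib[OF pe a, of d]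
      prime_elem_multiplicity_mult_distrib[OF pe c b] eq d by simp
  then have "int (multiplicity (int p) d) - int (multiplicity (int p) c)
      = int (multiplicity (int p) b) - int (multiplicity (int p) a)" by linarith
  then show ?thesis using q0 cd by (simp add: padic_abs_def)
qed

lemma rat_fract_cases:
  obtains a b where "(q::rat) = of_int a / of_int b" "b \<noteq> 0"
  using quotient_of_div[of q] quotient_of_denom_pos[of q]
  by (cases "quotient_of q") force

lemma padic_abs_0 [simp]: "padic_abs p 0 = 0"
  by (simp add: padic_abs_def)

lemma padic_abs_nonneg: "padic_abs p q \<ge> 0"
  by (simp add: padic_abs_def)

lemma padic_abs_eq_0: "prime p \<Longrightarrow> padic_abs p q = 0 \<longleftrightarrow> q = 0"
  by (auto simp: padic_abs_def prime_gt_0_nat)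

lemma padic_abs_mult:
  assumes p: "prime p"
  shows "padic_abs p (q * r) = padic_abs p q * padic_abs p r"
proof (cases "q = 0 \<or> r = 0")
  case False
  obtain a b where q: "q = of_int a / of_int b" "b \<noteq> 0" by (rule rat_fract_cases)
  obtain c d where r: "r = of_int c / of_int d" "d \<noteq> 0" by (rule rat_fract_cases)
  have a: "a \<noteq> 0" "c \<noteq> 0" using False q r by auto
  have pe: "prime_elem (int p)" using p by auto
  have qr: "q * r = of_int (a * c) / of_int (b * d)" using q r by simp
  have "padic_abs p (q * r) = real p powi (int (multiplicity (int p) (b * d)) - int (multiplicity (int p) (a * c)))"
    unfolding qr using padic_abs_fract[OF p, of "a * c" "b * d"] a q r by simp
  also have "\<dots> = real p powi ((int (multiplicity (int p) b) - int (multiplicity (int p) a))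
                  + (int (multiplicity (int p) d) - int (multiplicity (int p) c)))"
    using prime_elem_multiplicity_mult_distrib[OF pe, of a c]
      prime_elem_multiplicity_mult_distrib[OF pe, of b d] a q r by (simp add: algebra_simps)
  also have "\<dots> = padic_abs p q * padic_abs p r"
    unfolding q(1) r(1) padic_abs_fract[OF p a(1) q(2)] padic_abs_fract[OF p a(2) r(2)]
    by (rule power_int_add) (use p prime_gt_0_nat in auto)
  finally show ?thesis .
qed auto

lemma padic_abs_of_int_le: "prime p \<Longrightarrow> padic_abs p (of_int a) \<le> 1"
proof (cases "a = 0")
  case False
  assume p: "prime p"
  have "padic_abs p (of_int a / of_int 1) = real p powi (- int (multiplicity (int p) a))"
    using padic_abs_fract[OF p False, of 1] by simp
  also have "\<dots> \<le> 1"
    using prime_ge_1_nat[OF p] by (simp add: power_int_minus inverse_le_1_iff)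
  finally show ?thesis by simp
qed auto

lemma padic_abs_1 [simp]: "prime p \<Longrightarrow> padic_abs p 1 = 1"
  by (simp add: padic_abs_def)

lemma padic_abs_minus [simp]: "prime p \<Longrightarrow> padic_abs p (- q) = padic_abs p q"
proof -
  assume p: "prime p"
  have "padic_abs p (-1) * padic_abs p (-1) = 1"
    using padic_abs_mult[OF p, of "-1" "-1"] p by simp
  then have "padic_abs p (-1) = 1"
    using padic_abs_nonneg[of p "-1"] by (simp add: square_eq_1_iff)
  then show ?thesis using padic_abs_mult[OF p, of "-1" q] by simp
qed

lemma padic_abs_ultra:
  assumes p: "prime p"
  shows "padic_abs p (q + r) \<le> max (padic_abs p q) (padic_abs p r)"
proof (cases "q = 0 \<or> r = 0 \<or> q + r = 0")
  case True
  then show ?thesis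
    using padic_abs_nonneg[of p q] padic_abs_nonneg[of p r] by (auto simp: le_max_iff_disj)
next
  case False
  obtain a b where q: "q = of_int a / of_int b" "b \<noteq> 0" by (rule rat_fract_cases)
  obtain c d where r: "r = of_int c / of_int d" "d \<noteq> 0" by (rule rat_fract_cases)
  have q': "q = of_int (a * d) / of_int (b * d)" and r': "r = of_int (c * b) / of_int (b * d)"
    using q r by auto
  have s': "q + r = of_int (a * d + c * b) / of_int (b * d)"
    using q r by (simp add: field_simps)
  have nz: "a * d \<noteq> 0" "c * b \<noteq> 0" "b * d \<noteq> 0" "a * d + c * b \<noteq> 0"
    using False q r s' by (auto simp del: of_int_add of_int_mult)
  let ?m = "multiplicity (int p)"
  have p1: "\<not> is_unit (int p)" using p by auto
  have "int p ^ min (?m (a * d)) (?m (c * b)) dvd a * d + c * b"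
    by (intro dvd_add) (auto intro: multiplicity_dvd')
  then have "min (?m (a * d)) (?m (c * b)) \<le> ?m (a * d + c * b)"
    using nz p1 by (intro multiplicity_geI) auto
  then have "?m (a * d) \<le> ?m (a * d + c * b) \<or> ?m (c * b) \<le> ?m (a * d + c * b)"
    by linarith
  then have "padic_abs p (q + r) \<le> padic_abs p q \<or> padic_abs p (q + r) \<le> padic_abs p r"
    unfolding s' unfolding q' r' padic_abs_fract[OF p nz(1) nz(3)] padic_abs_fract[OF p nz(2) nz(3)]
      padic_abs_fract[OF p nz(4) nz(3)]
    using prime_ge_1_nat[OF p] by (auto intro!: power_int_increasing)
  then show ?thesis by (auto simp: le_max_iff_disj)
qed

lemma padic_abs_triangle: "prime p \<Longrightarrow> padic_abs p (q + r) \<le> padic_abs p q + padic_abs p r"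
  using padic_abs_ultra[of p q r] padic_abs_nonneg[of p q] padic_abs_nonneg[of p r] by linarith

lemma padic_abs_triangle_diff: "prime p \<Longrightarrow> \<bar>padic_abs p q - padic_abs p r\<bar> \<le> padic_abs p (q - r)"
  using padic_abs_triangle[of p "q - r" r] padic_abs_triangle[of p "r - q" q]
    padic_abs_minus[of p "q - r"] by auto


section \<open>The field of \<open>p\<close>-adic numbers as the completion of the rationals\<close>

definition padic_Cauchy :: "nat \<Rightarrow> (nat \<Rightarrow> rat) \<Rightarrow> bool" where
  "padic_Cauchy p s \<longleftrightarrow> (\<forall>e>0. \<exists>N. \<forall>m\<ge>N. \<forall>n\<ge>N. padic_abs p (s m - s n) < e)"

definition padic_Cauchy_ring :: "nat \<Rightarrow> (nat \<Rightarrow> rat) ring" where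
  "padic_Cauchy_ring p =
     \<lparr>carrier = {s. padic_Cauchy p s}, mult = (\<lambda>s t n. s n * t n), one = (\<lambda>_. 1),
      zero = (\<lambda>_. 0), add = (\<lambda>s t n. s n + t n)\<rparr>"

definition padic_null :: "nat \<Rightarrow> (nat \<Rightarrow> rat) set" where
  "padic_null p = {s. (\<lambda>n. padic_abs p (s n)) \<longlonglongrightarrow> 0}"

type_synonym padic = "(nat \<Rightarrow> rat) set"

definition padic_field :: "nat \<Rightarrow> padic ring" where
  "padic_field p = padic_Cauchy_ring p Quot padic_null p"

definition padic_of_rat :: "nat \<Rightarrow> rat \<Rightarrow> padic" where
  "padic_of_rat p q = padic_null p +>\<^bsub>padic_Cauchy_ring p\<^esub> (\<lambda>_. q)"

definition padic_norm :: "nat \<Rightarrow> padic \<Rightarrow> real" where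
  "padic_norm p x = (THE r. \<forall>s\<in>x. (\<lambda>n. padic_abs p (s n)) \<longlonglongrightarrow> r)"

text \<open>\<^locale>\<open>Metric_space\<close> wants a distance that is symmetric and nonnegative on the whole type,
  hence the default value off the carrier.\<close>

definition padic_dist :: "nat \<Rightarrow> padic \<Rightarrow> padic \<Rightarrow> real" where
  "padic_dist p x y =
     (if x \<in> carrier (padic_field p) \<and> y \<in> carrier (padic_field p)
      then padic_norm p (x \<ominus>\<^bsub>padic_field p\<^esub> y) else 0)"

definition padic_topology :: "nat \<Rightarrow> padic topology" where
  "padic_topology p = Metric_space.mtopology (carrier (padic_field p)) (padic_dist p)"

definition padic_ints :: "nat \<Rightarrow> padic ring" where
  "padic_ints p = padic_field p \<lparr>carrier := {x \<in> carrier (padic_field p). padic_norm p x \<le> 1}\<rparr>"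

lemma padic_Cauchy_ring_simps:
  "s \<in> carrier (padic_Cauchy_ring p) \<longleftrightarrow> padic_Cauchy p s"
  "s \<otimes>\<^bsub>padic_Cauchy_ring p\<^esub> t = (\<lambda>n. s n * t n)"
  "s \<oplus>\<^bsub>padic_Cauchy_ring p\<^esub> t = (\<lambda>n. s n + t n)"
  "\<one>\<^bsub>padic_Cauchy_ring p\<^esub> = (\<lambda>_. 1)" "\<zero>\<^bsub>padic_Cauchy_ring p\<^esub> = (\<lambda>_. 0)"
  by (simp_all add: padic_Cauchy_ring_def)

lemma padic_Cauchy_const [simp]: "padic_Cauchy p (\<lambda>_. q)"
  by (auto simp: padic_Cauchy_def)

lemma padic_Cauchy_add:
  assumes p: "prime p" and s: "padic_Cauchy p s" and t: "padic_Cauchy p t"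
  shows "padic_Cauchy p (\<lambda>n. s n + t n)"
  unfolding padic_Cauchy_def
proof (intro allI impI)
  fix e :: real assume e: "e > 0"
  obtain N where N: "\<And>m n. m \<ge> N \<Longrightarrow> n \<ge> N \<Longrightarrow> padic_abs p (s m - s n) < e"
    using s e unfolding padic_Cauchy_def by blast
  obtain M where M: "\<And>m n. m \<ge> M \<Longrightarrow> n \<ge> M \<Longrightarrow> padic_abs p (t m - t n) < e"
    using t e unfolding padic_Cauchy_def by blast
  have "padic_abs p (s m + t m - (s n + t n)) < e" if "m \<ge> max N M" "n \<ge> max N M" for m n
  proof -
    have "padic_abs p ((s m - s n) + (t m - t n)) < e"
      using padic_abs_ultra[OF p, of "s m - s n" "t m - t n"] N[of m n] M[of m n] that by auto
    then show ?thesis by (simp add: algebra_simps)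
  qed
  then show "\<exists>N. \<forall>m\<ge>N. \<forall>n\<ge>N. padic_abs p (s m + t m - (s n + t n)) < e" by blast
qed

lemma padic_Cauchy_minus: "prime p \<Longrightarrow> padic_Cauchy p s \<Longrightarrow> padic_Cauchy p (\<lambda>n. - s n)"
  unfolding padic_Cauchy_def using padic_abs_minus[of p] by (metis minus_diff_minus)

lemma padic_Cauchy_lim:
  assumes p: "prime p" and s: "padic_Cauchy p s"
  shows "convergent (\<lambda>n. padic_abs p (s n))"
proof -
  have "Cauchy (\<lambda>n. padic_abs p (s n))"
    unfolding Cauchy_def dist_real_def
    using s padic_abs_triangle_diff[OF p] unfolding padic_Cauchy_def by (meson le_less_trans)
  then show ?thesis by (simp add: Cauchy_convergent_iff)
qed

lemma padic_Cauchy_bounded: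
  assumes p: "prime p" and s: "padic_Cauchy p s"
  obtains B where "B > 0" "\<And>n. padic_abs p (s n) \<le> B"
proof -
  have "Bseq (\<lambda>n. padic_abs p (s n))" using padic_Cauchy_lim[OF p s] convergent_imp_Bseq by blast
  then show ?thesis using that padic_abs_nonneg[of p] unfolding Bseq_def by auto
qed

lemma padic_Cauchy_mult:
  assumes p: "prime p" and s: "padic_Cauchy p s" and t: "padic_Cauchy p t"
  shows "padic_Cauchy p (\<lambda>n. s n * t n)"
  unfolding padic_Cauchy_def
proof (intro allI impI)
  fix e :: real assume e: "e > 0"
  obtain B where B: "B > 0" "\<And>n. padic_abs p (s n) \<le> B" using padic_Cauchy_bounded[OF p s] by blast
  obtain C where C: "C > 0" "\<And>n. padic_abs p (t n) \<le> C" using padic_Cauchy_bounded[OF p t] by blast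
  obtain N where N: "\<And>m n. m \<ge> N \<Longrightarrow> n \<ge> N \<Longrightarrow> padic_abs p (s m - s n) < e / C"
    using s e C unfolding padic_Cauchy_def by (meson divide_pos_pos)
  obtain M where M: "\<And>m n. m \<ge> M \<Longrightarrow> n \<ge> M \<Longrightarrow> padic_abs p (t m - t n) < e / B"
    using t e B unfolding padic_Cauchy_def by (meson divide_pos_pos)
  have "padic_abs p (s m * t m - s n * t n) < e" if mn: "m \<ge> max N M" "n \<ge> max N M" for m n
  proof -
    have "padic_abs p (s m * (t m - t n)) \<le> B * padic_abs p (t m - t n)"
      unfolding padic_abs_mult[OF p] using B(2) padic_abs_nonneg by (simp add: mult_right_mono)
    also have "\<dots> < e" using M[of m n] mn B(1) by (simp add: field_simps)
    finally have 1: "padic_abs p (s m * (t m - t n)) < e" .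
    have "padic_abs p ((s m - s n) * t n) \<le> padic_abs p (s m - s n) * C"
      unfolding padic_abs_mult[OF p] using C(2) padic_abs_nonneg by (simp add: mult_left_mono)
    also have "\<dots> < e" using N[of m n] mn C(1) by (simp add: field_simps)
    finally have 2: "padic_abs p ((s m - s n) * t n) < e" .
    have "padic_abs p (s m * (t m - t n) + (s m - s n) * t n) < e"
      using padic_abs_ultra[OF p, of "s m * (t m - t n)" "(s m - s n) * t n"] 1 2 by auto
    then show ?thesis by (simp add: algebra_simps)
  qed
  then show "\<exists>N. \<forall>m\<ge>N. \<forall>n\<ge>N. padic_abs p (s m * t m - s n * t n) < e" by blast
qed

lemma padic_Cauchy_ring_cring:
  assumes p: "prime p"
  shows "cring (padic_Cauchy_ring p)"
proof (rule cringI)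
  show "abelian_group (padic_Cauchy_ring p)"
  proof (rule abelian_groupI)
    fix s assume "s \<in> carrier (padic_Cauchy_ring p)"
    then show "\<exists>t\<in>carrier (padic_Cauchy_ring p). t \<oplus>\<^bsub>padic_Cauchy_ring p\<^esub> s = \<zero>\<^bsub>padic_Cauchy_ring p\<^esub>"
      using padic_Cauchy_minus[OF p, of s]
      by (intro bexI[of _ "\<lambda>n. - s n"]) (auto simp: padic_Cauchy_ring_def)
  qed (auto simp: padic_Cauchy_ring_def padic_Cauchy_add[OF p] algebra_simps)
  show "comm_monoid (padic_Cauchy_ring p)"
    by (rule comm_monoidI) (auto simp: padic_Cauchy_ring_def padic_Cauchy_mult[OF p] algebra_simps)
qed (auto simp: padic_Cauchy_ring_def algebra_simps)

lemma padic_null_Cauchy: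
  assumes p: "prime p" and s: "s \<in> padic_null p"
  shows "padic_Cauchy p s"
  unfolding padic_Cauchy_def
proof (intro allI impI)
  fix e :: real assume e: "e > 0"
  have "\<forall>\<^sub>F n in sequentially. padic_abs p (s n) < e"
    using s e unfolding padic_null_def mem_Collect_eq by (rule order_tendstoD(2))
  then obtain N where N: "\<And>n. n \<ge> N \<Longrightarrow> padic_abs p (s n) < e"
    unfolding eventually_sequentially by blast
  have "padic_abs p (s m - s n) < e" if "m \<ge> N" "n \<ge> N" for m n
    using padic_abs_ultra[OF p, of "s m" "- s n"] N[OF that(1)] N[OF that(2)] p by simp
  then show "\<exists>N. \<forall>m\<ge>N. \<forall>n\<ge>N. padic_abs p (s m - s n) < e" by blast
qed

lemma padic_null_add:
  assumes p: "prime p" and s: "s \<in> padic_null p" and t: "t \<in> padic_null p"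
  shows "(\<lambda>n. s n + t n) \<in> padic_null p"
proof -
  have "(\<lambda>n. padic_abs p (s n) + padic_abs p (t n)) \<longlonglongrightarrow> 0"
    using tendsto_add[of "\<lambda>n. padic_abs p (s n)" 0 _ "\<lambda>n. padic_abs p (t n)" 0] s t by (simp add: padic_null_def)
  then have "(\<lambda>n. padic_abs p (s n + t n)) \<longlonglongrightarrow> 0"
    by (rule Lim_null_comparison[rotated])
       (use padic_abs_triangle[OF p] padic_abs_nonneg[of p] in auto)
  then show ?thesis by (simp add: padic_null_def)
qed

lemma padic_null_mult:
  assumes p: "prime p" and s: "s \<in> padic_null p" and t: "padic_Cauchy p t"
  shows "(\<lambda>n. t n * s n) \<in> padic_null p"
proof -
  obtain L where "(\<lambda>n. padic_abs p (t n)) \<longlonglongrightarrow> L"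
    using padic_Cauchy_lim[OF p t] unfolding convergent_def by blast
  then have "(\<lambda>n. padic_abs p (t n) * padic_abs p (s n)) \<longlonglongrightarrow> L * 0"
    using s unfolding padic_null_def by (intro tendsto_mult) auto
  then show ?thesis by (simp add: padic_null_def padic_abs_mult[OF p])
qed

lemma padic_Cauchy_ring_inv:
  assumes p: "prime p" and s: "padic_Cauchy p s"
  shows "\<ominus>\<^bsub>padic_Cauchy_ring p\<^esub> s = (\<lambda>n. - s n)"
proof -
  interpret cring "padic_Cauchy_ring p" using padic_Cauchy_ring_cring[OF p] .
  show ?thesis
    by (rule sum_zero_eq_neg[symmetric])
       (use s padic_Cauchy_minus[OF p s] in \<open>auto simp: padic_Cauchy_ring_def\<close>)
qed

lemma padic_null_ideal:
  assumes p: "prime p"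
  shows "ideal (padic_null p) (padic_Cauchy_ring p)"
proof -
  interpret cring "padic_Cauchy_ring p" using padic_Cauchy_ring_cring[OF p] .
  have car: "carrier (padic_Cauchy_ring p) = {s. padic_Cauchy p s}" by (simp add: padic_Cauchy_ring_def)
  have mul: "s \<otimes>\<^bsub>padic_Cauchy_ring p\<^esub> t = (\<lambda>n. s n * t n)" for s t by (simp add: padic_Cauchy_ring_def)
  have add: "s \<oplus>\<^bsub>padic_Cauchy_ring p\<^esub> t = (\<lambda>n. s n + t n)" for s t by (simp add: padic_Cauchy_ring_def)
  have neg: "inv\<^bsub>add_monoid (padic_Cauchy_ring p)\<^esub> s = (\<lambda>n. - s n)" if "padic_Cauchy p s" for s
    using padic_Cauchy_ring_inv[OF p that] by (simp add: a_inv_def)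
  show ?thesis
  proof (rule idealI)
    show "subgroup (padic_null p) (add_monoid (padic_Cauchy_ring p))"
    proof (rule add.subgroupI)
      show "padic_null p \<subseteq> carrier (padic_Cauchy_ring p)"
        using padic_null_Cauchy[OF p] car by auto
      show "padic_null p \<noteq> {}" using padic_null_def by (auto intro!: exI[of _ "\<lambda>_. 0"])
    next
      fix s assume s: "s \<in> padic_null p"
      have "\<ominus>\<^bsub>padic_Cauchy_ring p\<^esub> s = (\<lambda>n. - s n)"
        using padic_Cauchy_ring_inv[OF p padic_null_Cauchy[OF p s]] .
      then show "\<ominus>\<^bsub>padic_Cauchy_ring p\<^esub> s \<in> padic_null p"
        using s p by (simp add: padic_null_def)
    next
      fix s t assume "s \<in> padic_null p" "t \<in> padic_null p"
      then show "s \<oplus>\<^bsub>padic_Cauchy_ring p\<^esub> t \<in> padic_null p"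
        using padic_null_add[OF p] by (simp add: add)
    qed
  next
    fix a x assume ax: "a \<in> padic_null p" "x \<in> carrier (padic_Cauchy_ring p)"
    show 1: "x \<otimes>\<^bsub>padic_Cauchy_ring p\<^esub> a \<in> padic_null p"
      using padic_null_mult[OF p ax(1), of x] ax(2) by (simp add: mul car)
    then show "a \<otimes>\<^bsub>padic_Cauchy_ring p\<^esub> x \<in> padic_null p"
      by (simp add: mul mult.commute)
  qed (rule ring_axioms)
qed

lemma padic_field_cring: "prime p \<Longrightarrow> cring (padic_field p)"
  unfolding padic_field_def
  using ideal.quotient_is_cring[OF padic_null_ideal padic_Cauchy_ring_cring] .

definition padic_class :: "nat \<Rightarrow> (nat \<Rightarrow> rat) \<Rightarrow> padic" where
  "padic_class p s = padic_null p +>\<^bsub>padic_Cauchy_ring p\<^esub> s"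

lemma padic_of_rat_class: "padic_of_rat p q = padic_class p (\<lambda>_. q)"
  by (simp add: padic_of_rat_def padic_class_def)

lemma padic_field_carrier:
  "carrier (padic_field p) = padic_class p ` {s. padic_Cauchy p s}"
proof -
  have "carrier (padic_field p)
      = (\<Union>s\<in>carrier (padic_Cauchy_ring p). {padic_null p +>\<^bsub>padic_Cauchy_ring p\<^esub> s})"
    by (simp add: padic_field_def FactRing_def A_RCOSETS_def')
  then show ?thesis
    by (auto simp only: padic_class_def padic_Cauchy_ring_simps)
qed

lemma padic_field_cases:
  assumes "x \<in> carrier (padic_field p)"
  obtains s where "padic_Cauchy p s" "x = padic_class p s"
  using assms by (auto simp: padic_field_carrier)

lemma padic_field_add:
  assumes "prime p" "padic_Cauchy p s" "padic_Cauchy p t"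
  shows "padic_class p s \<oplus>\<^bsub>padic_field p\<^esub> padic_class p t = padic_class p (\<lambda>n. s n + t n)"
proof -
  interpret ideal "padic_null p" "padic_Cauchy_ring p" using padic_null_ideal[OF assms(1)] .
  show ?thesis
    using a_rcos_sum[of s t] assms(2,3)
    by (simp only: padic_field_def FactRing_def padic_class_def padic_Cauchy_ring_simps
        ring.simps monoid.simps simp_thms)
qed

lemma padic_field_mult:
  assumes "prime p" "padic_Cauchy p s" "padic_Cauchy p t"
  shows "padic_class p s \<otimes>\<^bsub>padic_field p\<^esub> padic_class p t = padic_class p (\<lambda>n. s n * t n)"
proof -
  interpret ideal "padic_null p" "padic_Cauchy_ring p" using padic_null_ideal[OF assms(1)] .
  show ?thesis
    using rcoset_mult_add[of s t] assms(2,3)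
    by (simp only: padic_field_def FactRing_def padic_class_def padic_Cauchy_ring_simps
        ring.simps monoid.simps simp_thms)
qed

lemma padic_field_one: "\<one>\<^bsub>padic_field p\<^esub> = padic_class p (\<lambda>_. 1)"
  by (simp add: padic_field_def FactRing_def padic_class_def padic_Cauchy_ring_simps)

lemma padic_field_zero:
  assumes "prime p"
  shows "\<zero>\<^bsub>padic_field p\<^esub> = padic_class p (\<lambda>_. 0)"
proof -
  interpret ideal "padic_null p" "padic_Cauchy_ring p" using padic_null_ideal[OF assms(1)] .
  have "padic_null p +>\<^bsub>padic_Cauchy_ring p\<^esub> \<zero>\<^bsub>padic_Cauchy_ring p\<^esub> = padic_null p"
    by (simp add: a_rcos_const)
  then show ?thesis
    by (simp add: padic_field_def FactRing_def padic_class_def padic_Cauchy_ring_simps)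
qed

lemma padic_field_inv:
  assumes p: "prime p" and s: "padic_Cauchy p s"
  shows "\<ominus>\<^bsub>padic_field p\<^esub> padic_class p s = padic_class p (\<lambda>n. - s n)"
proof -
  interpret cring "padic_field p" using padic_field_cring[OF p] .
  show ?thesis
    by (rule sum_zero_eq_neg[symmetric])
       (use s p padic_Cauchy_minus[OF p s] in
         \<open>auto simp: padic_field_add padic_field_zero padic_field_carrier\<close>)
qed

lemma padic_class_iff: "t \<in> padic_class p s \<longleftrightarrow> (\<lambda>n. t n - s n) \<in> padic_null p"
proof
  assume "t \<in> padic_class p s"
  then show "(\<lambda>n. t n - s n) \<in> padic_null p"
    by (auto simp: padic_class_def a_r_coset_def' padic_Cauchy_ring_def)
next
  assume "(\<lambda>n. t n - s n) \<in> padic_null p"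
  then show "t \<in> padic_class p s"
    unfolding padic_class_def a_r_coset_def'
    by (auto simp: padic_Cauchy_ring_def intro!: bexI[of _ "\<lambda>n. t n - s n"])
qed

lemma padic_norm_class:
  assumes p: "prime p" and L: "(\<lambda>n. padic_abs p (s n)) \<longlonglongrightarrow> L"
  shows "padic_norm p (padic_class p s) = L"
proof -
  have s: "s \<in> padic_class p s" by (simp add: padic_class_iff padic_null_def)
  have "(\<lambda>n. padic_abs p (t n)) \<longlonglongrightarrow> L" if "t \<in> padic_class p s" for t
  proof -
    have "(\<lambda>n. padic_abs p (t n - s n)) \<longlonglongrightarrow> 0"
      using that by (simp add: padic_class_iff padic_null_def)
    then have "(\<lambda>n. padic_abs p (t n) - padic_abs p (s n)) \<longlonglongrightarrow> 0"
      by (rule Lim_null_comparison[rotated]) (simp add: padic_abs_triangle_diff[OF p])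
    from tendsto_add[OF this L] show ?thesis by simp
  qed
  then show ?thesis unfolding padic_norm_def
    using s LIMSEQ_unique L by (intro the_equality) blast+
qed

lemma padic_norm_lim:
  assumes "prime p" "padic_Cauchy p s"
  shows "(\<lambda>n. padic_abs p (s n)) \<longlonglongrightarrow> padic_norm p (padic_class p s)"
  using padic_Cauchy_lim[OF assms] padic_norm_class[OF assms(1)] unfolding convergent_def by blast

lemma padic_norm_of_rat: "prime p \<Longrightarrow> padic_norm p (padic_of_rat p q) = padic_abs p q"
  by (simp add: padic_of_rat_class padic_norm_class)

lemma padic_of_rat_in [simp]: "padic_of_rat p q \<in> carrier (padic_field p)"
  by (auto simp: padic_of_rat_class padic_field_carrier)

lemma padic_norm_add:
  assumes p: "prime p" and x: "x \<in> carrier (padic_field p)" and y: "y \<in> carrier (padic_field p)"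
  shows "padic_norm p (x \<oplus>\<^bsub>padic_field p\<^esub> y) \<le> max (padic_norm p x) (padic_norm p y)"
proof -
  obtain s where s: "padic_Cauchy p s" "x = padic_class p s" using padic_field_cases[OF x] .
  obtain t where t: "padic_Cauchy p t" "y = padic_class p t" using padic_field_cases[OF y] .
  have "(\<lambda>n. padic_abs p (s n + t n)) \<longlonglongrightarrow> padic_norm p (x \<oplus>\<^bsub>padic_field p\<^esub> y)"
    using padic_norm_lim[OF p padic_Cauchy_add[OF p s(1) t(1)]] s t p by (simp add: padic_field_add)
  moreover have "(\<lambda>n. max (padic_abs p (s n)) (padic_abs p (t n))) \<longlonglongrightarrow> max (padic_norm p x) (padic_norm p y)"
    using padic_norm_lim[OF p s(1)] padic_norm_lim[OF p t(1)] s t by (intro tendsto_max) auto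
  ultimately show ?thesis by (rule LIMSEQ_le) (use padic_abs_ultra[OF p] in auto)
qed

lemma padic_norm_mult:
  assumes p: "prime p" and x: "x \<in> carrier (padic_field p)" and y: "y \<in> carrier (padic_field p)"
  shows "padic_norm p (x \<otimes>\<^bsub>padic_field p\<^esub> y) = padic_norm p x * padic_norm p y"
proof -
  obtain s where s: "padic_Cauchy p s" "x = padic_class p s" using padic_field_cases[OF x] .
  obtain t where t: "padic_Cauchy p t" "y = padic_class p t" using padic_field_cases[OF y] .
  have "(\<lambda>n. padic_abs p (s n) * padic_abs p (t n)) \<longlonglongrightarrow> padic_norm p x * padic_norm p y"
    using padic_norm_lim[OF p s(1)] padic_norm_lim[OF p t(1)] s t by (intro tendsto_mult) auto
  then show ?thesis using padic_norm_class[OF p, of "\<lambda>n. s n * t n"] s t p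
    by (simp add: padic_field_mult padic_abs_mult)
qed

lemma padic_norm_neg:
  assumes p: "prime p" and x: "x \<in> carrier (padic_field p)"
  shows "padic_norm p (\<ominus>\<^bsub>padic_field p\<^esub> x) = padic_norm p x"
proof -
  obtain s where s: "padic_Cauchy p s" "x = padic_class p s" using padic_field_cases[OF x] .
  show ?thesis
    using padic_norm_class[OF p, of "\<lambda>n. - s n"] padic_norm_lim[OF p s(1)] s p
    by (simp add: padic_field_inv)
qed

lemma padic_norm_nonneg:
  assumes p: "prime p" and x: "x \<in> carrier (padic_field p)"
  shows "padic_norm p x \<ge> 0"
proof -
  obtain s where s: "padic_Cauchy p s" "x = padic_class p s" using padic_field_cases[OF x] .
  show ?thesis using padic_norm_lim[OF p s(1)] s(2) padic_abs_nonneg[of p] by (auto intro: LIMSEQ_le_const)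
qed

lemma padic_norm_eq_0:
  assumes p: "prime p" and x: "x \<in> carrier (padic_field p)"
  shows "padic_norm p x = 0 \<longleftrightarrow> x = \<zero>\<^bsub>padic_field p\<^esub>"
proof
  obtain s where s: "padic_Cauchy p s" "x = padic_class p s" using padic_field_cases[OF x] .
  interpret ideal "padic_null p" "padic_Cauchy_ring p" using padic_null_ideal[OF p] .
  assume "padic_norm p x = 0"
  then have "s \<in> padic_null p" using padic_norm_lim[OF p s(1)] s(2) by (simp add: padic_null_def)
  then have "x = padic_null p" using s(2) a_rcos_const by (simp add: padic_class_def)
  then show "x = \<zero>\<^bsub>padic_field p\<^esub>" by (simp add: padic_field_def FactRing_def)
next
  assume "x = \<zero>\<^bsub>padic_field p\<^esub>"
  then show "padic_norm p x = 0" by (simp add: padic_field_zero[OF p] padic_norm_class[OF p])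
qed

lemma padic_Metric_space:
  assumes p: "prime p"
  shows "Metric_space (carrier (padic_field p)) (padic_dist p)"
proof -
  interpret cring "padic_field p" using padic_field_cring[OF p] .
  have comm: "padic_norm p (x \<ominus>\<^bsub>padic_field p\<^esub> y) = padic_norm p (y \<ominus>\<^bsub>padic_field p\<^esub> x)"
    if "x \<in> carrier (padic_field p)" "y \<in> carrier (padic_field p)" for x y
  proof -
    have "x \<ominus>\<^bsub>padic_field p\<^esub> y = \<ominus>\<^bsub>padic_field p\<^esub> (y \<ominus>\<^bsub>padic_field p\<^esub> x)"
      using that by algebra
    then show ?thesis using that padic_norm_neg[OF p, of "y \<ominus>\<^bsub>padic_field p\<^esub> x"] by simp
  qed
  have tri: "padic_norm p (x \<ominus>\<^bsub>padic_field p\<^esub> z)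
      \<le> padic_norm p (x \<ominus>\<^bsub>padic_field p\<^esub> y) + padic_norm p (y \<ominus>\<^bsub>padic_field p\<^esub> z)"
    if xyz: "x \<in> carrier (padic_field p)" "y \<in> carrier (padic_field p)" "z \<in> carrier (padic_field p)" for x y z
  proof -
    have "x \<ominus>\<^bsub>padic_field p\<^esub> z = (x \<ominus>\<^bsub>padic_field p\<^esub> y) \<oplus>\<^bsub>padic_field p\<^esub> (y \<ominus>\<^bsub>padic_field p\<^esub> z)"
      using xyz by algebra
    then show ?thesis
      using xyz padic_norm_add[OF p, of "x \<ominus>\<^bsub>padic_field p\<^esub> y" "y \<ominus>\<^bsub>padic_field p\<^esub> z"]
        padic_norm_nonneg[OF p, of "x \<ominus>\<^bsub>padic_field p\<^esub> y"] padic_norm_nonneg[OF p, of "y \<ominus>\<^bsub>padic_field p\<^esub> z"]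
      by simp
  qed
  show ?thesis
  proof
    show "0 \<le> padic_dist p x y" for x y
      by (simp add: padic_dist_def padic_norm_nonneg[OF p])
    show "padic_dist p x y = padic_dist p y x" for x y
      by (simp add: padic_dist_def comm)
    show "padic_dist p x y = 0 \<longleftrightarrow> x = y"
      if "x \<in> carrier (padic_field p)" "y \<in> carrier (padic_field p)" for x y
    proof -
      have "x = (x \<ominus>\<^bsub>padic_field p\<^esub> y) \<oplus>\<^bsub>padic_field p\<^esub> y" using that by algebra
      then have "x \<ominus>\<^bsub>padic_field p\<^esub> y = \<zero>\<^bsub>padic_field p\<^esub> \<longleftrightarrow> x = y"
        using that by (metis l_zero r_neg a_minus_def)
      then show ?thesis using that by (simp add: padic_dist_def padic_norm_eq_0[OF p])
    qed
    show "padic_dist p x z \<le> padic_dist p x y + padic_dist p y z"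
      if "x \<in> carrier (padic_field p)" "y \<in> carrier (padic_field p)" "z \<in> carrier (padic_field p)" for x y z
      using that tri by (simp add: padic_dist_def)
  qed
qed


section \<open>The adele ring of the rationals\<close>

typedef adele =
  "{a :: real \<times> (nat \<Rightarrow> padic).
      snd a \<in> (\<Pi>\<^sub>E p\<in>{p. prime p}. carrier (padic_field p)) \<and>
      finite {p. prime p \<and> snd a p \<notin> carrier (padic_ints p)}}"
  morphisms Rep_adele Abs_adele
proof (intro exI CollectI conjI)
  let ?a = "(0::real, \<lambda>p\<in>{p::nat. prime p}. padic_of_rat p 0)"
  show "snd ?a \<in> (\<Pi>\<^sub>E p\<in>{p. prime p}. carrier (padic_field p))" by auto
  have "{p. prime p \<and> snd ?a p \<notin> carrier (padic_ints p)} = {}"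
    by (auto simp: padic_ints_def padic_norm_of_rat)
  then show "finite {p. prime p \<and> snd ?a p \<notin> carrier (padic_ints p)}" by simp
qed

setup_lifting type_definition_adele

lift_definition adele_inf :: "adele \<Rightarrow> real" is fst .

lift_definition adele_at :: "adele \<Rightarrow> nat \<Rightarrow> padic" is snd .

lemma adele_at_in: "prime p \<Longrightarrow> adele_at a p \<in> carrier (padic_field p)"
  by transfer auto

lemma adele_at_finite: "finite {p. prime p \<and> adele_at a p \<notin> carrier (padic_ints p)}"
  by transfer auto

lemma adele_eqI:
  assumes "adele_inf a = adele_inf b" and "\<And>p. prime p \<Longrightarrow> adele_at a p = adele_at b p"
  shows "a = b"
  using assms by transfer (auto simp: prod_eq_iff intro: PiE_ext)

lemma padic_ints_closed:
  assumes p: "prime p" and x: "x \<in> carrier (padic_ints p)" and y: "y \<in> carrier (padic_ints p)"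
  shows padic_ints_add: "x \<oplus>\<^bsub>padic_field p\<^esub> y \<in> carrier (padic_ints p)"
    and padic_ints_mult: "x \<otimes>\<^bsub>padic_field p\<^esub> y \<in> carrier (padic_ints p)"
    and padic_ints_inv: "\<ominus>\<^bsub>padic_field p\<^esub> x \<in> carrier (padic_ints p)"
proof -
  interpret cring "padic_field p" using padic_field_cring[OF p] .
  show "x \<oplus>\<^bsub>padic_field p\<^esub> y \<in> carrier (padic_ints p)" "\<ominus>\<^bsub>padic_field p\<^esub> x \<in> carrier (padic_ints p)"
    "x \<otimes>\<^bsub>padic_field p\<^esub> y \<in> carrier (padic_ints p)"
    using x y padic_norm_add[OF p, of x y]
    by (auto simp: padic_ints_def padic_norm_neg[OF p] padic_norm_mult[OF p] padic_norm_nonneg[OF p]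
        intro: mult_le_one)
qed

lemma padic_abs_le_1_finite: "finite {p. prime p \<and> \<not> padic_abs p q \<le> 1}"
proof -
  obtain a b where q: "q = of_int a / of_int b" "b \<noteq> 0" by (rule rat_fract_cases)
  have "padic_abs p q \<le> 1" if p: "prime p" and nd: "\<not> int p dvd b" for p
  proof -
    have "padic_abs p q * padic_abs p (of_int b) = padic_abs p (of_int a)"
      using padic_abs_mult[OF p, of q "of_int b"] q by simp
    moreover have "padic_abs p (of_int b) = 1"
      using padic_abs_fract[OF p q(2), of 1] nd by (simp add: not_dvd_imp_multiplicity_0)
    ultimately show ?thesis using padic_abs_of_int_le[OF p, of a] by simp
  qed
  then have "int ` {p. prime p \<and> \<not> padic_abs p q \<le> 1} \<subseteq> {d. d dvd b}" by auto
  then have "finite (int ` {p. prime p \<and> \<not> padic_abs p q \<le> 1})"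
    using q(2) finite_subset finite_divisors_int by blast
  then show ?thesis by (rule finite_imageD) simp
qed

lift_definition adele_of_rat :: "rat \<Rightarrow> adele" is
  "\<lambda>q. (of_rat q, \<lambda>p\<in>{p. prime p}. padic_of_rat p q)"
proof (intro conjI)
  fix q :: rat
  have "{p. prime p \<and> snd (of_rat q :: real, \<lambda>p\<in>{p. prime p}. padic_of_rat p q) p \<notin> carrier (padic_ints p)}
      = {p. prime p \<and> \<not> padic_abs p q \<le> 1}"
    by (auto simp: padic_ints_def padic_norm_of_rat)
  then show "finite {p. prime p \<and> snd (of_rat q :: real, \<lambda>p\<in>{p. prime p}. padic_of_rat p q) p \<notin> carrier (padic_ints p)}"
    using padic_abs_le_1_finite by simp
qed auto

instantiation adele :: comm_ring_1
begin

definition zero_adele :: adele where "zero_adele = adele_of_rat 0"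

definition one_adele :: adele where "one_adele = adele_of_rat 1"

lift_definition plus_adele :: "adele \<Rightarrow> adele \<Rightarrow> adele" is
  "\<lambda>a b. (fst a + fst b, \<lambda>p\<in>{p. prime p}. snd a p \<oplus>\<^bsub>padic_field p\<^esub> snd b p)"
proof (intro conjI)
  fix a b :: "real \<times> (nat \<Rightarrow> padic)"
  assume a: "snd a \<in> (\<Pi>\<^sub>E p\<in>{p. prime p}. carrier (padic_field p)) \<and>
      finite {p. prime p \<and> snd a p \<notin> carrier (padic_ints p)}"
    and b: "snd b \<in> (\<Pi>\<^sub>E p\<in>{p. prime p}. carrier (padic_field p)) \<and>
      finite {p. prime p \<and> snd b p \<notin> carrier (padic_ints p)}"
  let ?c = "(fst a + fst b, \<lambda>p\<in>{p. prime p}. snd a p \<oplus>\<^bsub>padic_field p\<^esub> snd b p)"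
  show "snd ?c \<in> (\<Pi>\<^sub>E p\<in>{p. prime p}. carrier (padic_field p))"
    using a b by (auto intro!: ring.ring_simprules(1) cring.axioms(1) padic_field_cring)
  show "finite {p. prime p \<and> snd ?c p \<notin> carrier (padic_ints p)}"
  proof (rule finite_subset)
    show "{p. prime p \<and> snd ?c p \<notin> carrier (padic_ints p)} \<subseteq>
      {p. prime p \<and> snd a p \<notin> carrier (padic_ints p)} \<union> {p. prime p \<and> snd b p \<notin> carrier (padic_ints p)}"
      using padic_ints_add by auto
  qed (use a b in auto)
qed

lift_definition times_adele :: "adele \<Rightarrow> adele \<Rightarrow> adele" is
  "\<lambda>a b. (fst a * fst b, \<lambda>p\<in>{p. prime p}. snd a p \<otimes>\<^bsub>padic_field p\<^esub> snd b p)"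
proof (intro conjI)
  fix a b :: "real \<times> (nat \<Rightarrow> padic)"
  assume a: "snd a \<in> (\<Pi>\<^sub>E p\<in>{p. prime p}. carrier (padic_field p)) \<and>
      finite {p. prime p \<and> snd a p \<notin> carrier (padic_ints p)}"
    and b: "snd b \<in> (\<Pi>\<^sub>E p\<in>{p. prime p}. carrier (padic_field p)) \<and>
      finite {p. prime p \<and> snd b p \<notin> carrier (padic_ints p)}"
  let ?c = "(fst a * fst b, \<lambda>p\<in>{p. prime p}. snd a p \<otimes>\<^bsub>padic_field p\<^esub> snd b p)"
  show "snd ?c \<in> (\<Pi>\<^sub>E p\<in>{p. prime p}. carrier (padic_field p))"
    using a b by (auto intro!: ring.ring_simprules(5) cring.axioms(1) padic_field_cring)
  show "finite {p. prime p \<and> snd ?c p \<notin> carrier (padic_ints p)}"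
  proof (rule finite_subset)
    show "{p. prime p \<and> snd ?c p \<notin> carrier (padic_ints p)} \<subseteq>
      {p. prime p \<and> snd a p \<notin> carrier (padic_ints p)} \<union> {p. prime p \<and> snd b p \<notin> carrier (padic_ints p)}"
      using padic_ints_mult by auto
  qed (use a b in auto)
qed

lift_definition uminus_adele :: "adele \<Rightarrow> adele" is
  "\<lambda>a. (- fst a, \<lambda>p\<in>{p. prime p}. \<ominus>\<^bsub>padic_field p\<^esub> snd a p)"
proof (intro conjI)
  fix a :: "real \<times> (nat \<Rightarrow> padic)"
  assume a: "snd a \<in> (\<Pi>\<^sub>E p\<in>{p. prime p}. carrier (padic_field p)) \<and>
      finite {p. prime p \<and> snd a p \<notin> carrier (padic_ints p)}"
  let ?c = "(- fst a, \<lambda>p\<in>{p. prime p}. \<ominus>\<^bsub>padic_field p\<^esub> snd a p)"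
  show "snd ?c \<in> (\<Pi>\<^sub>E p\<in>{p. prime p}. carrier (padic_field p))"
    using a by (auto intro!: ring.ring_simprules(3) cring.axioms(1) padic_field_cring)
  show "finite {p. prime p \<and> snd ?c p \<notin> carrier (padic_ints p)}"
  proof (rule finite_subset)
    show "{p. prime p \<and> snd ?c p \<notin> carrier (padic_ints p)} \<subseteq>
      {p. prime p \<and> snd a p \<notin> carrier (padic_ints p)}"
      using padic_ints_inv by auto
  qed (use a in auto)
qed

definition minus_adele :: "adele \<Rightarrow> adele \<Rightarrow> adele" where "minus_adele a b = a + - b"

lemma adele_inf_simps [simp]:
  "adele_inf (a + b) = adele_inf a + adele_inf b"
  "adele_inf (a * b) = adele_inf a * adele_inf b"
  "adele_inf (- a) = - adele_inf a"
  "adele_inf (adele_of_rat q) = of_rat q"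
  "adele_inf 0 = 0" "adele_inf 1 = 1"
  unfolding zero_adele_def one_adele_def by (transfer, simp)+

lemma adele_at_simps [simp]:
  assumes "prime p"
  shows "adele_at (a + b) p = adele_at a p \<oplus>\<^bsub>padic_field p\<^esub> adele_at b p"
    "adele_at (a * b) p = adele_at a p \<otimes>\<^bsub>padic_field p\<^esub> adele_at b p"
    "adele_at (- a) p = \<ominus>\<^bsub>padic_field p\<^esub> adele_at a p"
    "adele_at (adele_of_rat q) p = padic_of_rat p q"
    "adele_at 0 p = \<zero>\<^bsub>padic_field p\<^esub>" "adele_at 1 p = \<one>\<^bsub>padic_field p\<^esub>"
  using assms unfolding zero_adele_def one_adele_def
  by (transfer, simp add: padic_field_zero padic_field_one padic_of_rat_class)+

instance
proof
  fix a b c :: adele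
  note R = cring.cring_simprules[OF padic_field_cring] adele_at_in
    monoid.r_one[OF ring.is_monoid[OF cring.axioms(1)[OF padic_field_cring]]]
  show "a * b * c = a * (b * c)" "a * b = b * a" "1 * a = a" "a + b + c = a + (b + c)"
    "a + b = b + a" "0 + a = a" "- a + a = 0" "(a + b) * c = a * c + b * c"
    by (rule adele_eqI; simp add: R algebra_simps)+
  show "a - b = a + - b" by (simp add: minus_adele_def)
  have "adele_inf 0 \<noteq> adele_inf 1" by simp
  then show "(0::adele) \<noteq> 1" by metis
qed

end

lemma adele_of_rat_hom:
  "adele_of_rat 0 = 0" "adele_of_rat 1 = 1"
  "adele_of_rat (q + r) = adele_of_rat q + adele_of_rat r"
  "adele_of_rat (q * r) = adele_of_rat q * adele_of_rat r"
  by (simp_all add: zero_adele_def one_adele_def)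
     (rule adele_eqI; simp add: of_rat_add of_rat_mult padic_of_rat_class padic_field_add padic_field_mult)+

instantiation adele :: topological_space
begin

definition adele_box :: "real set \<Rightarrow> (nat \<Rightarrow> padic set) \<Rightarrow> adele set" where
  "adele_box U V = {a. adele_inf a \<in> U \<and> (\<forall>p. prime p \<longrightarrow> adele_at a p \<in> V p)}"

definition open_adele :: "adele set \<Rightarrow> bool" where
  "open_adele = generate_topology {adele_box U V | U V. open U
     \<and> (\<forall>p. prime p \<longrightarrow> openin (padic_topology p) (V p))
     \<and> finite {p. prime p \<and> V p \<noteq> carrier (padic_ints p)}}"

instance
  by standard (auto simp: open_adele_def intro: generate_topology.intros)

end


section \<open>Quotient topologies and mapping tori\<close>

definition quotient_topology :: "'a topology \<Rightarrow> ('a \<Rightarrow> 'b) \<Rightarrow> 'b topology" where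
  "quotient_topology X q =
     topology (\<lambda>V. V \<subseteq> q ` topspace X \<and> openin X {x \<in> topspace X. q x \<in> V})"

lemma openin_quotient_topology:
  "openin (quotient_topology X q) V \<longleftrightarrow>
     V \<subseteq> q ` topspace X \<and> openin X {x \<in> topspace X. q x \<in> V}"
proof -
  have "istopology (\<lambda>V. V \<subseteq> q ` topspace X \<and> openin X {x \<in> topspace X. q x \<in> V})"
    unfolding istopology_def
  proof (intro conjI allI impI)
    fix S T assume "S \<subseteq> q ` topspace X \<and> openin X {x \<in> topspace X. q x \<in> S}"
      "T \<subseteq> q ` topspace X \<and> openin X {x \<in> topspace X. q x \<in> T}"
    moreover have "{x \<in> topspace X. q x \<in> S \<inter> T} = {x \<in> topspace X. q x \<in> S} \<inter> {x \<in> topspace X. q x \<in> T}"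
      by auto
    ultimately show "S \<inter> T \<subseteq> q ` topspace X" "openin X {x \<in> topspace X. q x \<in> S \<inter> T}"
      by auto
  next
    fix K assume K: "\<forall>V\<in>K. V \<subseteq> q ` topspace X \<and> openin X {x \<in> topspace X. q x \<in> V}"
    have "{x \<in> topspace X. q x \<in> \<Union>K} = (\<Union>V\<in>K. {x \<in> topspace X. q x \<in> V})" by auto
    with K show "\<Union>K \<subseteq> q ` topspace X" "openin X {x \<in> topspace X. q x \<in> \<Union>K}"
      by auto
  qed
  then show ?thesis by (simp add: quotient_topology_def topology_inverse')
qed

lemma topspace_quotient_topology [simp]: "topspace (quotient_topology X q) = q ` topspace X"
proof
  show "topspace (quotient_topology X q) \<subseteq> q ` topspace X"
    by (metis openin_quotient_topology openin_topspace)
  have "{x \<in> topspace X. q x \<in> q ` topspace X} = topspace X" by auto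
  then show "q ` topspace X \<subseteq> topspace (quotient_topology X q)"
    by (intro openin_subset) (simp add: openin_quotient_topology)
qed

lemma quotient_map_quotient_topology: "quotient_map X (quotient_topology X q) q"
  by (auto simp: quotient_map_def openin_quotient_topology)

definition torus_gluing :: "'a topology \<Rightarrow> ('a \<Rightarrow> 'a) \<Rightarrow> (('a \<times> real) \<times> ('a \<times> real)) set" where
  "torus_gluing X f = {((x, 0), (f x, 1)) | x. x \<in> topspace X}"

text \<open>The quotient of \<open>X \<times> [0,1]\<close> by the equivalence relation generated by \<open>(x,0) \<sim> (f x,1)\<close>.\<close>

definition mapping_torus :: "'a topology \<Rightarrow> ('a \<Rightarrow> 'a) \<Rightarrow> ('a \<times> real) set topology" where
  "mapping_torus X f =
     quotient_topology (prod_topology X (top_of_set {0..1}))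
       (\<lambda>z. (torus_gluing X f \<union> (torus_gluing X f)\<inverse>)\<^sup>* `` {z})"


section \<open>The double quotient of the affine matrices over the adeles\<close>

definition P_matrix :: "'a \<Rightarrow> 'a \<Rightarrow> ('a::comm_ring_1)^2^2" where
  "P_matrix a b = vector [vector [a, b], vector [0, 1]]"

definition P_bar :: "(('a::comm_ring_1)^2^2) set" where
  "P_bar = {P_matrix a b | a b. True}"

definition P_group :: "(('a::comm_ring_1)^2^2) set" where
  "P_group = {P_matrix a b | a b. a dvd 1}"

text \<open>The profinite units are placed at the finite places, with component 1 at the real place.\<close>

definition Zhat_units :: "adele set" where
  "Zhat_units = {u. adele_inf u = 1 \<and> (\<forall>p. prime p \<longrightarrow> adele_at u p \<in> Units (padic_ints p))}"

definition Zhat_class :: "adele \<Rightarrow> adele set" where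
  "Zhat_class y = {y * u | u. u \<in> Zhat_units}"

definition double_coset :: "adele^2^2 \<Rightarrow> (adele^2^2) set" where
  "double_coset M =
     {map_matrix adele_of_rat g ** M ** P_matrix u 0 | g u. g \<in> P_group \<and> u \<in> Zhat_units}"

definition Gamma_Q :: "(adele^2^2) set topology" where
  "Gamma_Q = quotient_topology (top_of_set P_bar) double_coset"

definition Q_coset :: "adele \<Rightarrow> adele set" where
  "Q_coset x = {x + adele_of_rat q | q. True}"

definition adele_mod_Q :: "adele set topology" where
  "adele_mod_Q = quotient_topology euclidean Q_coset"

definition adele_mod_Zhat :: "adele set topology" where
  "adele_mod_Zhat = quotient_topology euclidean Zhat_class"

definition Pi_classes :: "nat \<Rightarrow> adele set set" where
  "Pi_classes p =
     {Zhat_class a | a.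
        (\<forall>l. prime l \<and> l \<noteq> p \<longrightarrow> adele_at a l \<in> Units (padic_ints l)) \<and>
        adele_at a p = \<zero>\<^bsub>padic_field p\<^esub> \<and> adele_inf a > 0}"

definition Pi_space :: "nat \<Rightarrow> adele set topology" where
  "Pi_space p = subtopology adele_mod_Zhat (Pi_classes p)"

definition P_bar_at :: "nat \<Rightarrow> (adele^2^2) set" where
  "P_bar_at p = {P_matrix y x | y x. Zhat_class y \<in> Pi_classes p}"

text \<open>Multiplication by a rational number on classes of adeles, for both quotients above:
  it takes a class to a class as long as the rational number is nonzero.\<close>

definition scale_class :: "rat \<Rightarrow> adele set \<Rightarrow> adele set" where
  "scale_class r C = (*) (adele_of_rat r) ` C"

definition pZ_orbit :: "nat \<Rightarrow> adele set \<times> adele set \<Rightarrow> (adele set \<times> adele set) set" where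
  "pZ_orbit p c =
     {(scale_class (of_nat p powi n) (fst c), scale_class (of_nat p powi n) (snd c)) | n. True}"

definition Gamma_p :: "nat \<Rightarrow> (adele set \<times> adele set) set topology" where
  "Gamma_p p = quotient_topology (prod_topology adele_mod_Q (Pi_space p)) (pZ_orbit p)"

text \<open>The image of \<^const>\<open>P_bar_at\<close> in \<^const>\<open>Gamma_Q\<close> carries the quotient topology of
  \<^const>\<open>P_bar_at\<close>. The topology that the image inherits as a subset of \<^const>\<open>Gamma_Q\<close> is
  strictly coarser and not Hausdorff: for primes \<open>q\<close> tending to infinity, \<open>q \<cdot> \<pi>(\<lambda>/q)\<close> tends to
  \<open>\<pi>(\<lambda>)\<close> in the adeles modulo \<^const>\<open>Zhat_units\<close>, so that the classes of
  \<open>(\<pi>(\<lambda>/q), x/q)\<close> tend to the class of \<open>(\<pi>(\<lambda>), x)\<close> there.\<close>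

definition image_space :: "nat \<Rightarrow> (adele^2^2) set topology" where
  "image_space p = quotient_topology (top_of_set (P_bar_at p)) double_coset"

end

theory Submission
  imports Defs "HOL-Number_Theory.Cong"
begin

text \<open>Write \<open>A\<close> for the adeles and \<open>G\<close> for \<open>A\<close> modulo the rationals.

\<^emph>\<open>The orbit space and the image.\<close> Both are quotients of one space, the pairs \<open>(x, y)\<close> with
\<open>x\<close> any adele and \<open>y\<close> an adele whose class lies in \<^term>\<open>Pi_classes p\<close>. The matrices of
\<open>(x, y)\<close> and \<open>(x', y')\<close> have the same double coset when \<open>y' = a y u\<close> and \<open>x' = a x + b\<close> for
rationals \<open>a \<noteq> 0\<close> and \<open>b\<close> and a profinite unit \<open>u\<close>. Away from \<open>p\<close> both \<open>y\<close> and \<open>y'\<close> are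
units, so \<open>a\<close> has absolute value 1 there; at the real place both are positive, so \<open>a > 0\<close>. Hence
\<open>a\<close> is a power of \<open>p\<close> (\<open>rat_unit_outside_p\<close>), while \<open>b\<close> and \<open>u\<close> vanish on passing to classes:
the double cosets agree exactly when the classes lie in one orbit of the powers of \<open>p\<close>
(\<open>pZ_orbit_eq_iff_double_coset_eq\<close>). Two quotient maps with the same fibres have homeomorphic
images. That the map from pairs to pairs of classes is a quotient map at all is due to openness: both
class maps are quotients by groups of homeomorphisms, hence open, and a product of open maps is open,
whereas a product of quotient maps need not be a quotient map.

\<^emph>\<open>The group \<open>G\<close> is compact and Hausdorff.\<close> Every adele is moved into the product of \<open>[0,1]\<close>
with all the \<open>p\<close>-adic integers by a rational (\<open>adele_strong_approximation\<close>), and this product is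
compact by Tychonoff's theorem. The rationals are discrete in \<open>A\<close>, because a rational that is
integral at every prime and of absolute value less than 1 is 0; this gives the separation
(\<open>adele_separate_from_rat\<close>).

\<^emph>\<open>The mapping torus.\<close> The real component identifies \<^term>\<open>Pi_space p\<close> with the positive
reals. Taking the logarithm to base \<open>p\<close> modulo 1 is well defined on orbits and separates orbits with
different values; orbits with the same value have representatives at one level \<open>\<lambda>\<close>, and there
the Hausdorff property of \<open>G\<close> separates them. So the orbit space is Hausdorff. As \<open>s\<close> runs through
\<open>[0,1]\<close>, the levels \<open>p^s\<close> meet every orbit, so \<open>(C, s)\<close> goes to the orbit of
\<open>(C, \<pi>(p^s))\<close> by a continuous surjection from the compact cylinder \<open>G \<times> [0,1]\<close>, which is
therefore a quotient map and shows that the orbit space is compact. Its only identifications come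
from \<open>p \<cdot> (C, \<pi>(1)) = (p C, \<pi>(p))\<close>; these are the identifications of \<open>(C, 0)\<close> with
\<open>(p C, 1)\<close> in the mapping torus.\<close>

section \<open>Compactness of the p-adic integers\<close>

lemma openin_padic_topology:
  assumes p: "prime p"
  shows "openin (padic_topology p) U \<longleftrightarrow>
    U \<subseteq> carrier (padic_field p) \<and>
    (\<forall>x\<in>U. \<exists>r>0. \<forall>y\<in>carrier (padic_field p). padic_norm p (x \<ominus>\<^bsub>padic_field p\<^esub> y) < r \<longrightarrow> y \<in> U)"
proof -
  interpret Q: Metric_space "carrier (padic_field p)" "padic_dist p" by (rule padic_Metric_space[OF p])
  show ?thesis
    unfolding padic_topology_def Q.openin_mtopology
    by (fastforce simp: padic_dist_def Q.mball_def subset_iff)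
qed

lemma topspace_padic_topology: "prime p \<Longrightarrow> topspace (padic_topology p) = carrier (padic_field p)"
  by (simp add: padic_topology_def Metric_space.topspace_mtopology padic_Metric_space)

lemma carrier_padic_ints: "carrier (padic_ints p) = {x \<in> carrier (padic_field p). padic_norm p x \<le> 1}"
  by (simp add: padic_ints_def)

lemma continuous_map_padic_affine:
  assumes p: "prime p" and a: "a \<in> carrier (padic_field p)" and b: "b \<in> carrier (padic_field p)"
  shows "continuous_map (padic_topology p) (padic_topology p)
    (\<lambda>x. a \<otimes>\<^bsub>padic_field p\<^esub> x \<oplus>\<^bsub>padic_field p\<^esub> b)"
proof -
  interpret cring "padic_field p" by (rule padic_field_cring[OF p])
  let ?f = "\<lambda>x. a \<otimes>\<^bsub>padic_field p\<^esub> x \<oplus>\<^bsub>padic_field p\<^esub> b"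
  have "openin (padic_topology p) {x \<in> carrier (padic_field p). ?f x \<in> U}"
    if U: "openin (padic_topology p) U" for U
    unfolding openin_padic_topology[OF p]
  proof (intro conjI ballI)
    fix x assume "x \<in> {x \<in> carrier (padic_field p). ?f x \<in> U}"
    then have x: "x \<in> carrier (padic_field p)" "?f x \<in> U" by auto
    obtain r where r: "r > 0"
      "\<And>y. y \<in> carrier (padic_field p) \<Longrightarrow> padic_norm p (?f x \<ominus>\<^bsub>padic_field p\<^esub> y) < r \<Longrightarrow> y \<in> U"
      using U x(2) unfolding openin_padic_topology[OF p] by blast
    have na: "padic_norm p a \<ge> 0" using padic_norm_nonneg[OF p a] .
    show "\<exists>r>0. \<forall>y\<in>carrier (padic_field p). padic_norm p (x \<ominus>\<^bsub>padic_field p\<^esub> y) < r \<longrightarrow>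
        y \<in> {x \<in> carrier (padic_field p). ?f x \<in> U}"
    proof (intro exI[of _ "r / (padic_norm p a + 1)"] conjI ballI impI)
      show "r / (padic_norm p a + 1) > 0" using r(1) na by simp
      fix y assume y: "y \<in> carrier (padic_field p)"
        and xy: "padic_norm p (x \<ominus>\<^bsub>padic_field p\<^esub> y) < r / (padic_norm p a + 1)"
      have "?f x \<ominus>\<^bsub>padic_field p\<^esub> ?f y = a \<otimes>\<^bsub>padic_field p\<^esub> (x \<ominus>\<^bsub>padic_field p\<^esub> y)"
        using a b x(1) y by algebra
      then have "padic_norm p (?f x \<ominus>\<^bsub>padic_field p\<^esub> ?f y)
          = padic_norm p a * padic_norm p (x \<ominus>\<^bsub>padic_field p\<^esub> y)"
        using a x(1) y by (simp add: padic_norm_mult[OF p])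
      also have "\<dots> \<le> (padic_norm p a + 1) * padic_norm p (x \<ominus>\<^bsub>padic_field p\<^esub> y)"
        using padic_norm_nonneg[OF p, of "x \<ominus>\<^bsub>padic_field p\<^esub> y"] x(1) y by (intro mult_right_mono) auto
      also have "\<dots> < r" using xy na by (simp add: field_simps)
      finally show "y \<in> {x \<in> carrier (padic_field p). ?f x \<in> U}" using r(2) a b y by auto
    qed
  qed auto
  then show ?thesis
    using a b by (auto simp: continuous_map_def topspace_padic_topology[OF p])
qed

lemma padic_ints_absorb:
  assumes p: "prime p" and x: "x \<in> carrier (padic_ints p)" and y: "y \<in> carrier (padic_field p)"
  shows "x \<oplus>\<^bsub>padic_field p\<^esub> y \<in> carrier (padic_ints p) \<longleftrightarrow> y \<in> carrier (padic_ints p)"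
proof
  interpret cring "padic_field p" by (rule padic_field_cring[OF p])
  have x': "x \<in> carrier (padic_field p)" using x by (simp add: carrier_padic_ints)
  assume "x \<oplus>\<^bsub>padic_field p\<^esub> y \<in> carrier (padic_ints p)"
  then have "\<ominus>\<^bsub>padic_field p\<^esub> x \<oplus>\<^bsub>padic_field p\<^esub> (x \<oplus>\<^bsub>padic_field p\<^esub> y) \<in> carrier (padic_ints p)"
    using padic_ints_add[OF p] padic_ints_inv[OF p x] by blast
  moreover have "\<ominus>\<^bsub>padic_field p\<^esub> x \<oplus>\<^bsub>padic_field p\<^esub> (x \<oplus>\<^bsub>padic_field p\<^esub> y) = y"
    using x' y by algebra
  ultimately show "y \<in> carrier (padic_ints p)" by simp
next
  assume "y \<in> carrier (padic_ints p)"
  then show "x \<oplus>\<^bsub>padic_field p\<^esub> y \<in> carrier (padic_ints p)" using padic_ints_add[OF p x] by blast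
qed

text \<open>The ultrametric inequality makes the integers open and closed: a ball of radius 1 lies inside or
outside them.\<close>

lemma padic_norm_diff_le_1:
  assumes p: "prime p" and x: "x \<in> carrier (padic_field p)" and y: "y \<in> carrier (padic_field p)"
    and xy: "padic_norm p (x \<ominus>\<^bsub>padic_field p\<^esub> y) \<le> 1"
  shows "x \<in> carrier (padic_ints p) \<longleftrightarrow> y \<in> carrier (padic_ints p)"
proof -
  interpret cring "padic_field p" by (rule padic_field_cring[OF p])
  have "x = (x \<ominus>\<^bsub>padic_field p\<^esub> y) \<oplus>\<^bsub>padic_field p\<^esub> y" using x y by algebra
  then show ?thesis using padic_ints_absorb[OF p, of "x \<ominus>\<^bsub>padic_field p\<^esub> y" y] x y xy
    by (simp add: carrier_padic_ints)
qed

lemma openin_padic_ints: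
  assumes p: "prime p"
  shows "openin (padic_topology p) (carrier (padic_ints p))"
  unfolding openin_padic_topology[OF p]
proof (intro conjI ballI exI impI)
  show "carrier (padic_ints p) \<subseteq> carrier (padic_field p)" by (auto simp: carrier_padic_ints)
  fix x y assume "x \<in> carrier (padic_ints p)" "y \<in> carrier (padic_field p)"
    "padic_norm p (x \<ominus>\<^bsub>padic_field p\<^esub> y) < 1"
  then show "y \<in> carrier (padic_ints p)"
    using padic_norm_diff_le_1[OF p, of x y] by (simp add: carrier_padic_ints)
qed simp

lemma closedin_padic_ints:
  assumes p: "prime p"
  shows "closedin (padic_topology p) (carrier (padic_ints p))"
  unfolding closedin_def openin_padic_topology[OF p] topspace_padic_topology[OF p]
proof (intro conjI ballI exI impI)
  show "carrier (padic_ints p) \<subseteq> carrier (padic_field p)" by (auto simp: carrier_padic_ints)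
  fix x y assume "x \<in> carrier (padic_field p) - carrier (padic_ints p)" "y \<in> carrier (padic_field p)"
    "padic_norm p (x \<ominus>\<^bsub>padic_field p\<^esub> y) < 1"
  then show "y \<in> carrier (padic_field p) - carrier (padic_ints p)"
    using padic_norm_diff_le_1[OF p, of x y] by simp
qed auto

lemma openin_padic_ball:
  assumes p: "prime p"
  shows "openin (padic_topology p) {x \<in> carrier (padic_field p). padic_norm p x < r}"
  unfolding openin_padic_topology[OF p]
proof (intro conjI ballI)
  interpret cring "padic_field p" by (rule padic_field_cring[OF p])
  fix x assume x: "x \<in> {x \<in> carrier (padic_field p). padic_norm p x < r}"
  have "padic_norm p y < r" if y: "y \<in> carrier (padic_field p)"
    and "padic_norm p (x \<ominus>\<^bsub>padic_field p\<^esub> y) < r" for y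
  proof -
    have "y = x \<oplus>\<^bsub>padic_field p\<^esub> \<ominus>\<^bsub>padic_field p\<^esub> (x \<ominus>\<^bsub>padic_field p\<^esub> y)"
      using x y by (simp, algebra)
    then have "padic_norm p y \<le> max (padic_norm p x) (padic_norm p (x \<ominus>\<^bsub>padic_field p\<^esub> y))"
      using padic_norm_add[OF p, of x "\<ominus>\<^bsub>padic_field p\<^esub> (x \<ominus>\<^bsub>padic_field p\<^esub> y)"]
        padic_norm_neg[OF p, of "x \<ominus>\<^bsub>padic_field p\<^esub> y"] x y by simp
    then show ?thesis using that x by (auto simp: max_def split: if_splits)
  qed
  moreover have "r > 0" using x padic_norm_nonneg[OF p, of x] by auto
  ultimately show "\<exists>s>0. \<forall>y\<in>carrier (padic_field p). padic_norm p (x \<ominus>\<^bsub>padic_field p\<^esub> y) < s \<longrightarrow>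
      y \<in> {x \<in> carrier (padic_field p). padic_norm p x < r}" by blast
qed auto

lemma padic_of_rat_diff:
  assumes p: "prime p"
  shows "padic_of_rat p q \<ominus>\<^bsub>padic_field p\<^esub> padic_of_rat p r = padic_of_rat p (q - r)"
  using p by (simp add: padic_of_rat_class a_minus_def padic_field_inv padic_field_add)

lemma padic_class_minus_of_rat_norm:
  assumes p: "prime p" and s: "padic_Cauchy p s"
  shows "(\<lambda>n. padic_abs p (s n - q)) \<longlonglongrightarrow>
    padic_norm p (padic_class p s \<ominus>\<^bsub>padic_field p\<^esub> padic_of_rat p q)"
proof -
  have "padic_class p s \<ominus>\<^bsub>padic_field p\<^esub> padic_of_rat p q = padic_class p (\<lambda>n. s n - q)"
    using p s by (simp add: padic_of_rat_class a_minus_def padic_field_inv padic_field_add)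
  moreover have "padic_Cauchy p (\<lambda>n. s n - q)" using s by (simp add: padic_Cauchy_def)
  ultimately show ?thesis using padic_norm_lim[OF p] by simp
qed

lemma padic_Cauchy_lim_of_rat:
  assumes p: "prime p" and s: "padic_Cauchy p s" and e: "e > 0"
  shows "\<exists>N. \<forall>n\<ge>N. padic_norm p (padic_class p s \<ominus>\<^bsub>padic_field p\<^esub> padic_of_rat p (s n)) < e"
proof -
  have "e / 2 > 0" using e by simp
  then obtain N where N: "\<And>m n. m \<ge> N \<Longrightarrow> n \<ge> N \<Longrightarrow> padic_abs p (s m - s n) < e / 2"
    using s unfolding padic_Cauchy_def by blast
  have "padic_norm p (padic_class p s \<ominus>\<^bsub>padic_field p\<^esub> padic_of_rat p (s n)) \<le> e / 2" if "n \<ge> N" for n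
    using N[OF _ that] less_imp_le
    by (intro LIMSEQ_le_const2[OF padic_class_minus_of_rat_norm[OF p s]]) blast
  then show ?thesis using e by (intro exI[of _ N]) force
qed

lemma padic_rat_dense:
  assumes p: "prime p" and x: "x \<in> carrier (padic_field p)" and e: "e > 0"
  obtains q where "padic_norm p (x \<ominus>\<^bsub>padic_field p\<^esub> padic_of_rat p q) < e"
proof -
  obtain s where "padic_Cauchy p s" "x = padic_class p s" using padic_field_cases[OF x] .
  then show ?thesis using that padic_Cauchy_lim_of_rat[OF p _ e] by blast
qed

text \<open>Approximating the terms of a Cauchy sequence ever more closely by rationals gives a Cauchy sequence
of rationals, and its class is the limit.\<close>

lemma padic_mcomplete:
  assumes p: "prime p"
  shows "Metric_space.mcomplete (carrier (padic_field p)) (padic_dist p)"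
proof -
  interpret Q: Metric_space "carrier (padic_field p)" "padic_dist p" by (rule padic_Metric_space[OF p])
  show ?thesis
    unfolding Q.mcomplete_def
  proof (intro allI impI)
    fix \<sigma> assume \<sigma>: "Q.MCauchy \<sigma>"
    then have in\<sigma>: "\<sigma> n \<in> carrier (padic_field p)" for n by (auto simp: Q.MCauchy_def)
    have "\<exists>q. padic_dist p (\<sigma> n) (padic_of_rat p q) < 1 / real (Suc n)" for n
      by (rule padic_rat_dense[OF p in\<sigma>[of n], of "1 / real (Suc n)"]) (use in\<sigma> in \<open>auto simp: padic_dist_def\<close>)
    then obtain s where s: "padic_dist p (\<sigma> n) (padic_of_rat p (s n)) < 1 / real (Suc n)" for n
      by metis
    have s_close: "\<exists>N. \<forall>n\<ge>N. padic_dist p (\<sigma> n) (padic_of_rat p (s n)) < e" if e: "e > 0" for e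
    proof -
      obtain N where N: "1 / real (Suc N) < e" using nat_approx_posE[OF e] by blast
      have "padic_dist p (\<sigma> n) (padic_of_rat p (s n)) < e" if "n \<ge> N" for n
        using s[of n] N that frac_le[of 1 1 "real (Suc N)" "real (Suc n)"] by linarith
      then show ?thesis by blast
    qed
    have C: "padic_Cauchy p s"
      unfolding padic_Cauchy_def
    proof (intro allI impI)
      fix e :: real assume e: "e > 0"
      obtain N where N: "\<forall>n\<ge>N. padic_dist p (\<sigma> n) (padic_of_rat p (s n)) < e / 3"
        using s_close[of "e / 3"] e by auto
      obtain M where M: "\<And>m n. m \<ge> M \<Longrightarrow> n \<ge> M \<Longrightarrow> padic_dist p (\<sigma> m) (\<sigma> n) < e / 3"
        using \<sigma> e unfolding Q.MCauchy_def by (metis zero_less_divide_iff zero_less_numeral)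
      have "padic_abs p (s m - s n) < e" if mn: "m \<ge> max M N" "n \<ge> max M N" for m n
      proof -
        have "padic_abs p (s m - s n) = padic_dist p (padic_of_rat p (s m)) (padic_of_rat p (s n))"
          by (simp add: padic_dist_def padic_of_rat_diff[OF p] padic_norm_of_rat[OF p])
        also have "\<dots> \<le> padic_dist p (padic_of_rat p (s m)) (\<sigma> m) + padic_dist p (\<sigma> m) (padic_of_rat p (s n))"
          by (rule Q.triangle) (auto simp: in\<sigma>)
        also have "padic_dist p (\<sigma> m) (padic_of_rat p (s n))
            \<le> padic_dist p (\<sigma> m) (\<sigma> n) + padic_dist p (\<sigma> n) (padic_of_rat p (s n))"
          by (rule Q.triangle) (auto simp: in\<sigma>)
        finally have "padic_abs p (s m - s n) \<le> padic_dist p (\<sigma> m) (padic_of_rat p (s m)) +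
            (padic_dist p (\<sigma> m) (\<sigma> n) + padic_dist p (\<sigma> n) (padic_of_rat p (s n)))"
          by (simp add: Q.commute)
        moreover have "padic_dist p (\<sigma> m) (padic_of_rat p (s m)) < e / 3"
          "padic_dist p (\<sigma> n) (padic_of_rat p (s n)) < e / 3" "padic_dist p (\<sigma> m) (\<sigma> n) < e / 3"
          using N M mn by simp_all
        ultimately show ?thesis by linarith
      qed
      then show "\<exists>N. \<forall>m\<ge>N. \<forall>n\<ge>N. padic_abs p (s m - s n) < e" by blast
    qed
    let ?x = "padic_class p s"
    have x: "?x \<in> carrier (padic_field p)" using C by (auto simp: padic_field_carrier)
    have "\<exists>N. \<forall>n\<ge>N. \<sigma> n \<in> carrier (padic_field p) \<and> padic_dist p (\<sigma> n) ?x < e" if e: "e > 0" for e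
    proof -
      obtain N where N: "\<forall>n\<ge>N. padic_dist p (\<sigma> n) (padic_of_rat p (s n)) < e / 2"
        using s_close[of "e / 2"] e by auto
      obtain M where M: "\<forall>n\<ge>M. padic_norm p (?x \<ominus>\<^bsub>padic_field p\<^esub> padic_of_rat p (s n)) < e / 2"
        using padic_Cauchy_lim_of_rat[OF p C, of "e / 2"] e by auto
      have "padic_dist p (\<sigma> n) ?x < e" if "n \<ge> max M N" for n
      proof -
        have "padic_dist p (\<sigma> n) ?x
            \<le> padic_dist p (\<sigma> n) (padic_of_rat p (s n)) + padic_dist p (padic_of_rat p (s n)) ?x"
          by (rule Q.triangle) (auto simp: in\<sigma> x)
        moreover have "padic_dist p (padic_of_rat p (s n)) ?x < e / 2"
          using M that x by (subst Q.commute) (simp add: padic_dist_def)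
        moreover have "padic_dist p (\<sigma> n) (padic_of_rat p (s n)) < e / 2" using N that by simp
        ultimately show ?thesis by linarith
      qed
      then show ?thesis using in\<sigma> by blast
    qed
    then show "\<exists>x. limitin Q.mtopology \<sigma> x sequentially"
      using x unfolding Q.limitin_metric eventually_sequentially by blast
  qed
qed

lemma padic_abs_le_1_not_dvd_denominator:
  assumes p: "prime p" and q: "quotient_of r = (a, b)" and r: "padic_abs p r \<le> 1"
  shows "\<not> int p dvd b"
proof
  have b: "b > 0" and ab: "r = of_int a / of_int b" and cop: "coprime a b"
    using quotient_of_denom_pos[OF q] quotient_of_div[OF q] quotient_of_coprime[OF q] by auto
  have p1: "real p > 1" using prime_gt_1_nat[OF p] by simp
  have pe: "prime (int p)" using p by simp
  assume pb: "int p dvd b"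
  have "\<not> int p dvd a" using coprime_common_divisor[OF cop _ pb] pe by (metis not_prime_unit)
  then have a: "a \<noteq> 0" "multiplicity (int p) a = 0" by (auto simp: not_dvd_imp_multiplicity_0)
  have "multiplicity (int p) b \<ge> 1"
    using pb b pe by (intro multiplicity_geI) auto
  then have "1 < real p ^ multiplicity (int p) b" using p1 by (intro one_less_power) auto
  also have "\<dots> = padic_abs p r"
    using padic_abs_fract[OF p a(1), of b] a(2) b ab by simp
  finally show False using r by simp
qed

text \<open>For \<open>r = a/b\<close> in lowest terms, \<open>b\<close> is prime to \<open>p\<close>, so \<open>b c = a\<close> can be solved modulo
\<open>p^k\<close>. The bound on \<open>c\<close> makes the set of approximants finite, as total boundedness requires.\<close>

lemma padic_integral_rat_cong_nat:
  assumes p: "prime p" and r: "padic_abs p r \<le> 1"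
  obtains c where "c < p ^ k" "padic_abs p (r - of_nat c) \<le> 1 / real p ^ k"
proof -
  obtain a b where q: "quotient_of r = (a, b)" by (cases "quotient_of r")
  have b: "b > 0" and ab: "r = of_int a / of_int b" and cop: "coprime a b"
    using quotient_of_denom_pos[OF q] quotient_of_div[OF q] quotient_of_coprime[OF q] by auto
  have p1: "real p > 1" using prime_gt_1_nat[OF p] by simp
  have pe: "prime (int p)" using p by simp
  have nd: "\<not> int p dvd b" using padic_abs_le_1_not_dvd_denominator[OF p q r] .
  have "coprime b (int p ^ k)"
    using nd pe prime_imp_coprime coprime_commute coprime_power_right_iff by metis
  then obtain u where u: "[b * u = 1] (mod (int p ^ k))" using cong_solve_coprime_int by blast
  define c where "c = (a * u) mod (int p ^ k)"
  have c: "0 \<le> c" "c < int p ^ k" using pe by (simp_all add: c_def prime_gt_0_nat p)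
  have "[b * c = b * (a * u)] (mod (int p ^ k))" by (simp add: c_def cong_def mod_mult_right_eq)
  also have "b * (a * u) = a * (b * u)" by simp
  also have "[a * (b * u) = a * 1] (mod (int p ^ k))" using u by (rule cong_scalar_left)
  finally have dv: "int p ^ k dvd a - b * c"
    by (simp add: cong_iff_dvd_diff dvd_diff_commute)
  have "padic_abs p (r - of_int c) \<le> 1 / real p ^ k"
  proof (cases "a - b * c = 0")
    case True
    then have "r - of_int c = 0" using ab b by simp
    then show ?thesis by simp
  next
    case False
    have "k \<le> multiplicity (int p) (a - b * c)"
      using dv False pe by (intro multiplicity_geI) auto
    then have "real p ^ k \<le> real p ^ multiplicity (int p) (a - b * c)"
      using p1 by (intro power_increasing) auto
    moreover have "r - of_int c = of_int (a - b * c) / of_int b" using ab b by (simp add: field_simps)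
    then have "padic_abs p (r - of_int c) = padic_abs p (of_int (a - b * c) / of_int b)" by (rule arg_cong)
    then have "padic_abs p (r - of_int c) = 1 / real p ^ multiplicity (int p) (a - b * c)"
      using padic_abs_fract[OF p False, of b] b nd
      by (simp add: not_dvd_imp_multiplicity_0 power_int_minus inverse_eq_divide)
    ultimately show ?thesis using p1 by (simp add: frac_le)
  qed
  then show ?thesis using that[of "nat c"] c by (simp add: nat_less_iff of_nat_power)
qed

lemma padic_of_nat_dense_in_ints:
  assumes p: "prime p" and x: "x \<in> carrier (padic_ints p)"
  obtains c where "c < p ^ k" "padic_norm p (x \<ominus>\<^bsub>padic_field p\<^esub> padic_of_rat p (of_nat c)) \<le> 1 / real p ^ k"
proof -
  interpret cring "padic_field p" by (rule padic_field_cring[OF p])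
  have x': "x \<in> carrier (padic_field p)" using x by (simp add: carrier_padic_ints)
  have pk: "1 / real p ^ k > 0" "1 / real p ^ k \<le> 1" using prime_gt_0_nat[OF p] by auto
  obtain q where q: "padic_norm p (x \<ominus>\<^bsub>padic_field p\<^esub> padic_of_rat p q) < 1 / real p ^ k"
    using padic_rat_dense[OF p x' pk(1)] .
  then have "padic_of_rat p q \<in> carrier (padic_ints p)"
    using padic_norm_diff_le_1[OF p x', of "padic_of_rat p q"] x pk by simp
  then have "padic_abs p q \<le> 1" by (simp add: carrier_padic_ints padic_norm_of_rat[OF p])
  then obtain c where c: "c < p ^ k" "padic_abs p (q - of_nat c) \<le> 1 / real p ^ k"
    by (rule padic_integral_rat_cong_nat[OF p, where k = k])
  have "x \<ominus>\<^bsub>padic_field p\<^esub> padic_of_rat p (of_nat c) = (x \<ominus>\<^bsub>padic_field p\<^esub> padic_of_rat p q)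
      \<oplus>\<^bsub>padic_field p\<^esub> (padic_of_rat p q \<ominus>\<^bsub>padic_field p\<^esub> padic_of_rat p (of_nat c))"
    using x' padic_of_rat_in[of p] by algebra
  then have "padic_norm p (x \<ominus>\<^bsub>padic_field p\<^esub> padic_of_rat p (of_nat c)) \<le> 1 / real p ^ k"
    using padic_norm_add[OF p, of "x \<ominus>\<^bsub>padic_field p\<^esub> padic_of_rat p q" "padic_of_rat p (q - of_nat c)"]
      q c(2) x' by (simp add: padic_of_rat_diff[OF p] padic_norm_of_rat[OF p])
  then show ?thesis using that c(1) by blast
qed

lemma padic_abs_of_nat_le: "prime p \<Longrightarrow> padic_abs p (of_nat c) \<le> 1"
  using padic_abs_of_int_le[of p "int c"] by simp

text \<open>The numbers below \<open>p^k\<close> form a finite \<open>p^(-k)\<close>-net, so the integers are totally bounded, and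
they are closed in a complete space.\<close>

lemma compactin_padic_ints:
  assumes p: "prime p"
  shows "compactin (padic_topology p) (carrier (padic_ints p))"
proof -
  interpret Q: Metric_space "carrier (padic_field p)" "padic_dist p" by (rule padic_Metric_space[OF p])
  have "Q.mtotally_bounded (carrier (padic_ints p))"
    unfolding Q.mtotally_bounded_def
  proof (intro allI impI)
    fix e :: real assume e: "e > 0"
    have "1 / real p < 1" using prime_gt_1_nat[OF p] by simp
    then obtain k where "(1 / real p) ^ k < e" using real_arch_pow_inv[OF e] by blast
    then have k: "1 / real p ^ k < e" by (simp add: power_divide)
    let ?K = "(\<lambda>c. padic_of_rat p (of_nat c)) ` {..<p ^ k}"
    have "?K \<subseteq> carrier (padic_ints p)"
      using padic_abs_of_nat_le[OF p] by (auto simp: carrier_padic_ints padic_norm_of_rat[OF p])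
    moreover have "carrier (padic_ints p) \<subseteq> (\<Union>y\<in>?K. Q.mball y e)"
    proof
      fix x assume x: "x \<in> carrier (padic_ints p)"
      obtain c where c: "c < p ^ k"
        "padic_norm p (x \<ominus>\<^bsub>padic_field p\<^esub> padic_of_rat p (of_nat c)) \<le> 1 / real p ^ k"
        using padic_of_nat_dense_in_ints[OF p x] by blast
      have "x \<in> Q.mball (padic_of_rat p (of_nat c)) e"
        using c(2) k x by (subst Q.in_mball, subst Q.commute) (simp add: padic_dist_def carrier_padic_ints)
      then show "x \<in> (\<Union>y\<in>?K. Q.mball y e)" using c(1) by blast
    qed
    ultimately show "\<exists>K. finite K \<and> K \<subseteq> carrier (padic_ints p) \<and>
        carrier (padic_ints p) \<subseteq> (\<Union>x\<in>K. Q.mball x e)" by blast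
  qed
  then have "compactin Q.mtopology (Q.mtopology closure_of carrier (padic_ints p))"
    using Q.mtotally_bounded_eq_compact_closure_of[OF padic_mcomplete[OF p]] by blast
  then show ?thesis
    using closedin_padic_ints[OF p] by (simp add: padic_topology_def closure_of_closedin)
qed

section \<open>The topology of the adeles\<close>

lemma open_adele_box:
  assumes "open U" "\<And>p. prime p \<Longrightarrow> openin (padic_topology p) (V p)"
    "finite {p. prime p \<and> V p \<noteq> carrier (padic_ints p)}"
  shows "open (adele_box U V)"
  unfolding open_adele_def using assms by (intro generate_topology.Basis) blast

text \<open>The boxes generate the topology.\<close>

lemma continuous_map_into_adele:
  assumes "\<And>U V. \<lbrakk>open U; \<And>p. prime p \<Longrightarrow> openin (padic_topology p) (V p);
      finite {p. prime p \<and> V p \<noteq> carrier (padic_ints p)}\<rbrakk>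
    \<Longrightarrow> openin X {x \<in> topspace X. f x \<in> adele_box U V}"
  shows "continuous_map X euclidean f"
proof -
  have "openin X {x \<in> topspace X. f x \<in> S}" if "open S" for S
    using that unfolding open_adele_def
  proof (induction S rule: generate_topology.induct)
    case (Int a b)
    have "{x \<in> topspace X. f x \<in> a \<inter> b} = {x \<in> topspace X. f x \<in> a} \<inter> {x \<in> topspace X. f x \<in> b}" by auto
    then show ?case using Int by auto
  next
    case (UN K)
    have "{x \<in> topspace X. f x \<in> \<Union>K} = (\<Union>S\<in>K. {x \<in> topspace X. f x \<in> S})" by auto
    then show ?case using UN by auto
  next
    case (Basis s)
    then show ?case using assms by blast
  qed auto
  then show ?thesis by (auto simp: continuous_map_def)
qed

text \<open>The representing functions are extensional, hence the restriction to the primes.\<close>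

definition adele_of_components :: "real \<Rightarrow> (nat \<Rightarrow> padic) \<Rightarrow> adele" where
  "adele_of_components t f = Abs_adele (t, restrict f {p. prime p})"

lemma adele_of_components:
  assumes "\<And>p. prime p \<Longrightarrow> f p \<in> carrier (padic_field p)"
    and "finite {p. prime p \<and> f p \<notin> carrier (padic_ints p)}"
  shows "adele_inf (adele_of_components t f) = t"
    and "prime p \<Longrightarrow> adele_at (adele_of_components t f) p = f p"
proof -
  have "{p. prime p \<and> restrict f {p. prime p} p \<notin> carrier (padic_ints p)}
      = {p. prime p \<and> f p \<notin> carrier (padic_ints p)}" by auto
  then have "Rep_adele (adele_of_components t f) = (t, restrict f {p. prime p})"
    unfolding adele_of_components_def using assms by (intro Abs_adele_inverse) auto
  then show "adele_inf (adele_of_components t f) = t"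
    "prime p \<Longrightarrow> adele_at (adele_of_components t f) p = f p"
    by (simp_all add: adele_inf.rep_eq adele_at.rep_eq)
qed

text \<open>A box prescribes integral components at almost all primes, so the preimage of an open set of reals is
not a box but the union of the boxes that allow arbitrary components at finitely many primes.\<close>

lemma continuous_adele_inf: "continuous_on UNIV adele_inf"
  unfolding continuous_on_open_vimage[OF open_UNIV]
proof (intro allI impI)
  fix U :: "real set" assume U: "open U"
  let ?V = "\<lambda>S p. if p \<in> S then carrier (padic_field p) else carrier (padic_ints p)"
  have ex: "\<exists>S. finite S \<and> a \<in> adele_box U (?V S)" if "adele_inf a \<in> U" for a
    using that adele_at_in[of _ a] adele_at_finite[of a]
    by (intro exI[of _ "{p. prime p \<and> adele_at a p \<notin> carrier (padic_ints p)}"])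
      (auto simp: adele_box_def)
  have "adele_inf -` U \<inter> UNIV = (\<Union>S\<in>Collect finite. adele_box U (?V S))"
  proof (intro equalityI subsetI)
    fix a assume "a \<in> adele_inf -` U \<inter> UNIV"
    then obtain S where "finite S" "a \<in> adele_box U (?V S)" using ex[of a] by auto
    then show "a \<in> (\<Union>S\<in>Collect finite. adele_box U (?V S))" by (intro UN_I) simp_all
  next
    fix a assume "a \<in> (\<Union>S\<in>Collect finite. adele_box U (?V S))"
    then show "a \<in> adele_inf -` U \<inter> UNIV" by (auto simp: adele_box_def)
  qed
  moreover have "open (adele_box U (?V S))" if "finite S" for S
  proof (rule open_adele_box[OF U])
    show "openin (padic_topology p) (?V S p)" if "prime p" for p
      using openin_padic_ints[OF that] openin_topspace[of "padic_topology p"]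
      by (auto simp: topspace_padic_topology[OF that])
    show "finite {p. prime p \<and> ?V S p \<noteq> carrier (padic_ints p)}"
      by (rule finite_subset[OF _ that]) auto
  qed
  ultimately show "open (adele_inf -` U \<inter> UNIV)" by (simp only:) (rule open_UN, simp)
qed

lemma Units_padic_ints_norm:
  assumes p: "prime p" and x: "x \<in> Units (padic_ints p)"
  shows "x \<in> carrier (padic_field p)" "padic_norm p x = 1"
proof -
  obtain y where y: "y \<in> carrier (padic_ints p)" "x \<otimes>\<^bsub>padic_field p\<^esub> y = \<one>\<^bsub>padic_field p\<^esub>"
    and x': "x \<in> carrier (padic_ints p)"
    using x by (auto simp: Units_def padic_ints_def)
  show "x \<in> carrier (padic_field p)" using x' by (simp add: carrier_padic_ints)
  have "padic_norm p \<one>\<^bsub>padic_field p\<^esub> = 1"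
    using padic_norm_of_rat[OF p, of 1] p by (simp add: padic_of_rat_class padic_field_one)
  then have "padic_norm p x * padic_norm p y = 1"
    using padic_norm_mult[OF p, of x y] x' y by (simp add: carrier_padic_ints)
  moreover have "padic_norm p x \<le> 1" "padic_norm p y \<le> 1" "padic_norm p x \<ge> 0" "padic_norm p y \<ge> 0"
    using x' y padic_norm_nonneg[OF p] by (auto simp: carrier_padic_ints)
  ultimately show "padic_norm p x = 1"
    using mult_left_le[of "padic_norm p y" "padic_norm p x"] by linarith
qed

lemma padic_of_rat_mult:
  assumes p: "prime p"
  shows "padic_of_rat p (q * r) = padic_of_rat p q \<otimes>\<^bsub>padic_field p\<^esub> padic_of_rat p r"
  using p by (simp add: padic_of_rat_class padic_field_mult)

lemma padic_of_rat_1: "padic_of_rat p 1 = \<one>\<^bsub>padic_field p\<^esub>"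
  by (simp add: padic_of_rat_class padic_field_one)

lemma padic_of_rat_in_Units:
  assumes p: "prime p"
  shows "padic_of_rat p q \<in> Units (padic_ints p) \<longleftrightarrow> padic_abs p q = 1"
proof
  assume "padic_of_rat p q \<in> Units (padic_ints p)"
  then show "padic_abs p q = 1" using Units_padic_ints_norm[OF p] padic_norm_of_rat[OF p] by metis
next
  assume q: "padic_abs p q = 1"
  then have q0: "q \<noteq> 0" by auto
  then have "padic_abs p q * padic_abs p (1 / q) = 1"
    using padic_abs_mult[OF p, of q "1 / q"] p by simp
  then have "padic_abs p (1 / q) = 1" using q by simp
  moreover have "padic_of_rat p q \<otimes>\<^bsub>padic_field p\<^esub> padic_of_rat p (1 / q) = \<one>\<^bsub>padic_field p\<^esub>"
    "padic_of_rat p (1 / q) \<otimes>\<^bsub>padic_field p\<^esub> padic_of_rat p q = \<one>\<^bsub>padic_field p\<^esub>"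
    using q0 by (simp_all add: padic_of_rat_1 flip: padic_of_rat_mult[OF p])
  ultimately show "padic_of_rat p q \<in> Units (padic_ints p)"
    using q by (auto simp: Units_def padic_ints_def padic_norm_of_rat[OF p]
        intro!: exI[of _ "padic_of_rat p (1 / q)"])
qed

text \<open>At almost all primes \<open>a\<close> is a unit and \<open>b\<close> is integral, and there the map permutes the integers;
so the preimage of a box is again a box. This one lemma covers translations and multiplication by
nonzero rationals and by profinite units.\<close>

lemma continuous_adele_affine:
  assumes a: "finite {p. prime p \<and> adele_at a p \<notin> Units (padic_ints p)}"
  shows "continuous_on UNIV (\<lambda>x. a * x + b)"
proof -
  have "openin euclidean {x \<in> topspace euclidean. a * x + b \<in> adele_box U V}"
    if U: "open U" and V: "\<And>p. prime p \<Longrightarrow> openin (padic_topology p) (V p)"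
      and fin: "finite {p. prime p \<and> V p \<noteq> carrier (padic_ints p)}" for U V
  proof -
    let ?g = "\<lambda>p x. adele_at a p \<otimes>\<^bsub>padic_field p\<^esub> x \<oplus>\<^bsub>padic_field p\<^esub> adele_at b p"
    let ?U = "(\<lambda>t. adele_inf a * t + adele_inf b) -` U"
    let ?V = "\<lambda>p. {x \<in> carrier (padic_field p). ?g p x \<in> V p}"
    have "{x \<in> topspace euclidean. a * x + b \<in> adele_box U V} = adele_box ?U ?V"
      using adele_at_in by (auto simp: adele_box_def)
    moreover have "open (adele_box ?U ?V)"
    proof (rule open_adele_box)
      show "open ?U" using U by (intro open_vimage continuous_intros)
      show "openin (padic_topology p) (?V p)" if p: "prime p" for p
        using openin_continuous_map_preimage[OF continuous_map_padic_affine[OF p adele_at_in[OF p] adele_at_in[OF p]] V[OF p]]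
        by (simp add: topspace_padic_topology[OF p])
      have "?V p = carrier (padic_ints p)"
        if p: "prime p" and au: "adele_at a p \<in> Units (padic_ints p)"
          and b: "adele_at b p \<in> carrier (padic_ints p)" and Vp: "V p = carrier (padic_ints p)" for p
      proof -
        have a': "adele_at a p \<in> carrier (padic_field p)" "padic_norm p (adele_at a p) = 1"
          using Units_padic_ints_norm[OF p au] .
        have b': "adele_at b p \<in> carrier (padic_field p)" using b by (simp add: carrier_padic_ints)
        interpret cring "padic_field p" by (rule padic_field_cring[OF p])
        have "?g p x \<in> carrier (padic_ints p) \<longleftrightarrow> x \<in> carrier (padic_ints p)"
          if x: "x \<in> carrier (padic_field p)" for x
        proof -
          have "?g p x \<in> carrier (padic_ints p)
              \<longleftrightarrow> adele_at a p \<otimes>\<^bsub>padic_field p\<^esub> x \<in> carrier (padic_ints p)"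
            using padic_ints_absorb[OF p b, of "adele_at a p \<otimes>\<^bsub>padic_field p\<^esub> x"] a' b' x
            by (simp add: a_comm)
          then show ?thesis using a' x by (simp add: carrier_padic_ints padic_norm_mult[OF p])
        qed
        then show ?thesis unfolding Vp by (auto simp: carrier_padic_ints)
      qed
      then have "{p. prime p \<and> ?V p \<noteq> carrier (padic_ints p)} \<subseteq>
          {p. prime p \<and> adele_at a p \<notin> Units (padic_ints p)} \<union>
          {p. prime p \<and> adele_at b p \<notin> carrier (padic_ints p)} \<union>
          {p. prime p \<and> V p \<noteq> carrier (padic_ints p)}" by blast
      then show "finite {p. prime p \<and> ?V p \<noteq> carrier (padic_ints p)}"
        using finite_subset a adele_at_finite fin by (metis (no_types, lifting) finite_Un)
    qed
    ultimately show ?thesis by simp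
  qed
  then have "continuous_map euclidean euclidean (\<lambda>x. a * x + b)"
    by (rule continuous_map_into_adele)
  then show ?thesis by simp
qed

lemma adele_of_rat_ae_unit:
  assumes "q \<noteq> 0"
  shows "finite {p. prime p \<and> adele_at (adele_of_rat q) p \<notin> Units (padic_ints p)}"
proof (rule finite_subset)
  have "padic_abs p q = 1" if p: "prime p" and "padic_abs p q \<le> 1" "padic_abs p (1 / q) \<le> 1" for p
  proof -
    have "padic_abs p q * padic_abs p (1 / q) = 1"
      using padic_abs_mult[OF p, of q "1 / q"] p assms by simp
    then show ?thesis
      using that mult_left_le[of "padic_abs p (1 / q)" "padic_abs p q"] padic_abs_nonneg[of p q] by linarith
  qed
  then show "{p. prime p \<and> adele_at (adele_of_rat q) p \<notin> Units (padic_ints p)} \<subseteq>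
      {p. prime p \<and> \<not> padic_abs p q \<le> 1} \<union> {p. prime p \<and> \<not> padic_abs p (1 / q) \<le> 1}"
    using padic_of_rat_in_Units by auto
qed (use padic_abs_le_1_finite in auto)

lemma continuous_adele_scale: "q \<noteq> 0 \<Longrightarrow> continuous_on UNIV ((*) (adele_of_rat q))"
  using continuous_adele_affine[OF adele_of_rat_ae_unit, of q 0] by simp

lemma continuous_adele_translate: "continuous_on UNIV ((+) (b::adele))"
  using continuous_adele_affine[OF adele_of_rat_ae_unit[of 1], of b]
  by (simp add: adele_of_rat_hom add.commute)

lemma continuous_adele_unit_mult:
  assumes "u \<in> Zhat_units"
  shows "continuous_on UNIV ((*) u)"
proof -
  have "{p. prime p \<and> adele_at u p \<notin> Units (padic_ints p)} = {}"
    using assms by (auto simp: Zhat_units_def)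
  then have "finite {p. prime p \<and> adele_at u p \<notin> Units (padic_ints p)}" by (simp only: finite.emptyI)
  then show ?thesis using continuous_adele_affine[of u 0] by simp
qed

section \<open>Strong approximation\<close>

definition adele_unit_box :: "adele set" where
  "adele_unit_box = adele_box {0..1} (\<lambda>p. carrier (padic_ints p))"

text \<open>On a product of \<open>[0,1]\<close> with all the \<open>p\<close>-adic integers the adelic topology is coarser than the
product topology, so Tychonoff's theorem applies.\<close>

lemma compact_adele_unit_box: "compact adele_unit_box"
proof -
  let ?P = "{p::nat. prime p}"
  let ?Z = "\<lambda>p. subtopology (padic_topology p) (carrier (padic_ints p))"
  let ?X = "prod_topology (top_of_set {0..1::real}) (product_topology ?Z ?P)"
  let ?F = "\<lambda>(t, f). adele_of_components t f"
  have sub: "carrier (padic_ints p) \<subseteq> carrier (padic_field p)" for p by (auto simp: carrier_padic_ints)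
  have topZ: "topspace (?Z p) = carrier (padic_ints p)" if "prime p" for p
    using that sub by (auto simp: topspace_padic_topology)
  have top: "topspace ?X = {0..1} \<times> (\<Pi>\<^sub>E p\<in>?P. carrier (padic_ints p))"
    using topZ by (auto intro!: PiE_cong simp del: topspace_subtopology)
  have comp: "adele_inf (adele_of_components t f) = t \<and>
      (\<forall>p. prime p \<longrightarrow> adele_at (adele_of_components t f) p = f p)"
    if "f \<in> (\<Pi>\<^sub>E p\<in>?P. carrier (padic_ints p))" for t f
  proof -
    have "{p. prime p \<and> f p \<notin> carrier (padic_ints p)} = {}" using that by auto
    then have fin: "finite {p. prime p \<and> f p \<notin> carrier (padic_ints p)}" by (simp only: finite.emptyI)
    have "f p \<in> carrier (padic_field p)" if "prime p" for p
      using \<open>f \<in> _\<close> sub that by (auto simp: PiE_iff)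
    from adele_of_components[OF this fin] show ?thesis by blast
  qed
  have "compact_space ?X"
    unfolding compact_space_prod_topology compact_space_product_topology
    using compact_space_subtopology[OF compactin_padic_ints] by (auto simp: compact_space_subtopology)
  moreover have "continuous_map ?X euclidean ?F"
  proof (rule continuous_map_into_adele)
    fix U :: "real set" and V
    assume U: "open U" and V: "\<And>p. prime p \<Longrightarrow> openin (padic_topology p) (V p)"
      and fin: "finite {p. prime p \<and> V p \<noteq> carrier (padic_ints p)}"
    have "{x \<in> topspace ?X. ?F x \<in> adele_box U V}
        = ({0..1} \<inter> U) \<times> (\<Pi>\<^sub>E p\<in>?P. carrier (padic_ints p) \<inter> V p)"
      unfolding top using comp by (auto simp: adele_box_def PiE_iff)
    moreover have "openin (top_of_set {0..1}) ({0..1} \<inter> U)" using U by (rule openin_open_Int)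
    moreover have "openin (product_topology ?Z ?P) (\<Pi>\<^sub>E p\<in>?P. carrier (padic_ints p) \<inter> V p)"
      unfolding openin_PiE_gen
    proof (intro disjI2 conjI ballI)
      show "finite {p \<in> ?P. carrier (padic_ints p) \<inter> V p \<noteq> topspace (?Z p)}"
        by (rule finite_subset[OF _ fin]) (use topZ in auto)
      show "openin (?Z p) (carrier (padic_ints p) \<inter> V p)" if "p \<in> ?P" for p
        using V that by (simp add: openin_subtopology_Int2)
    qed
    ultimately show "openin ?X {x \<in> topspace ?X. ?F x \<in> adele_box U V}"
      by (simp add: openin_prod_Times_iff)
  qed
  ultimately have "compactin euclidean (?F ` topspace ?X)"
    using image_compactin compact_space_def by blast
  moreover have "?F ` topspace ?X = adele_unit_box"
  proof
    show "?F ` topspace ?X \<subseteq> adele_unit_box"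
      unfolding top using comp by (auto simp: adele_unit_box_def adele_box_def PiE_iff)
    show "adele_unit_box \<subseteq> ?F ` topspace ?X"
    proof
      fix a assume a: "a \<in> adele_unit_box"
      let ?f = "restrict (adele_at a) ?P"
      have f: "?f \<in> (\<Pi>\<^sub>E p\<in>?P. carrier (padic_ints p))" using a by (auto simp: adele_unit_box_def adele_box_def)
      have "a = ?F (adele_inf a, ?f)" using comp[OF f] by (auto intro: adele_eqI)
      moreover have "(adele_inf a, ?f) \<in> topspace ?X"
        unfolding top using a f by (auto simp: adele_unit_box_def adele_box_def)
      ultimately show "a \<in> ?F ` topspace ?X" by blast
    qed
  qed
  ultimately show ?thesis by simp
qed

lemma padic_abs_prime:
  assumes "prime p" "prime l"
  shows "padic_abs l (of_nat p) = (if l = p then 1 / real p else 1)"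
proof -
  have "p \<noteq> 0" using assms by auto
  then have "padic_abs l (of_int (int p) / of_int 1) = real l powi (- int (multiplicity (int l) (int p)))"
    using padic_abs_fract[OF assms(2), of "int p" 1] by simp
  moreover have "multiplicity (int l) (int p) = (if l = p then 1 else 0)"
    using assms primes_dvd_imp_eq[of l p] by (auto intro!: not_dvd_imp_multiplicity_0)
  ultimately show ?thesis by (auto simp: power_int_minus inverse_eq_divide)
qed

lemma padic_abs_power: "prime p \<Longrightarrow> padic_abs p (q ^ n) = padic_abs p q ^ n"
  by (induction n) (simp_all add: padic_abs_mult)

lemma padic_abs_inverse:
  assumes p: "prime p"
  shows "padic_abs p (inverse q) = inverse (padic_abs p q)"
proof (cases "q = 0")
  case False
  then have "padic_abs p (inverse q) * padic_abs p q = 1"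
    using padic_abs_mult[OF p, of "inverse q" q] p by simp
  then show ?thesis by (metis inverse_unique mult.commute)
qed simp

lemma padic_abs_power_int: "prime p \<Longrightarrow> padic_abs p (q powi n) = padic_abs p q powi n"
  by (simp add: power_int_def padic_abs_power padic_abs_inverse)

text \<open>The subtracted rational has a power of \<open>p\<close> as denominator, so it does no harm at the other primes.\<close>

lemma padic_fractional_part:
  assumes p: "prime p" and x: "x \<in> carrier (padic_field p)"
  obtains q where "x \<ominus>\<^bsub>padic_field p\<^esub> padic_of_rat p q \<in> carrier (padic_ints p)"
    "\<And>l. prime l \<Longrightarrow> l \<noteq> p \<Longrightarrow> padic_abs l q \<le> 1"
proof -
  interpret cring "padic_field p" by (rule padic_field_cring[OF p])
  obtain r where r: "padic_norm p (x \<ominus>\<^bsub>padic_field p\<^esub> padic_of_rat p r) < 1"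
    using padic_rat_dense[OF p x] by (metis zero_less_one)
  obtain m where m: "padic_abs p r < real p ^ m"
    using real_arch_pow prime_gt_1_nat[OF p] by (metis of_nat_1 of_nat_less_iff)
  have p0: "real p > 0" "p > 0" using prime_gt_0_nat[OF p] by auto
  have pm: "padic_abs p (of_nat p ^ m) = 1 / real p ^ m"
    using padic_abs_prime[OF p p] by (simp add: padic_abs_power[OF p] power_divide)
  have "padic_abs p (of_nat p ^ m * r) \<le> 1"
    using m p0 by (simp add: padic_abs_mult[OF p] pm divide_simps)
  \<comment> \<open>Dividing by \<open>p^m\<close> stretches distances by \<open>p^m\<close>, so precision \<open>p^(-m)\<close> here gives precision 1 for \<open>q\<close>.\<close>
  then obtain c where c: "padic_abs p (of_nat p ^ m * r - of_nat c) \<le> 1 / real p ^ m"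
    by (rule padic_integral_rat_cong_nat[OF p, where k = m])
  define q :: rat where "q = of_nat c / of_nat p ^ m"
  have "of_nat p ^ m * (r - q) = of_nat p ^ m * r - of_nat c"
    using p0 by (simp add: q_def algebra_simps)
  then have "padic_abs p (of_nat p ^ m) * padic_abs p (r - q) \<le> 1 / real p ^ m"
    using c by (metis padic_abs_mult[OF p])
  then have rq: "padic_abs p (r - q) \<le> 1" using p0 by (simp add: pm divide_simps)
  have "x \<ominus>\<^bsub>padic_field p\<^esub> padic_of_rat p q = (x \<ominus>\<^bsub>padic_field p\<^esub> padic_of_rat p r)
      \<oplus>\<^bsub>padic_field p\<^esub> (padic_of_rat p r \<ominus>\<^bsub>padic_field p\<^esub> padic_of_rat p q)"
    using x padic_of_rat_in[of p] by algebra
  then have "x \<ominus>\<^bsub>padic_field p\<^esub> padic_of_rat p q \<in> carrier (padic_ints p)"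
    using padic_ints_add[OF p, of "x \<ominus>\<^bsub>padic_field p\<^esub> padic_of_rat p r" "padic_of_rat p (r - q)"] r rq x
    by (simp add: carrier_padic_ints padic_of_rat_diff[OF p] padic_norm_of_rat[OF p])
  moreover have "padic_abs l q \<le> 1" if l: "prime l" "l \<noteq> p" for l
  proof -
    have "padic_abs l (of_nat p ^ m) = 1"
      using padic_abs_prime[OF p l(1)] l by (simp add: padic_abs_power)
    then have "padic_abs l q = padic_abs l (of_nat c)"
      using padic_abs_mult[OF l(1), of "of_nat p ^ m" q] p0 by (simp add: q_def)
    then show ?thesis using padic_abs_of_nat_le[OF l(1)] by simp
  qed
  ultimately show ?thesis using that by blast
qed

lemma adele_of_rat_uminus: "adele_of_rat (- q) = - adele_of_rat q"
  using adele_of_rat_hom(3)[of q "- q"] adele_of_rat_hom(1) by (simp add: minus_unique)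

lemma adele_at_diff:
  "prime p \<Longrightarrow> adele_at (a - b) p = adele_at a p \<ominus>\<^bsub>padic_field p\<^esub> adele_at b p"
  by (simp add: a_minus_def diff_conv_add_uminus del: add_uminus_conv_diff)

lemma adele_inf_diff: "adele_inf (a - b) = adele_inf a - adele_inf b"
  by (simp add: diff_conv_add_uminus del: add_uminus_conv_diff)

text \<open>The finitely many primes at which \<open>x\<close> is not integral are removed one at a time, each without
spoiling another. The remaining freedom, an integer, is used to bring the real component into
\<open>[0,1]\<close>.\<close>

theorem adele_strong_approximation:
  obtains q where "x - adele_of_rat q \<in> adele_unit_box"
proof -
  let ?B = "\<lambda>x. {p. prime p \<and> adele_at x p \<notin> carrier (padic_ints p)}"
  have "\<exists>q. ?B (x - adele_of_rat q) = {}"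
  proof (induction "card (?B x)" arbitrary: x rule: less_induct)
    case less
    show ?case
    proof (cases "?B x = {}")
      case True
      then show ?thesis by (intro exI[of _ 0]) (simp add: adele_of_rat_hom)
    next
      case False
      then obtain p where p: "prime p" "adele_at x p \<notin> carrier (padic_ints p)" by auto
      obtain q where q: "adele_at x p \<ominus>\<^bsub>padic_field p\<^esub> padic_of_rat p q \<in> carrier (padic_ints p)"
        "\<And>l. prime l \<Longrightarrow> l \<noteq> p \<Longrightarrow> padic_abs l q \<le> 1"
        using padic_fractional_part[OF p(1) adele_at_in[OF p(1)]] by blast
      have "adele_at (x - adele_of_rat q) l \<in> carrier (padic_ints l)"
        if l: "prime l" "l \<noteq> p" "adele_at x l \<in> carrier (padic_ints l)" for l
      proof -
        have "padic_of_rat l q \<in> carrier (padic_ints l)"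
          using q(2)[OF l(1,2)] by (simp add: carrier_padic_ints padic_norm_of_rat[OF l(1)])
        then show ?thesis using padic_ints_add[OF l(1) l(3) padic_ints_inv[OF l(1)]]
          by (simp only: adele_at_diff[OF l(1)] a_minus_def adele_at_simps(4)[OF l(1)])
      qed
      moreover have "adele_at (x - adele_of_rat q) p \<in> carrier (padic_ints p)"
        using q(1) p by (simp add: adele_at_diff)
      ultimately have "?B (x - adele_of_rat q) \<subset> ?B x" using p by blast
      then have "card (?B (x - adele_of_rat q)) < card (?B x)"
        using adele_at_finite by (intro psubset_card_mono)
      then obtain r where "?B (x - adele_of_rat q - adele_of_rat r) = {}" using less by blast
      then show ?thesis
        by (intro exI[of _ "q + r"]) (simp add: adele_of_rat_hom diff_diff_eq)
    qed
  qed
  then obtain q where q: "?B (x - adele_of_rat q) = {}" by blast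
  define n where "n = \<lfloor>adele_inf (x - adele_of_rat q)\<rfloor>"
  let ?z = "x - adele_of_rat q - adele_of_rat (of_int n)"
  have "adele_inf ?z \<in> {0..1}"
    unfolding adele_inf_diff[of "x - adele_of_rat q"] by (simp add: n_def) linarith
  moreover have "adele_at ?z p \<in> carrier (padic_ints p)" if p: "prime p" for p
  proof -
    have 1: "padic_of_rat p (of_int n) \<in> carrier (padic_ints p)"
      using padic_abs_of_int_le[OF p] by (simp add: carrier_padic_ints padic_norm_of_rat[OF p])
    have 2: "adele_at (x - adele_of_rat q) p \<in> carrier (padic_ints p)" using q p by blast
    show ?thesis using padic_ints_add[OF p 2 padic_ints_inv[OF p 1 1]]
      by (simp only: adele_at_diff[OF p, of "x - adele_of_rat q"] a_minus_def adele_at_simps(4)[OF p])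
  qed
  ultimately have "x - adele_of_rat (q + of_int n) \<in> adele_unit_box"
    by (simp add: adele_unit_box_def adele_box_def adele_of_rat_hom diff_diff_eq)
  then show ?thesis using that by blast
qed

lemma rat_integral_everywhere:
  assumes "\<And>p. prime p \<Longrightarrow> padic_abs p q \<le> 1"
  obtains n where "q = of_int n"
proof -
  obtain a b where ab: "quotient_of q = (a, b)" by (cases "quotient_of q")
  have b: "b > 0" using quotient_of_denom_pos[OF ab] .
  have "b = 1"
  proof (rule ccontr)
    assume "b \<noteq> 1"
    then obtain l where l: "prime l" "l dvd nat b"
      using b prime_factor_nat[of "nat b"] by (metis int_nat_eq order_less_imp_le of_nat_1)
    then have "int l dvd b" using b by (metis int_dvd_int_iff int_nat_eq order_less_imp_le)
    then show False using padic_abs_le_1_not_dvd_denominator[OF l(1) ab assms[OF l(1)]] by blast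
  qed
  then show ?thesis using that quotient_of_div[OF ab] by simp
qed

text \<open>If \<open>|q|\<close> is \<open>p^n\<close> at \<open>p\<close>, then \<open>q p^n\<close> is a unit at every prime. It and its inverse are then
integers, and it is positive, so it is 1.\<close>

lemma rat_unit_outside_p:
  assumes p: "prime p" and q: "q > 0" and u: "\<And>l. prime l \<Longrightarrow> l \<noteq> p \<Longrightarrow> padic_abs l q = 1"
  obtains n where "q = of_nat p powi n"
proof -
  obtain n where n: "padic_abs p q = real p powi n" using q by (auto simp: padic_abs_def)
  have p0: "p > 0" using prime_gt_0_nat[OF p] .
  define r where "r = q * of_nat p powi n"
  have r: "r > 0" using q p0 by (simp add: r_def)
  have abs_r: "padic_abs l r = 1" if l: "prime l" for l
  proof (cases "l = p")
    case True
    then show ?thesis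
      using n p0 by (simp add: r_def padic_abs_mult[OF p] padic_abs_power_int[OF p] padic_abs_prime[OF p p]
          power_int_divide_distrib)
  next
    case False
    then show ?thesis
      using u[OF l False] l by (simp add: r_def padic_abs_mult padic_abs_power_int padic_abs_prime[OF p l])
  qed
  obtain a where a: "r = of_int a" using rat_integral_everywhere[of r] abs_r by (metis order_refl)
  obtain b where b: "inverse r = of_int b"
    using rat_integral_everywhere[of "inverse r"] abs_r by (metis inverse_1 order_refl padic_abs_inverse)
  have "of_int (a * b) = (1::rat)" using a b r by (metis of_int_mult less_irrefl right_inverse)
  then have "a * b = 1" by (metis of_int_eq_1_iff)
  then have "a = 1" using a r by (auto simp: zmult_eq_1_iff)
  then have "q * of_nat p powi n = 1" using a by (simp add: r_def)
  then have "q = of_nat p powi (- n)" using p0 by (simp add: power_int_minus field_simps)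
  then show ?thesis using that by blast
qed

section \<open>Quotient maps\<close>

text \<open>The hypothesis says that saturating an open set leaves it open. It holds whenever the fibres of
\<open>q\<close> are the orbits of a group of homeomorphisms, and this is how it is used below.\<close>

lemma open_map_quotient_topology:
  assumes "\<And>S. openin X S \<Longrightarrow> openin X {x \<in> topspace X. \<exists>y\<in>S. q x = q y}"
  shows "open_map X (quotient_topology X q) q"
  unfolding open_map_def
proof (intro allI impI)
  fix S assume S: "openin X S"
  have "{x \<in> topspace X. q x \<in> q ` S} = {x \<in> topspace X. \<exists>y\<in>S. q x = q y}" by auto
  then show "openin (quotient_topology X q) (q ` S)"
    using assms[OF S] openin_subset[OF S] by (auto simp: openin_quotient_topology)
qed

lemma open_map_prod_top:
  assumes f: "open_map X X' f" and g: "open_map Y Y' g"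
  shows "open_map (prod_topology X Y) (prod_topology X' Y') (\<lambda>(x, y). (f x, g y))"
  unfolding open_map_def
proof (intro allI impI)
  fix S assume S: "openin (prod_topology X Y) S"
  show "openin (prod_topology X' Y') ((\<lambda>(x, y). (f x, g y)) ` S)"
    unfolding openin_prod_topology_alt
  proof (intro allI impI)
    fix a b assume "(a, b) \<in> (\<lambda>(x, y). (f x, g y)) ` S"
    then obtain x y where xy: "(x, y) \<in> S" "a = f x" "b = g y" by auto
    obtain U V where UV: "openin X U" "openin Y V" "x \<in> U" "y \<in> V" "U \<times> V \<subseteq> S"
      using S[unfolded openin_prod_topology_alt, rule_format, OF xy(1)] by (elim exE conjE)
    show "\<exists>U V. openin X' U \<and> openin Y' V \<and> a \<in> U \<and> b \<in> V \<and> U \<times> V \<subseteq> (\<lambda>(x, y). (f x, g y)) ` S"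
    proof (intro exI conjI)
      show "openin X' (f ` U)" "openin Y' (g ` V)" using f g UV(1,2) by (simp_all add: open_map_def)
      show "a \<in> f ` U" "b \<in> g ` V" using UV(3,4) xy by auto
      show "f ` U \<times> g ` V \<subseteq> (\<lambda>(x, y). (f x, g y)) ` S" using UV(5) by force
    qed
  qed
qed

text \<open>Each of the two quotient maps factors through the other, and the two factors are inverse to each
other.\<close>

lemma quotient_maps_same_fibres:
  assumes f: "quotient_map X Y f" and g: "quotient_map X Z g"
    and fib: "\<And>x x'. x \<in> topspace X \<Longrightarrow> x' \<in> topspace X \<Longrightarrow> f x = f x' \<longleftrightarrow> g x = g x'"
  obtains h where "homeomorphic_map Y Z h" "\<And>x. x \<in> topspace X \<Longrightarrow> h (f x) = g x"
proof -
  obtain h where h: "continuous_map Y Z h" "\<And>x. x \<in> topspace X \<Longrightarrow> h (f x) = g x"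
    using quotient_map_lift_exists[OF f quotient_imp_continuous_map[OF g]] fib by metis
  obtain k where k: "continuous_map Z Y k" "\<And>x. x \<in> topspace X \<Longrightarrow> k (g x) = f x"
    using quotient_map_lift_exists[OF g quotient_imp_continuous_map[OF f]] fib by metis
  have "homeomorphic_maps Y Z h k"
    using h k quotient_imp_surjective_map[OF f] quotient_imp_surjective_map[OF g]
    unfolding homeomorphic_maps_def by (metis (no_types, lifting) imageE)
  then show ?thesis using that h(2) homeomorphic_maps_map by blast
qed

section \<open>The adeles modulo the rationals\<close>

lemma mem_Q_coset: "y \<in> Q_coset x \<longleftrightarrow> (\<exists>q. y = x + adele_of_rat q)"
  by (auto simp: Q_coset_def)

lemma Q_coset_eq_iff: "Q_coset x = Q_coset y \<longleftrightarrow> (\<exists>q. y = x + adele_of_rat q)"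
proof
  assume "Q_coset x = Q_coset y"
  moreover have "y \<in> Q_coset y"
    unfolding mem_Q_coset by (rule exI[of _ 0]) (simp add: adele_of_rat_hom)
  ultimately show "\<exists>q. y = x + adele_of_rat q" using mem_Q_coset by metis
next
  assume "\<exists>q. y = x + adele_of_rat q"
  then obtain q where q: "y = x + adele_of_rat q" by blast
  have "x + adele_of_rat r = y + adele_of_rat (r - q)" "y + adele_of_rat r = x + adele_of_rat (q + r)" for r
    using adele_of_rat_hom(3)[of q "r - q"] by (simp_all add: q adele_of_rat_hom(3) add.assoc)
  then show "Q_coset x = Q_coset y" unfolding set_eq_iff mem_Q_coset by metis
qed

lemma topspace_adele_mod_Q: "topspace adele_mod_Q = range Q_coset"
  by (simp add: adele_mod_Q_def)

lemma open_translate: "open S \<Longrightarrow> open ((+) (b::adele) ` S)"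
proof -
  assume "open S"
  then have "open ((+) (- b) -` S)" using continuous_adele_translate by (rule open_vimage)
  moreover have "(+) b ` S = (+) (- b) -` S" by (force simp: image_iff)
  ultimately show ?thesis by simp
qed

lemma open_map_Q_coset: "open_map euclidean adele_mod_Q Q_coset"
  unfolding adele_mod_Q_def
proof (rule open_map_quotient_topology)
  fix S :: "adele set" assume "openin euclidean S"
  then have "open (\<Union>q. (+) (adele_of_rat q) ` S)" using open_translate by auto
  moreover have "{x \<in> topspace euclidean. \<exists>y\<in>S. Q_coset x = Q_coset y} = (\<Union>q. (+) (adele_of_rat q) ` S)"
  proof -
    have "(\<exists>y\<in>S. Q_coset x = Q_coset y) \<longleftrightarrow> (\<exists>q. \<exists>y\<in>S. x = adele_of_rat q + y)" for x
      using Q_coset_eq_iff[of _ x] by (metis add.commute)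
    note eq = this
    show ?thesis
      by (intro Set.set_eqI) (simp only: mem_Collect_eq topspace_euclidean UNIV_I simp_thms UN_iff image_iff bex_UNIV eq)
  qed
  ultimately show "openin euclidean {x \<in> topspace euclidean. \<exists>y\<in>S. Q_coset x = Q_coset y}" by simp
qed

lemma quotient_map_Q_coset: "quotient_map euclidean adele_mod_Q Q_coset"
  unfolding adele_mod_Q_def by (rule quotient_map_quotient_topology)

lemma compact_space_adele_mod_Q: "compact_space adele_mod_Q"
proof -
  have "topspace adele_mod_Q \<subseteq> Q_coset ` adele_unit_box"
  proof
    fix C assume "C \<in> topspace adele_mod_Q"
    then obtain x where x: "C = Q_coset x" by (auto simp: topspace_adele_mod_Q)
    obtain q where q: "x - adele_of_rat q \<in> adele_unit_box" by (rule adele_strong_approximation)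
    have "Q_coset (x - adele_of_rat q) = Q_coset x" unfolding Q_coset_eq_iff by (intro exI[of _ q]) simp
    then show "C \<in> Q_coset ` adele_unit_box" using q x by blast
  qed
  then have "topspace adele_mod_Q = Q_coset ` adele_unit_box" by (auto simp: topspace_adele_mod_Q)
  moreover have "compactin adele_mod_Q (Q_coset ` adele_unit_box)"
    using compact_adele_unit_box quotient_imp_continuous_map[OF quotient_map_Q_coset]
    by (intro image_compactin) auto
  ultimately show ?thesis by (simp add: compact_space_def)
qed

text \<open>The rationals are discrete in the adeles.\<close>

lemma rat_in_small_adele_box_eq_0:
  assumes "\<bar>adele_inf (adele_of_rat q)\<bar> < 1"
    and "\<And>p. prime p \<Longrightarrow> adele_at (adele_of_rat q) p \<in> carrier (padic_ints p)"
  shows "q = 0"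
proof -
  obtain n where n: "q = of_int n"
    using assms(2) by (auto simp: carrier_padic_ints padic_norm_of_rat intro: rat_integral_everywhere[of q])
  have "adele_inf (adele_of_rat q) = real_of_int n" by (simp only: n adele_inf_simps of_rat_of_int_eq)
  then have "\<bar>real_of_int n\<bar> < 1" using assms(1) by (simp only:)
  then have "n = 0" by linarith
  then show ?thesis using n by simp
qed

text \<open>Differences of elements of a box of radius \<open>1/4\<close> lie in a box of radius \<open>1/2\<close>, which
contains \<open>d - q\<close> for at most one rational \<open>q\<close>, by discreteness. So only one nonzero difference
has to be excluded, which is done by shrinking the box at a single place.\<close>

lemma adele_separate_from_rat:
  assumes d: "\<And>q. d \<noteq> adele_of_rat q"
  obtains W where "open W" "0 \<in> W"
    "\<And>v w q. v \<in> W \<Longrightarrow> w \<in> W \<Longrightarrow> d - adele_of_rat q \<noteq> v - w"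
proof -
  define B where "B \<epsilon> = adele_box {-\<epsilon><..<\<epsilon>} (\<lambda>p. carrier (padic_ints p))" for \<epsilon>
  have zero: "\<zero>\<^bsub>padic_field p\<^esub> \<in> carrier (padic_ints p)" "padic_norm p \<zero>\<^bsub>padic_field p\<^esub> = 0" if p: "prime p" for p
    using padic_norm_of_rat[OF p, of 0] padic_of_rat_in[of p 0]
    by (simp_all add: carrier_padic_ints padic_field_zero[OF p] padic_of_rat_class)
  have openB: "open (B \<epsilon>)" for \<epsilon>
    unfolding B_def using openin_padic_ints by (intro open_adele_box) auto
  have diffB: "v - w \<in> B (\<epsilon> + \<delta>)" if "v \<in> B \<epsilon>" "w \<in> B \<delta>" for v w \<epsilon> \<delta>
  proof -
    have "adele_at (v - w) p \<in> carrier (padic_ints p)" if p: "prime p" for p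
    proof -
      have "adele_at v p \<in> carrier (padic_ints p)" "adele_at w p \<in> carrier (padic_ints p)"
        using \<open>v \<in> B \<epsilon>\<close> \<open>w \<in> B \<delta>\<close> p by (auto simp: B_def adele_box_def)
      then show ?thesis
        using padic_ints_add[OF p] padic_ints_inv[OF p] by (simp add: adele_at_diff[OF p] a_minus_def)
    qed
    then show ?thesis using that by (auto simp: B_def adele_box_def adele_inf_diff)
  qed
  show ?thesis
  proof (cases "\<exists>q. d - adele_of_rat q \<in> B (1/2)")
    case False
    have "0 \<in> B (1/4)" using zero by (simp add: B_def adele_box_def)
    moreover have "d - adele_of_rat q \<noteq> v - w" if "v \<in> B (1/4)" "w \<in> B (1/4)" for v w q
    proof
      assume "d - adele_of_rat q = v - w"
      moreover have "v - w \<in> B (1/2)" using diffB[OF that] by simp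
      ultimately have "d - adele_of_rat q \<in> B (1/2)" by simp
      then show False using False by blast
    qed
    ultimately show ?thesis using that openB by blast
  next
    case True
    then obtain q0 where q0: "d - adele_of_rat q0 \<in> B (1/2)" by blast
    let ?e = "d - adele_of_rat q0"
    have unique: "q = q0" if "d - adele_of_rat q \<in> B (1/2)" for q
    proof -
      have "adele_of_rat (q - q0) = ?e - (d - adele_of_rat q)"
        using adele_of_rat_hom(3)[of "q - q0" q0] by (simp add: algebra_simps)
      then have "adele_of_rat (q - q0) \<in> B 1" using diffB[OF q0 that] by simp
      then have "q - q0 = 0"
        by (intro rat_in_small_adele_box_eq_0)
          (auto simp: B_def adele_box_def abs_less_iff simp del: adele_inf_simps(4) adele_at_simps(4))
      then show ?thesis by simp
    qed
    have main: "d - adele_of_rat q \<noteq> v - w"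
      if "v \<in> B (1/4)" "w \<in> B (1/4)" "v - w \<noteq> ?e" for v w q
    proof
      assume eq: "d - adele_of_rat q = v - w"
      moreover have "v - w \<in> B (1/2)" using diffB[OF that(1,2)] by simp
      ultimately have "q = q0" by (intro unique) simp
      then show False using eq that(3) by simp
    qed
    have "?e \<noteq> 0" using d[of q0] by simp
    then consider "adele_inf ?e \<noteq> 0" | l where "prime l" "adele_at ?e l \<noteq> \<zero>\<^bsub>padic_field l\<^esub>"
      using adele_eqI[of ?e 0] by auto
    then show ?thesis
    proof cases
      case 1
      define \<epsilon> where "\<epsilon> = min (1/4) (\<bar>adele_inf ?e\<bar> / 2)"
      have \<epsilon>: "\<epsilon> > 0" "\<epsilon> \<le> 1/4" "2 * \<epsilon> \<le> \<bar>adele_inf ?e\<bar>" using 1 by (auto simp: \<epsilon>_def)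
      have "0 \<in> B \<epsilon>" using zero \<epsilon> by (simp add: B_def adele_box_def)
      moreover have "d - adele_of_rat q \<noteq> v - w" if "v \<in> B \<epsilon>" "w \<in> B \<epsilon>" for v w q
      proof (rule main)
        show "v \<in> B (1/4)" "w \<in> B (1/4)" using that \<epsilon> by (auto simp: B_def adele_box_def)
        have "\<bar>adele_inf (v - w)\<bar> < 2 * \<epsilon>" using that by (auto simp: B_def adele_box_def adele_inf_diff)
        then show "v - w \<noteq> ?e" using \<epsilon> by auto
      qed
      ultimately show ?thesis using that openB by blast
    next
      case (2 l)
      interpret cring "padic_field l" by (rule padic_field_cring[OF 2(1)])
      define r where "r = padic_norm l (adele_at ?e l)"
      have r: "r > 0" using 2 padic_norm_eq_0[OF 2(1)] padic_norm_nonneg[OF 2(1)] adele_at_in[OF 2(1)]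
        by (metis less_eq_real_def r_def)
      have "adele_at ?e l \<in> carrier (padic_ints l)" using q0 2(1) by (auto simp: B_def adele_box_def)
      then have r1: "r \<le> 1" by (simp add: r_def carrier_padic_ints)
      let ?V = "\<lambda>p. if p = l then {x \<in> carrier (padic_field p). padic_norm p x < r} else carrier (padic_ints p)"
      let ?W = "adele_box {-1/4<..<1/4} ?V"
      have "open ?W"
      proof (rule open_adele_box)
        show "openin (padic_topology p) (?V p)" if "prime p" for p
          using openin_padic_ball[OF that] openin_padic_ints[OF that] by (cases "p = l") simp_all
        show "finite {p. prime p \<and> ?V p \<noteq> carrier (padic_ints p)}"
          by (rule finite_subset[of _ "{l}"]) auto
      qed simp
      moreover have "0 \<in> ?W" using zero r 2(1) by (auto simp: adele_box_def carrier_padic_ints)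
      moreover have "d - adele_of_rat q \<noteq> v - w" if v: "v \<in> ?W" and w: "w \<in> ?W" for v w q
      proof (rule main)
        have "?W \<subseteq> B (1/4)" using r1 by (auto simp: B_def adele_box_def carrier_padic_ints split: if_splits)
        then show "v \<in> B (1/4)" "w \<in> B (1/4)" using v w by auto
        have vw: "adele_at v l \<in> carrier (padic_field l)" "padic_norm l (adele_at v l) < r"
          "adele_at w l \<in> carrier (padic_field l)" "padic_norm l (adele_at w l) < r"
          using v w 2(1) by (auto simp: adele_box_def)
        then have "padic_norm l (adele_at (v - w) l) < r"
          using padic_norm_add[OF 2(1) vw(1), of "\<ominus>\<^bsub>padic_field l\<^esub> adele_at w l"] padic_norm_neg[OF 2(1) vw(3)]
          by (simp add: adele_at_diff[OF 2(1)] a_minus_def)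
        then show "v - w \<noteq> ?e" by (auto simp: r_def)
      qed
      ultimately show ?thesis using that by blast
    qed
  qed
qed

lemma Hausdorff_space_adele_mod_Q: "Hausdorff_space adele_mod_Q"
  unfolding Hausdorff_space_def
proof (intro allI impI)
  fix C D assume CD: "C \<in> topspace adele_mod_Q \<and> D \<in> topspace adele_mod_Q \<and> C \<noteq> D"
  then obtain x y where xy: "C = Q_coset x" "D = Q_coset y" by (auto simp: topspace_adele_mod_Q)
  have "y - x \<noteq> adele_of_rat q" for q
    using CD xy Q_coset_eq_iff[of x y] by (metis add.commute diff_add_cancel)
  then obtain W where W: "open W" "0 \<in> W"
    "\<And>v w q. v \<in> W \<Longrightarrow> w \<in> W \<Longrightarrow> (y - x) - adele_of_rat q \<noteq> v - w"
    by (rule adele_separate_from_rat) blast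
  have "openin adele_mod_Q (Q_coset ` (+) z ` W)" for z
    using open_map_Q_coset open_translate[OF W(1)] by (simp add: open_map_def)
  moreover have "C \<in> Q_coset ` (+) x ` W" "D \<in> Q_coset ` (+) y ` W"
    unfolding xy using W(2) by (force simp: image_iff)+
  moreover have "disjnt (Q_coset ` (+) x ` W) (Q_coset ` (+) y ` W)"
  proof -
    have "Q_coset (x + v) \<noteq> Q_coset (y + w)" if "v \<in> W" "w \<in> W" for v w
    proof
      assume "Q_coset (x + v) = Q_coset (y + w)"
      then obtain q where "y + w = x + v + adele_of_rat q" unfolding Q_coset_eq_iff by blast
      then have "(y - x) - adele_of_rat q = v - w" by (simp add: algebra_simps)
      then show False using W(3) that by blast
    qed
    then show ?thesis unfolding disjnt_def by blast
  qed
  ultimately show "\<exists>U V. openin adele_mod_Q U \<and> openin adele_mod_Q V \<and> C \<in> U \<and> D \<in> V \<and> disjnt U V"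
    by blast
qed

section \<open>The adeles modulo the profinite units\<close>

lemma padic_ints_comm_monoid:
  assumes p: "prime p"
  shows "comm_monoid (padic_ints p)"
proof -
  interpret cring "padic_field p" by (rule padic_field_cring[OF p])
  have "\<one>\<^bsub>padic_field p\<^esub> \<in> carrier (padic_ints p)"
    using padic_norm_of_rat[OF p, of 1] p one_closed
    by (simp add: carrier_padic_ints flip: padic_of_rat_1)
  then have "\<one>\<^bsub>padic_ints p\<^esub> \<in> carrier (padic_ints p)" by (simp add: padic_ints_def)
  moreover have "x \<otimes>\<^bsub>padic_ints p\<^esub> y = x \<otimes>\<^bsub>padic_field p\<^esub> y" "\<one>\<^bsub>padic_ints p\<^esub> = \<one>\<^bsub>padic_field p\<^esub>" for x y
    by (simp_all add: padic_ints_def)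
  moreover have "x \<in> carrier (padic_field p)" if "x \<in> carrier (padic_ints p)" for x
    using that by (simp add: carrier_padic_ints)
  ultimately show ?thesis
    by (intro comm_monoidI) (simp_all add: padic_ints_mult[OF p] m_ac)
qed

lemma padic_ints_Units:
  assumes p: "prime p"
  shows padic_ints_Units_one: "\<one>\<^bsub>padic_field p\<^esub> \<in> Units (padic_ints p)"
    and padic_ints_Units_mult: "\<And>x y. x \<in> Units (padic_ints p) \<Longrightarrow> y \<in> Units (padic_ints p) \<Longrightarrow>
      x \<otimes>\<^bsub>padic_field p\<^esub> y \<in> Units (padic_ints p)"
    and padic_ints_Units_inv: "\<And>x. x \<in> Units (padic_ints p) \<Longrightarrow>
      inv\<^bsub>padic_ints p\<^esub> x \<in> Units (padic_ints p) \<and> x \<otimes>\<^bsub>padic_field p\<^esub> inv\<^bsub>padic_ints p\<^esub> x = \<one>\<^bsub>padic_field p\<^esub>"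
proof -
  interpret comm_monoid "padic_ints p" by (rule padic_ints_comm_monoid[OF p])
  have ops: "mult (padic_ints p) = mult (padic_field p)" "one (padic_ints p) = one (padic_field p)"
    by (simp_all add: padic_ints_def)
  show "\<one>\<^bsub>padic_field p\<^esub> \<in> Units (padic_ints p)" using Units_one_closed by (simp add: ops)
  show "x \<otimes>\<^bsub>padic_field p\<^esub> y \<in> Units (padic_ints p)"
    if "x \<in> Units (padic_ints p)" "y \<in> Units (padic_ints p)" for x y
    using Units_m_closed[OF that] by (simp add: ops)
  show "inv\<^bsub>padic_ints p\<^esub> x \<in> Units (padic_ints p) \<and> x \<otimes>\<^bsub>padic_field p\<^esub> inv\<^bsub>padic_ints p\<^esub> x = \<one>\<^bsub>padic_field p\<^esub>"
    if "x \<in> Units (padic_ints p)" for x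
    using Units_inv_Units[OF that] Units_r_inv[OF that] by (simp add: ops)
qed

lemma Units_padic_ints_subset: "Units (padic_ints p) \<subseteq> carrier (padic_ints p)"
  by (auto simp: Units_def)

lemma adele_of_units_in_Zhat_units:
  assumes f: "\<And>p. prime p \<Longrightarrow> f p \<in> Units (padic_ints p)"
  shows "adele_of_components 1 f \<in> Zhat_units" "prime p \<Longrightarrow> adele_at (adele_of_components 1 f) p = f p"
proof -
  have "{p. prime p \<and> f p \<notin> carrier (padic_ints p)} = {}" using f Units_padic_ints_subset by auto
  then have fin: "finite {p. prime p \<and> f p \<notin> carrier (padic_ints p)}" by (simp only: finite.emptyI)
  have "f p \<in> carrier (padic_field p)" if "prime p" for p using Units_padic_ints_norm[OF that f[OF that]] by simp
  note c = adele_of_components[OF this fin]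
  show "adele_of_components 1 f \<in> Zhat_units" using c f by (simp add: Zhat_units_def)
  show "prime p \<Longrightarrow> adele_at (adele_of_components 1 f) p = f p" using c by simp
qed

lemma one_in_Zhat_units: "1 \<in> Zhat_units"
  using padic_ints_Units_one by (simp add: Zhat_units_def)

lemma Zhat_units_mult: "u \<in> Zhat_units \<Longrightarrow> v \<in> Zhat_units \<Longrightarrow> u * v \<in> Zhat_units"
  using padic_ints_Units_mult by (simp add: Zhat_units_def)

lemma Zhat_units_inverse:
  assumes u: "u \<in> Zhat_units"
  obtains v where "v \<in> Zhat_units" "u * v = 1"
proof -
  let ?v = "adele_of_components 1 (\<lambda>p. inv\<^bsub>padic_ints p\<^esub> adele_at u p)"
  have U: "adele_at u p \<in> Units (padic_ints p)" if "prime p" for p using u that by (simp add: Zhat_units_def)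
  note v = adele_of_units_in_Zhat_units[of "\<lambda>p. inv\<^bsub>padic_ints p\<^esub> adele_at u p"]
  have "?v \<in> Zhat_units" using v U padic_ints_Units_inv by blast
  moreover have "u * ?v = 1"
  proof (rule adele_eqI)
    show "adele_inf (u * ?v) = adele_inf 1" using u \<open>?v \<in> Zhat_units\<close> by (simp add: Zhat_units_def)
    show "adele_at (u * ?v) p = adele_at 1 p" if "prime p" for p
      using v(2)[of p] U padic_ints_Units_inv that by simp
  qed
  ultimately show ?thesis using that by blast
qed

lemma Zhat_class_eq_iff: "Zhat_class y = Zhat_class z \<longleftrightarrow> (\<exists>u\<in>Zhat_units. z = y * u)"
proof
  assume "Zhat_class y = Zhat_class z"
  moreover have "z \<in> Zhat_class z"
    using one_in_Zhat_units unfolding Zhat_class_def by (intro CollectI exI[of _ 1]) simp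
  ultimately have "z \<in> Zhat_class y" by simp
  then show "\<exists>u\<in>Zhat_units. z = y * u" by (auto simp: Zhat_class_def)
next
  assume "\<exists>u\<in>Zhat_units. z = y * u"
  then obtain u where u: "u \<in> Zhat_units" "z = y * u" by blast
  obtain v where v: "v \<in> Zhat_units" "u * v = 1" by (rule Zhat_units_inverse[OF u(1)])
  have "y * w = z * (v * w)" for w
    using v(2) by (metis mult.assoc mult.right_neutral mult_1 u(2))
  moreover have "z * w = y * (u * w)" for w by (simp add: u(2) mult.assoc)
  ultimately show "Zhat_class y = Zhat_class z"
    unfolding Zhat_class_def using Zhat_units_mult u(1) v(1) by blast
qed

lemma topspace_adele_mod_Zhat: "topspace adele_mod_Zhat = range Zhat_class"
  by (simp add: adele_mod_Zhat_def)

lemma quotient_map_Zhat_class: "quotient_map euclidean adele_mod_Zhat Zhat_class"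
  unfolding adele_mod_Zhat_def by (rule quotient_map_quotient_topology)

lemma open_map_Zhat_class: "open_map euclidean adele_mod_Zhat Zhat_class"
  unfolding adele_mod_Zhat_def
proof (rule open_map_quotient_topology)
  fix S :: "adele set" assume S: "openin euclidean S"
  have "{x \<in> topspace euclidean. \<exists>y\<in>S. Zhat_class x = Zhat_class y} = (\<Union>u\<in>Zhat_units. (*) u -` S)"
    by (auto simp: Zhat_class_eq_iff mult.commute)
  moreover have "open (\<Union>u\<in>Zhat_units. (*) u -` S)"
    using S continuous_adele_unit_mult by (intro open_UN ballI open_vimage) auto
  ultimately show "openin euclidean {x \<in> topspace euclidean. \<exists>y\<in>S. Zhat_class x = Zhat_class y}" by simp
qed

definition Pi_adeles :: "nat \<Rightarrow> adele set" where
  "Pi_adeles p = {a. (\<forall>l. prime l \<and> l \<noteq> p \<longrightarrow> adele_at a l \<in> Units (padic_ints l)) \<and>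
     adele_at a p = \<zero>\<^bsub>padic_field p\<^esub> \<and> adele_inf a > 0}"

lemma Pi_adeles_mult_unit:
  assumes p: "prime p" and a: "a \<in> Pi_adeles p" and u: "u \<in> Zhat_units"
  shows "a * u \<in> Pi_adeles p"
proof -
  interpret cring "padic_field p" by (rule padic_field_cring[OF p])
  show ?thesis
    using a u p adele_at_in[OF p] padic_ints_Units_mult by (auto simp: Pi_adeles_def Zhat_units_def)
qed

lemma Pi_classes_eq: "Pi_classes p = Zhat_class ` Pi_adeles p"
  by (auto simp: Pi_classes_def Pi_adeles_def)

lemma Zhat_class_in_Pi_classes:
  assumes p: "prime p"
  shows "Zhat_class y \<in> Pi_classes p \<longleftrightarrow> y \<in> Pi_adeles p"
proof
  assume "Zhat_class y \<in> Pi_classes p"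
  then obtain a where a: "a \<in> Pi_adeles p" "Zhat_class a = Zhat_class y" by (auto simp: Pi_classes_eq)
  then obtain u where "u \<in> Zhat_units" "y = a * u" by (auto simp: Zhat_class_eq_iff)
  then show "y \<in> Pi_adeles p" using Pi_adeles_mult_unit[OF p a(1)] by simp
qed (auto simp: Pi_classes_eq)

text \<open>The quotient \<open>b/a\<close> is a unit away from \<open>p\<close>. At \<open>p\<close> both components are 0, and any unit
serves there; 1 is chosen.\<close>

lemma Pi_adeles_Zhat_class_eq_iff:
  assumes p: "prime p" and a: "a \<in> Pi_adeles p" and b: "b \<in> Pi_adeles p"
  shows "Zhat_class a = Zhat_class b \<longleftrightarrow> adele_inf a = adele_inf b"
proof
  assume "Zhat_class a = Zhat_class b"
  then show "adele_inf a = adele_inf b" by (auto simp: Zhat_class_eq_iff Zhat_units_def)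
next
  assume inf: "adele_inf a = adele_inf b"
  let ?f = "\<lambda>l. if l = p then \<one>\<^bsub>padic_field p\<^esub>
    else inv\<^bsub>padic_ints l\<^esub> adele_at a l \<otimes>\<^bsub>padic_field l\<^esub> adele_at b l"
  have f: "?f l \<in> Units (padic_ints l)" if "prime l" for l
    using a b that padic_ints_Units_one padic_ints_Units_mult padic_ints_Units_inv by (auto simp: Pi_adeles_def)
  let ?u = "adele_of_components 1 ?f"
  have u1: "?u \<in> Zhat_units" by (rule adele_of_units_in_Zhat_units(1)[OF f])
  have u2: "adele_at ?u l = ?f l" if "prime l" for l by (rule adele_of_units_in_Zhat_units(2)[OF f that])
  have "b = a * ?u"
  proof (rule adele_eqI)
    show "adele_inf b = adele_inf (a * ?u)" using u1 inf by (simp add: Zhat_units_def)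
    show "adele_at b l = adele_at (a * ?u) l" if l: "prime l" for l
    proof -
      interpret cring "padic_field l" by (rule padic_field_cring[OF l])
      show ?thesis
      proof (cases "l = p")
        case True
        then show ?thesis using a b u2[OF l] l r_one[OF zero_closed] by (simp add: Pi_adeles_def)
      next
        case False
        then have ab: "adele_at a l \<in> Units (padic_ints l)" "adele_at b l \<in> Units (padic_ints l)"
          using a b l by (auto simp: Pi_adeles_def)
        note i = padic_ints_Units_inv[OF l ab(1)]
        have "inv\<^bsub>padic_ints l\<^esub> adele_at a l \<in> carrier (padic_field l)"
          using i Units_padic_ints_norm[OF l] by blast
        then show ?thesis using u2[OF l] l False i adele_at_in[OF l] by (simp flip: m_assoc)
      qed
    qed
  qed
  then show "Zhat_class a = Zhat_class b" using u1 Zhat_class_eq_iff by blast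
qed

lemma topspace_Pi_space: "topspace (Pi_space p) = Zhat_class ` Pi_adeles p"
  by (auto simp: Pi_space_def topspace_adele_mod_Zhat Pi_classes_eq)

lemma Zhat_class_Pi_space:
  assumes p: "prime p"
  shows open_map_Zhat_class_Pi_space: "open_map (top_of_set (Pi_adeles p)) (Pi_space p) Zhat_class"
    and continuous_map_Zhat_class_Pi_space: "continuous_map (top_of_set (Pi_adeles p)) (Pi_space p) Zhat_class"
proof -
  show "open_map (top_of_set (Pi_adeles p)) (Pi_space p) Zhat_class"
    unfolding Pi_space_def using Zhat_class_in_Pi_classes[OF p]
    by (intro open_map_restriction[OF open_map_Zhat_class]) auto
  show "continuous_map (top_of_set (Pi_adeles p)) (Pi_space p) Zhat_class"
    unfolding Pi_space_def
    using continuous_map_from_subtopology[OF quotient_imp_continuous_map[OF quotient_map_Zhat_class]]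
      Zhat_class_in_Pi_classes[OF p]
    by (auto simp: continuous_map_in_subtopology)
qed

definition pi_adele :: "nat \<Rightarrow> real \<Rightarrow> adele" where
  "pi_adele p t = adele_of_components t (\<lambda>l. if l = p then \<zero>\<^bsub>padic_field p\<^esub> else \<one>\<^bsub>padic_field l\<^esub>)"

lemma pi_adele_simps:
  assumes p: "prime p"
  shows "adele_inf (pi_adele p t) = t"
    and "prime l \<Longrightarrow> adele_at (pi_adele p t) l = (if l = p then \<zero>\<^bsub>padic_field p\<^esub> else \<one>\<^bsub>padic_field l\<^esub>)"
proof -
  let ?f = "\<lambda>l. if l = p then \<zero>\<^bsub>padic_field p\<^esub> else \<one>\<^bsub>padic_field l\<^esub>"
  have car: "?f l \<in> carrier (padic_field l)" if "prime l" for l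
  proof -
    interpret cring "padic_field l" by (rule padic_field_cring[OF that])
    show ?thesis using zero_closed one_closed by (cases "l = p") simp_all
  qed
  have "{l. prime l \<and> ?f l \<notin> carrier (padic_ints l)} \<subseteq> {p}"
    using padic_ints_Units_one Units_padic_ints_subset by auto
  then have fin: "finite {l. prime l \<and> ?f l \<notin> carrier (padic_ints l)}" by (rule finite_subset) simp
  show "adele_inf (pi_adele p t) = t" "prime l \<Longrightarrow> adele_at (pi_adele p t) l = ?f l"
    using adele_of_components[OF car fin] by (simp_all add: pi_adele_def)
qed

lemma pi_adele_in_Pi_adeles: "prime p \<Longrightarrow> t > 0 \<Longrightarrow> pi_adele p t \<in> Pi_adeles p"
  using padic_ints_Units_one by (simp add: Pi_adeles_def pi_adele_simps)

lemma continuous_pi_adele: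
  assumes p: "prime p"
  shows "continuous_map euclideanreal euclidean (pi_adele p)"
proof (rule continuous_map_into_adele)
  fix U :: "real set" and V :: "nat \<Rightarrow> padic set" assume U: "open U"
  have "{t \<in> topspace euclideanreal. pi_adele p t \<in> adele_box U V} =
      (if \<forall>l. prime l \<longrightarrow> (if l = p then \<zero>\<^bsub>padic_field p\<^esub> else \<one>\<^bsub>padic_field l\<^esub>) \<in> V l then U else {})"
    using pi_adele_simps[OF p] by (auto simp: adele_box_def)
  then show "openin euclideanreal {t \<in> topspace euclideanreal. pi_adele p t \<in> adele_box U V}"
    using U by (simp split: if_split)
qed

definition pi_class :: "nat \<Rightarrow> real \<Rightarrow> adele set" where
  "pi_class p t = Zhat_class (pi_adele p t)"

lemma continuous_pi_class:
  assumes p: "prime p"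
  shows "continuous_map (top_of_set {0<..}) (Pi_space p) (pi_class p)"
proof -
  have "continuous_map (top_of_set {0<..}) (top_of_set (Pi_adeles p)) (pi_adele p)"
    using continuous_map_from_subtopology[OF continuous_pi_adele[OF p]] pi_adele_in_Pi_adeles[OF p]
    by (auto simp: continuous_map_in_subtopology)
  then have "continuous_map (top_of_set {0<..}) (Pi_space p) (Zhat_class \<circ> pi_adele p)"
    using continuous_map_Zhat_class_Pi_space[OF p] by (rule continuous_map_compose)
  then show ?thesis by (simp add: pi_class_def[abs_def] comp_def)
qed

text \<open>The profinite units have real component 1, so all members of a class share their real component.\<close>

definition Zhat_level :: "adele set \<Rightarrow> real" where
  "Zhat_level C = adele_inf (SOME a. a \<in> C)"

lemma Zhat_level_class [simp]: "Zhat_level (Zhat_class y) = adele_inf y"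
proof -
  have "y \<in> Zhat_class y"
    using one_in_Zhat_units unfolding Zhat_class_def by (intro CollectI exI[of _ 1]) simp
  then have "(SOME a. a \<in> Zhat_class y) \<in> Zhat_class y" by (rule someI)
  then show ?thesis by (auto simp: Zhat_level_def Zhat_class_def Zhat_units_def)
qed

lemma continuous_Zhat_level: "continuous_map (Pi_space p) euclideanreal Zhat_level"
proof -
  have "continuous_map adele_mod_Zhat euclideanreal Zhat_level"
    using continuous_adele_inf
    by (intro continuous_compose_quotient_map[OF quotient_map_Zhat_class]) (simp add: comp_def)
  then show ?thesis unfolding Pi_space_def by (rule continuous_map_from_subtopology)
qed

text \<open>Together with the continuity of \<^term>\<open>Zhat_level\<close> and \<^term>\<open>pi_class p\<close>, this identifies
\<^term>\<open>Pi_space p\<close> with the positive reals.\<close>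

lemma Pi_space_eq_pi_class:
  assumes p: "prime p" and C: "C \<in> topspace (Pi_space p)"
  shows "C = pi_class p (Zhat_level C)" "Zhat_level C > 0"
proof -
  obtain a where a: "a \<in> Pi_adeles p" "C = Zhat_class a" using C by (auto simp: topspace_Pi_space)
  then have pos: "adele_inf a > 0" by (simp add: Pi_adeles_def)
  then show "Zhat_level C > 0" using a by simp
  show "C = pi_class p (Zhat_level C)"
    unfolding a(2) pi_class_def
    using Pi_adeles_Zhat_class_eq_iff[OF p a(1) pi_adele_in_Pi_adeles[OF p pos]]
    by (simp add: pi_adele_simps(1)[OF p])
qed

lemma pi_class_in: "prime p \<Longrightarrow> t > 0 \<Longrightarrow> pi_class p t \<in> topspace (Pi_space p)"
  using pi_adele_in_Pi_adeles by (auto simp: pi_class_def topspace_Pi_space)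

lemma Zhat_level_pi_class: "prime p \<Longrightarrow> Zhat_level (pi_class p t) = t"
  by (simp add: pi_class_def pi_adele_simps(1))

section \<open>Multiplication of classes by rationals\<close>

lemma scale_class_scale_class: "scale_class r (scale_class s C) = scale_class (r * s) C"
  by (simp add: scale_class_def image_image adele_of_rat_hom mult.assoc)

lemma scale_class_1: "scale_class 1 C = C"
  by (simp add: scale_class_def adele_of_rat_hom)

lemma scale_class_Q_coset:
  assumes r: "r \<noteq> 0"
  shows "scale_class r (Q_coset x) = Q_coset (adele_of_rat r * x)"
proof -
  have 1: "adele_of_rat r * (x + adele_of_rat q) = adele_of_rat r * x + adele_of_rat (r * q)" for q
    by (simp add: adele_of_rat_hom distrib_left)
  have 2: "adele_of_rat r * x + adele_of_rat q = adele_of_rat r * (x + adele_of_rat (q / r))" for q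
    using 1[of "q / r"] r by simp
  show ?thesis unfolding scale_class_def
  proof (intro equalityI subsetI)
    fix y assume "y \<in> (*) (adele_of_rat r) ` Q_coset x"
    then show "y \<in> Q_coset (adele_of_rat r * x)" using 1 by (force simp: mem_Q_coset)
  next
    fix y assume "y \<in> Q_coset (adele_of_rat r * x)"
    then obtain q where "y = adele_of_rat r * (x + adele_of_rat (q / r))" using 2 by (auto simp: mem_Q_coset)
    then show "y \<in> (*) (adele_of_rat r) ` Q_coset x"
      by (intro image_eqI[of _ _ "x + adele_of_rat (q / r)"]) (auto simp: mem_Q_coset)
  qed
qed

lemma scale_class_Zhat_class: "scale_class r (Zhat_class y) = Zhat_class (adele_of_rat r * y)"
  by (auto simp: scale_class_def Zhat_class_def image_iff mult.assoc)

lemma continuous_map_scale_class_Q: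
  assumes r: "r \<noteq> 0"
  shows "continuous_map adele_mod_Q adele_mod_Q (scale_class r)"
proof -
  have "continuous_map euclidean adele_mod_Q (Q_coset \<circ> (*) (adele_of_rat r))"
    using continuous_adele_scale[OF r] quotient_imp_continuous_map[OF quotient_map_Q_coset]
    by (intro continuous_map_compose) auto
  then show ?thesis
    by (intro continuous_compose_quotient_map[OF quotient_map_Q_coset])
      (simp add: comp_def scale_class_Q_coset[OF r])
qed

lemma homeomorphic_maps_scale_class_Q:
  assumes r: "r \<noteq> 0"
  shows "homeomorphic_maps adele_mod_Q adele_mod_Q (scale_class r) (scale_class (inverse r))"
  unfolding homeomorphic_maps_def
  using r continuous_map_scale_class_Q[of r] continuous_map_scale_class_Q[of "inverse r"]
  by (simp add: scale_class_scale_class scale_class_1)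

lemma Pi_adeles_scale:
  assumes p: "prime p" and a: "a \<in> Pi_adeles p"
  shows "adele_of_rat (of_nat p powi n) * a \<in> Pi_adeles p"
proof -
  interpret cring "padic_field p" by (rule padic_field_cring[OF p])
  have "adele_at (adele_of_rat (of_nat p powi n)) l \<in> Units (padic_ints l)" if l: "prime l" "l \<noteq> p" for l
    using l padic_abs_prime[OF p l(1)] by (simp add: padic_of_rat_in_Units padic_abs_power_int)
  moreover have "(of_rat (of_nat p powi n) :: real) > 0"
    using prime_gt_0_nat[OF p] by (simp add: zero_less_power_int)
  ultimately show ?thesis
    using a p padic_ints_Units_mult by (simp add: Pi_adeles_def)
qed

lemma continuous_map_scale_class_Pi:
  assumes p: "prime p"
  shows "continuous_map (Pi_space p) (Pi_space p) (scale_class (of_nat p powi n))"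
proof -
  let ?r = "of_nat p powi n :: rat"
  have r: "?r \<noteq> 0" using prime_gt_0_nat[OF p] by simp
  have "continuous_map euclidean adele_mod_Zhat (Zhat_class \<circ> (*) (adele_of_rat ?r))"
    using continuous_adele_scale[OF r] quotient_imp_continuous_map[OF quotient_map_Zhat_class]
    by (intro continuous_map_compose) auto
  then have "continuous_map adele_mod_Zhat adele_mod_Zhat (scale_class ?r)"
    by (intro continuous_compose_quotient_map[OF quotient_map_Zhat_class])
      (simp add: comp_def scale_class_Zhat_class)
  then show ?thesis
    unfolding Pi_space_def continuous_map_in_subtopology
    using continuous_map_from_subtopology Pi_adeles_scale[OF p]
    by (auto simp: Pi_classes_eq scale_class_Zhat_class)
qed

lemma of_rat_power_int: "of_rat (q powi n) = (of_rat q :: 'a :: field_char_0) powi n"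
  by (simp add: power_int_def of_rat_power of_rat_inverse)

lemma scale_pi_class:
  assumes p: "prime p" and t: "t > 0"
  shows "scale_class (of_nat p powi n) (pi_class p t) = pi_class p (real p powi n * t)"
proof -
  have "real p powi n * t > 0" using t prime_gt_0_nat[OF p] by simp
  then show ?thesis
    unfolding pi_class_def scale_class_Zhat_class
    using Pi_adeles_Zhat_class_eq_iff[OF p Pi_adeles_scale[OF p pi_adele_in_Pi_adeles[OF p t]] pi_adele_in_Pi_adeles[OF p]]
    by (simp add: pi_adele_simps(1)[OF p] of_rat_power_int)
qed

section \<open>Orbits of the powers of p\<close>

definition pZ_act :: "nat \<Rightarrow> int \<Rightarrow> adele set \<times> adele set \<Rightarrow> adele set \<times> adele set" where
  "pZ_act p n = (\<lambda>(C, D). (scale_class (of_nat p powi n) C, scale_class (of_nat p powi n) D))"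

abbreviation pZ_space :: "nat \<Rightarrow> (adele set \<times> adele set) topology" where
  "pZ_space p \<equiv> prod_topology adele_mod_Q (Pi_space p)"

lemma pZ_orbit_eq_range: "pZ_orbit p c = range (\<lambda>n. pZ_act p n c)"
  by (auto simp: pZ_orbit_def pZ_act_def case_prod_beta)

lemma pZ_act_0: "pZ_act p 0 c = c"
  by (cases c) (simp add: pZ_act_def scale_class_1)

lemma pZ_act_add: "prime p \<Longrightarrow> pZ_act p m (pZ_act p n c) = pZ_act p (m + n) c"
  by (cases c) (auto simp: pZ_act_def scale_class_scale_class power_int_add prime_gt_0_nat)

lemma pZ_orbit_eq_iff:
  assumes p: "prime p"
  shows "pZ_orbit p c = pZ_orbit p d \<longleftrightarrow> (\<exists>n. d = pZ_act p n c)"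
proof
  assume "pZ_orbit p c = pZ_orbit p d"
  moreover have "d \<in> pZ_orbit p d" unfolding pZ_orbit_eq_range using pZ_act_0 by (metis rangeI)
  ultimately show "\<exists>n. d = pZ_act p n c" unfolding pZ_orbit_eq_range by auto
next
  assume "\<exists>n. d = pZ_act p n c"
  then obtain n where n: "d = pZ_act p n c" by blast
  have "pZ_act p m d = pZ_act p (m + n) c" "pZ_act p m c = pZ_act p (m - n) d" for m
    by (simp_all add: n pZ_act_add[OF p])
  then show "pZ_orbit p c = pZ_orbit p d"
    unfolding pZ_orbit_eq_range by (metis (no_types, lifting) image_eqI image_subsetI subset_antisym UNIV_I)
qed

lemma continuous_pZ_act:
  assumes p: "prime p"
  shows "continuous_map (pZ_space p) (pZ_space p) (pZ_act p n)"
  unfolding pZ_act_def continuous_map_prod_top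
  using continuous_map_scale_class_Q[of "of_nat p powi n"] continuous_map_scale_class_Pi[OF p] prime_gt_0_nat[OF p] by simp

lemma quotient_map_pZ_orbit: "quotient_map (pZ_space p) (Gamma_p p) (pZ_orbit p)"
  unfolding Gamma_p_def by (rule quotient_map_quotient_topology)

lemma open_map_pZ_orbit:
  assumes p: "prime p"
  shows "open_map (pZ_space p) (Gamma_p p) (pZ_orbit p)"
  unfolding Gamma_p_def
proof (rule open_map_quotient_topology)
  fix S assume S: "openin (pZ_space p) S"
  have "{c \<in> topspace (pZ_space p). \<exists>d\<in>S. pZ_orbit p c = pZ_orbit p d}
      = (\<Union>n. {c \<in> topspace (pZ_space p). pZ_act p n c \<in> S})"
    by (auto simp: pZ_orbit_eq_iff[OF p])
  moreover have "openin (pZ_space p) {c \<in> topspace (pZ_space p). pZ_act p n c \<in> S}" for n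
    using continuous_pZ_act[OF p] S by (rule openin_continuous_map_preimage)
  ultimately show "openin (pZ_space p) {c \<in> topspace (pZ_space p). \<exists>d\<in>S. pZ_orbit p c = pZ_orbit p d}"
    by auto
qed

section \<open>Double cosets of affine matrices\<close>

lemma P_matrix_nth [simp]:
  "P_matrix a b $ 1 $ 1 = a" "P_matrix a b $ 1 $ 2 = b" "P_matrix a b $ 2 $ 1 = 0" "P_matrix a b $ 2 $ 2 = 1"
  by (simp_all add: P_matrix_def)

lemma P_matrix_eq_iff: "P_matrix a b = P_matrix c d \<longleftrightarrow> a = c \<and> b = d"
  by (auto simp: vec_eq_iff forall_2)

lemma P_matrix_translates:
  "map_matrix adele_of_rat (P_matrix a b) ** P_matrix y x ** P_matrix u 0
    = P_matrix (adele_of_rat a * y * u) (adele_of_rat a * x + adele_of_rat b)"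
  by (simp add: vec_eq_iff forall_2 matrix_matrix_mult_def sum_2 adele_of_rat_hom)

lemma mem_double_coset_P_matrix:
  "N \<in> double_coset (P_matrix y x) \<longleftrightarrow>
    (\<exists>a b u. a \<noteq> 0 \<and> u \<in> Zhat_units \<and>
      N = P_matrix (adele_of_rat a * y * u) (adele_of_rat a * x + adele_of_rat b))"
proof
  assume "N \<in> double_coset (P_matrix y x)"
  then obtain g u where g: "g \<in> P_group" "u \<in> Zhat_units"
    "N = map_matrix adele_of_rat g ** P_matrix y x ** P_matrix u 0"
    by (auto simp: double_coset_def)
  obtain a b where ab: "a \<noteq> 0" "g = P_matrix a b" using g(1) by (auto simp: P_group_def dvd_field_iff)
  then have "N = P_matrix (adele_of_rat a * y * u) (adele_of_rat a * x + adele_of_rat b)"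
    using g(3) by (simp add: P_matrix_translates)
  then show "\<exists>a b u. a \<noteq> 0 \<and> u \<in> Zhat_units \<and>
      N = P_matrix (adele_of_rat a * y * u) (adele_of_rat a * x + adele_of_rat b)"
    using ab(1) g(2) by (intro exI conjI)
next
  assume "\<exists>a b u. a \<noteq> 0 \<and> u \<in> Zhat_units \<and>
      N = P_matrix (adele_of_rat a * y * u) (adele_of_rat a * x + adele_of_rat b)"
  then obtain a b u where a: "a \<noteq> 0" "u \<in> Zhat_units"
    "N = P_matrix (adele_of_rat a * y * u) (adele_of_rat a * x + adele_of_rat b)"
    by (elim exE conjE)
  have "P_matrix a b \<in> P_group" using a(1) unfolding P_group_def dvd_field_iff by auto
  moreover have "N = map_matrix adele_of_rat (P_matrix a b) ** P_matrix y x ** P_matrix u 0"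
    using a(3) by (simp add: P_matrix_translates)
  ultimately show "N \<in> double_coset (P_matrix y x)"
    unfolding double_coset_def using a(2) by (intro CollectI exI conjI)
qed

lemma double_coset_subset:
  assumes a: "a \<noteq> 0" and u: "u \<in> Zhat_units"
  shows "double_coset (P_matrix (adele_of_rat a * y * u) (adele_of_rat a * x + adele_of_rat b))
    \<subseteq> double_coset (P_matrix y x)"
proof
  fix N assume "N \<in> double_coset (P_matrix (adele_of_rat a * y * u) (adele_of_rat a * x + adele_of_rat b))"
  then obtain c d v where v: "c \<noteq> 0" "v \<in> Zhat_units"
    "N = P_matrix (adele_of_rat c * (adele_of_rat a * y * u) * v)
      (adele_of_rat c * (adele_of_rat a * x + adele_of_rat b) + adele_of_rat d)"
    by (auto simp: mem_double_coset_P_matrix)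
  then have "N = P_matrix (adele_of_rat (c * a) * y * (u * v)) (adele_of_rat (c * a) * x + adele_of_rat (c * b + d))"
    by (simp add: P_matrix_eq_iff adele_of_rat_hom algebra_simps)
  moreover have "c * a \<noteq> 0" "u * v \<in> Zhat_units" using a v u Zhat_units_mult by auto
  ultimately show "N \<in> double_coset (P_matrix y x)" unfolding mem_double_coset_P_matrix by blast
qed

text \<open>The inverse of the affine map \<open>a x + b\<close> and the inverse of \<open>u\<close> give the second inclusion.\<close>

lemma double_coset_eq_iff:
  "double_coset (P_matrix y x) = double_coset (P_matrix y' x') \<longleftrightarrow>
    (\<exists>a b u. a \<noteq> 0 \<and> u \<in> Zhat_units \<and>
      y' = adele_of_rat a * y * u \<and> x' = adele_of_rat a * x + adele_of_rat b)"
proof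
  assume "double_coset (P_matrix y x) = double_coset (P_matrix y' x')"
  moreover have "P_matrix y' x' \<in> double_coset (P_matrix y' x')"
    unfolding mem_double_coset_P_matrix using one_in_Zhat_units
    by (intro exI[of _ 1] exI[of _ 0]) (simp add: adele_of_rat_hom)
  ultimately show "\<exists>a b u. a \<noteq> 0 \<and> u \<in> Zhat_units \<and>
      y' = adele_of_rat a * y * u \<and> x' = adele_of_rat a * x + adele_of_rat b"
    using mem_double_coset_P_matrix[of "P_matrix y' x'" y x] by (simp add: P_matrix_eq_iff)
next
  assume "\<exists>a b u. a \<noteq> 0 \<and> u \<in> Zhat_units \<and>
      y' = adele_of_rat a * y * u \<and> x' = adele_of_rat a * x + adele_of_rat b"
  then obtain a b u where a: "a \<noteq> 0" and u: "u \<in> Zhat_units"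
    and y': "y' = adele_of_rat a * y * u" and x': "x' = adele_of_rat a * x + adele_of_rat b" by blast
  obtain v where v: "v \<in> Zhat_units" "u * v = 1" by (rule Zhat_units_inverse[OF u])
  have inv: "adele_of_rat (inverse a) * adele_of_rat a = 1"
    using a by (simp flip: adele_of_rat_hom)
  have "adele_of_rat (inverse a) * y' * v = (adele_of_rat (inverse a) * adele_of_rat a) * y * (u * v)"
    unfolding y' by (simp only: mult_ac)
  then have y: "y = adele_of_rat (inverse a) * y' * v" using inv v by simp
  have "adele_of_rat (inverse a) * x' + adele_of_rat (- (inverse a * b))
      = (adele_of_rat (inverse a) * adele_of_rat a) * x"
    unfolding x' by (simp add: adele_of_rat_uminus adele_of_rat_hom distrib_left mult.assoc)
  then have x: "x = adele_of_rat (inverse a) * x' + adele_of_rat (- (inverse a * b))" using inv by simp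
  have "double_coset (P_matrix y' x') \<subseteq> double_coset (P_matrix y x)"
    unfolding y' x' by (rule double_coset_subset[OF a u])
  moreover have "double_coset (P_matrix y x) \<subseteq> double_coset (P_matrix y' x')"
    by (subst y, subst x) (rule double_coset_subset, use a v in auto)
  ultimately show "double_coset (P_matrix y x) = double_coset (P_matrix y' x')" by blast
qed

lemma Pi_adeles_rational_multiple:
  assumes p: "prime p" and y: "y \<in> Pi_adeles p" and ay: "adele_of_rat a * y * u \<in> Pi_adeles p"
    and u: "u \<in> Zhat_units"
  obtains n where "a = of_nat p powi n"
proof -
  have "of_rat a * adele_inf y > 0" "adele_inf y > 0"
    using y ay u by (simp_all add: Pi_adeles_def Zhat_units_def)
  then have "(of_rat a :: real) > 0" by (simp add: zero_less_mult_iff)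
  then have "a > 0" by simp
  moreover have "padic_abs l a = 1" if l: "prime l" "l \<noteq> p" for l
  proof -
    have yl: "adele_at y l \<in> Units (padic_ints l)" and ul: "adele_at u l \<in> Units (padic_ints l)"
      and "adele_at (adele_of_rat a * y * u) l \<in> Units (padic_ints l)"
      using y ay u l by (auto simp: Pi_adeles_def Zhat_units_def)
    then have "padic_norm l (padic_of_rat l a \<otimes>\<^bsub>padic_field l\<^esub> adele_at y l \<otimes>\<^bsub>padic_field l\<^esub> adele_at u l) = 1"
      using Units_padic_ints_norm[OF l(1)] l(1) by simp
    moreover interpret cring "padic_field l" by (rule padic_field_cring[OF l(1)])
    have "padic_norm l (padic_of_rat l a \<otimes>\<^bsub>padic_field l\<^esub> adele_at y l \<otimes>\<^bsub>padic_field l\<^esub> adele_at u l)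
        = padic_abs l a * padic_norm l (adele_at y l) * padic_norm l (adele_at u l)"
      by (simp add: padic_norm_mult[OF l(1)] adele_at_in[OF l(1)] padic_norm_of_rat[OF l(1)])
    ultimately show ?thesis using Units_padic_ints_norm[OF l(1)] yl ul by simp
  qed
  ultimately show ?thesis using that by (rule rat_unit_outside_p[OF p])
qed

text \<open>The algebraic core: among the nonzero rationals \<open>a\<close> only powers of \<open>p\<close> can link two adeles of
this kind, and translation by \<open>b\<close> and multiplication by \<open>u\<close> are what the two classes forget.\<close>

lemma pZ_orbit_eq_iff_double_coset_eq:
  assumes p: "prime p" and y: "y \<in> Pi_adeles p" and y': "y' \<in> Pi_adeles p"
  shows "pZ_orbit p (Q_coset x, Zhat_class y) = pZ_orbit p (Q_coset x', Zhat_class y') \<longleftrightarrow>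
    double_coset (P_matrix y x) = double_coset (P_matrix y' x')"
proof -
  have p0: "of_nat p powi n \<noteq> (0::rat)" for n using prime_gt_0_nat[OF p] by simp
  have "pZ_orbit p (Q_coset x, Zhat_class y) = pZ_orbit p (Q_coset x', Zhat_class y') \<longleftrightarrow>
    (\<exists>n. Q_coset (adele_of_rat (of_nat p powi n) * x) = Q_coset x' \<and>
      Zhat_class (adele_of_rat (of_nat p powi n) * y) = Zhat_class y')"
    unfolding pZ_orbit_eq_iff[OF p] using p0
    by (auto simp: pZ_act_def scale_class_Q_coset scale_class_Zhat_class)
  also have "\<dots> \<longleftrightarrow> (\<exists>n b u. u \<in> Zhat_units \<and> y' = adele_of_rat (of_nat p powi n) * y * u \<and>
      x' = adele_of_rat (of_nat p powi n) * x + adele_of_rat b)"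
    unfolding Q_coset_eq_iff Zhat_class_eq_iff by blast
  also have "\<dots> \<longleftrightarrow> (\<exists>a b u. a \<noteq> 0 \<and> u \<in> Zhat_units \<and>
      y' = adele_of_rat a * y * u \<and> x' = adele_of_rat a * x + adele_of_rat b)"
    using p0 Pi_adeles_rational_multiple[OF p y] y' by metis
  finally show ?thesis by (simp only: double_coset_eq_iff)
qed

lemma P_bar_at_eq: "prime p \<Longrightarrow> P_bar_at p = {P_matrix y x | y x. y \<in> Pi_adeles p}"
  by (simp add: P_bar_at_def Zhat_class_in_Pi_classes)

abbreviation P_coords :: "nat \<Rightarrow> (adele \<times> adele) topology" where
  "P_coords p \<equiv> prod_topology euclidean (top_of_set (Pi_adeles p))"

lemma homeomorphic_map_P_matrix:
  assumes p: "prime p"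
  shows "homeomorphic_map (P_coords p) (top_of_set (P_bar_at p)) (\<lambda>(x, y). P_matrix y x)"
proof -
  have cont: "continuous_on S (\<lambda>z. P_matrix (snd z) (fst z))" for S :: "(adele \<times> adele) set"
  proof -
    have eq: "P_matrix b a = (\<chi> i j. if i = 1 then if j = 1 then b else a else if j = 1 then 0 else 1)"
      for a b :: adele by (simp add: vec_eq_iff forall_2)
    show ?thesis unfolding eq
    proof (intro continuous_on_vec_lambda)
      fix i j :: 2
      show "continuous_on S (\<lambda>z. if i = 1 then if j = 1 then snd z else fst z else if j = 1 then 0 else 1)"
        by (cases "i = 1"; cases "j = 1") (simp_all add: continuous_on_fst continuous_on_snd)
    qed
  qed
  have X: "P_coords p = top_of_set (UNIV \<times> Pi_adeles p)"
    using prod_topology_subtopology_eu[of UNIV "Pi_adeles p"] by simp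
  have "homeomorphic_maps (P_coords p) (top_of_set (P_bar_at p)) (\<lambda>(x, y). P_matrix y x)
      (\<lambda>M. (M $ 1 $ 2, M $ 1 $ 1))"
    unfolding homeomorphic_maps_def X
  proof (intro conjI)
    show "continuous_map (top_of_set (UNIV \<times> Pi_adeles p)) (top_of_set (P_bar_at p)) (\<lambda>(x, y). P_matrix y x)"
      using cont by (auto simp: case_prod_beta continuous_map_in_subtopology P_bar_at_eq[OF p])
    show "continuous_map (top_of_set (P_bar_at p)) (top_of_set (UNIV \<times> Pi_adeles p)) (\<lambda>M. (M $ 1 $ 2, M $ 1 $ 1))"
      unfolding continuous_map_in_subtopology
    proof
      have "continuous_on (P_bar_at p) (\<lambda>M. (M $ 1 $ 2, M $ 1 $ 1))" by (intro continuous_intros)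
      then show "continuous_map (top_of_set (P_bar_at p)) euclidean (\<lambda>M. (M $ 1 $ 2, M $ 1 $ 1))" by simp
    qed (auto simp: P_bar_at_eq[OF p])
  qed (auto simp: P_bar_at_eq[OF p])
  then show ?thesis using homeomorphic_maps_map by blast
qed

text \<open>Both spaces are quotients of the space of pairs \<open>(x, y)\<close>, with the same fibres.\<close>

lemma image_space_homeomorphism:
  assumes p: "prime p"
  obtains \<theta> where "homeomorphic_map (Gamma_p p) (image_space p) \<theta>"
    "\<And>y x. y \<in> Pi_adeles p \<Longrightarrow> \<theta> (pZ_orbit p (Q_coset x, Zhat_class y)) = double_coset (P_matrix y x)"
proof -
  let ?c = "\<lambda>(x, y). (Q_coset x, Zhat_class y)"
  have cont: "continuous_map (P_coords p) (pZ_space p) ?c"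
    unfolding continuous_map_prod_top
    using continuous_map_Zhat_class_Pi_space[OF p] quotient_imp_continuous_map[OF quotient_map_Q_coset] by simp
  have op: "open_map (P_coords p) (pZ_space p) ?c"
    by (rule open_map_prod_top[OF open_map_Q_coset open_map_Zhat_class_Pi_space[OF p]])
  have surj: "?c ` topspace (P_coords p) = topspace (pZ_space p)"
    by (force simp: topspace_adele_mod_Q topspace_Pi_space)
  have f: "quotient_map (P_coords p) (Gamma_p p) (pZ_orbit p \<circ> ?c)"
    using continuous_open_imp_quotient_map[OF cont op surj] quotient_map_pZ_orbit by (rule quotient_map_compose)
  have g: "quotient_map (P_coords p) (image_space p) (double_coset \<circ> (\<lambda>(x, y). P_matrix y x))"
    using homeomorphic_map_P_matrix[OF p, unfolded homeomorphic_map_def, THEN conjunct1] quotient_map_quotient_topology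
    unfolding image_space_def by (rule quotient_map_compose)
  have fib: "(pZ_orbit p \<circ> ?c) z = (pZ_orbit p \<circ> ?c) w \<longleftrightarrow>
      (double_coset \<circ> (\<lambda>(x, y). P_matrix y x)) z = (double_coset \<circ> (\<lambda>(x, y). P_matrix y x)) w"
    if "z \<in> topspace (P_coords p)" "w \<in> topspace (P_coords p)" for z w
    using that by (cases z; cases w) (simp add: pZ_orbit_eq_iff_double_coset_eq[OF p])
  obtain \<theta> where "homeomorphic_map (Gamma_p p) (image_space p) \<theta>"
    "\<And>z. z \<in> topspace (P_coords p) \<Longrightarrow>
      \<theta> ((pZ_orbit p \<circ> ?c) z) = (double_coset \<circ> (\<lambda>(x, y). P_matrix y x)) z"
    using quotient_maps_same_fibres[OF f g fib] by blast
  then show ?thesis using that by force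
qed

lemma continuous_map_image_space_Gamma_Q: "continuous_map (image_space p) Gamma_Q id"
proof -
  have "continuous_map (top_of_set P_bar) Gamma_Q double_coset"
    unfolding Gamma_Q_def using quotient_map_quotient_topology by (rule quotient_imp_continuous_map)
  moreover have "P_bar_at p \<subseteq> P_bar" by (auto simp: P_bar_at_def P_bar_def)
  ultimately have "continuous_map (top_of_set (P_bar_at p)) Gamma_Q double_coset"
    by (rule continuous_map_from_subtopology_mono)
  then show ?thesis
    unfolding image_space_def by (intro continuous_compose_quotient_map[OF quotient_map_quotient_topology]) simp
qed

section \<open>The orbit space as a mapping torus\<close>

lemma pZ_space_cases:
  assumes "prime p" "c \<in> topspace (pZ_space p)"
  obtains C t where "C \<in> topspace adele_mod_Q" "t > 0" "c = (C, pi_class p t)"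
  using assms Pi_space_eq_pi_class[OF assms(1)] by (metis SigmaE topspace_prod_topology)

lemma Gamma_p_cases:
  assumes p: "prime p" and c: "c \<in> topspace (Gamma_p p)"
  obtains C t where "C \<in> topspace adele_mod_Q" "t > 0" "c = pZ_orbit p (C, pi_class p t)"
proof -
  obtain z where z: "z \<in> topspace (pZ_space p)" "c = pZ_orbit p z" using c by (auto simp: Gamma_p_def)
  show ?thesis by (rule pZ_space_cases[OF p z(1)]) (use that z(2) in simp)
qed

lemma pZ_act_pi_class:
  "prime p \<Longrightarrow> t > 0 \<Longrightarrow>
    pZ_act p n (C, pi_class p t) = (scale_class (of_nat p powi n) C, pi_class p (real p powi n * t))"
  by (simp add: pZ_act_def scale_pi_class)

lemma powi_times_powr: "p > 0 \<Longrightarrow> real p powi n * real p powr s = real p powr (of_int n + s)"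
  by (simp add: powr_add powr_real_of_int')

lemma pi_class_inj: "prime p \<Longrightarrow> pi_class p s = pi_class p t \<longleftrightarrow> s = t"
  using Zhat_level_pi_class by metis

lemma powr_log_prime: "prime p \<Longrightarrow> t > 0 \<Longrightarrow> real p powr log (real p) t = t"
  using prime_gt_1_nat[of p] by (intro powr_log_cancel) auto

text \<open>Levels whose logarithms differ by a noninteger are told apart by a map to the circle, which is
constant on orbits. Otherwise the two orbits have representatives at the same level, and the
Hausdorff property of the adeles modulo the rationals applies to these.\<close>

lemma Hausdorff_space_Gamma_p:
  assumes p: "prime p"
  shows "Hausdorff_space (Gamma_p p)"
  unfolding Hausdorff_space_def
proof (intro allI impI)
  have p1: "real p > 1" using prime_gt_1_nat[OF p] by simp
  define circ where "circ t = cis (2 * pi * log (real p) t)" for t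
  have level: "continuous_map (pZ_space p) euclideanreal (Zhat_level \<circ> snd)"
    using continuous_map_snd continuous_Zhat_level by (rule continuous_map_compose)
  have "continuous_map (pZ_space p) (top_of_set {0<..}) (Zhat_level \<circ> snd)"
    unfolding continuous_map_in_subtopology using level Pi_space_eq_pi_class(2)[OF p] by auto
  moreover have "continuous_map (top_of_set {0<..}) euclidean circ"
  proof -
    have "continuous_on {0<..} circ" unfolding circ_def using p1 by (intro continuous_intros) auto
    then show ?thesis by simp
  qed
  ultimately have circ_cont: "continuous_map (pZ_space p) euclidean (circ \<circ> (Zhat_level \<circ> snd))"
    by (rule continuous_map_compose)
  have circ_scale: "circ (real p powi n * t) = circ t" if "t > 0" for n t
  proof -
    have "real p powi n = real p powr of_int n" using p1 by (simp add: powr_real_of_int')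
    then have "log (real p) (real p powi n * t) = of_int n + log (real p) t"
      using p1 that by (simp add: log_mult)
    then have "circ (real p powi n * t) = cis (2 * pi * of_int n) * circ t"
      by (simp only: circ_def distrib_left cis_mult)
    then show ?thesis by (simp add: cis_multiple_2pi)
  qed
  fix c d assume cd: "c \<in> topspace (Gamma_p p) \<and> d \<in> topspace (Gamma_p p) \<and> c \<noteq> d"
  obtain C s where C: "C \<in> topspace adele_mod_Q" "s > 0" "c = pZ_orbit p (C, pi_class p s)"
    using Gamma_p_cases[OF p] cd by blast
  obtain D t where D: "D \<in> topspace adele_mod_Q" "t > 0" "d = pZ_orbit p (D, pi_class p t)"
    using Gamma_p_cases[OF p] cd by blast
  show "\<exists>U V. openin (Gamma_p p) U \<and> openin (Gamma_p p) V \<and> c \<in> U \<and> d \<in> V \<and> disjnt U V"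
  proof (cases "circ s = circ t")
    case False
    then obtain U V where UV: "open U" "open V" "circ s \<in> U" "circ t \<in> V" "U \<inter> V = {}"
      using hausdorff[OF False] by blast
    let ?W = "\<lambda>U. pZ_orbit p ` {c \<in> topspace (pZ_space p). (circ \<circ> (Zhat_level \<circ> snd)) c \<in> U}"
    have "openin (Gamma_p p) (?W U)" if "open U" for U
      using open_map_pZ_orbit[OF p] openin_continuous_map_preimage[OF circ_cont, of U] that
      unfolding open_map_def by auto
    moreover have "c \<in> ?W U" "d \<in> ?W V"
      using C D UV pi_class_in[OF p] by (auto simp: Zhat_level_pi_class[OF p])
    moreover have "disjnt (?W U) (?W V)"
    proof -
      have "pZ_orbit p a \<noteq> pZ_orbit p b"
        if a: "a \<in> topspace (pZ_space p)" "(circ \<circ> (Zhat_level \<circ> snd)) a \<in> U"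
          and b: "b \<in> topspace (pZ_space p)" "(circ \<circ> (Zhat_level \<circ> snd)) b \<in> V" for a b
      proof
        assume "pZ_orbit p a = pZ_orbit p b"
        then obtain n where n: "b = pZ_act p n a" using pZ_orbit_eq_iff[OF p] by blast
        obtain A r where A: "r > 0" "a = (A, pi_class p r)" using pZ_space_cases[OF p a(1)] by metis
        have "(circ \<circ> (Zhat_level \<circ> snd)) b = (circ \<circ> (Zhat_level \<circ> snd)) a"
          using A n circ_scale by (simp add: pZ_act_pi_class[OF p] Zhat_level_pi_class[OF p])
        then show False using a(2) b(2) UV(5) by (metis disjoint_iff)
      qed
      then show ?thesis unfolding disjnt_def by blast
    qed
    ultimately show ?thesis using UV by blast
  next
    case True
    then obtain n where "2 * pi * log (real p) t = 2 * pi * log (real p) s + 2 * pi * of_int n"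
      using sin_cos_eq_iff[of "2 * pi * log (real p) t" "2 * pi * log (real p) s"]
      by (auto simp: circ_def complex_eq_iff)
    then have "2 * pi * log (real p) t = 2 * pi * (log (real p) s + of_int n)" by (simp only: distrib_left)
    then have "log (real p) t = log (real p) s + of_int n" by simp
    then have "real p powr (of_int n + log (real p) s) = t"
      using powr_log_prime[OF p D(2)] by (simp only: add.commute)
    then have ts: "real p powi n * s = t"
      using powi_times_powr[of p n "log (real p) s"] powr_log_prime[OF p C(2)] p1 by simp
    define E where "E = scale_class (of_nat p powi n) C"
    have p0: "of_nat p powi n \<noteq> (0::rat)" using p1 by auto
    have E: "E \<in> topspace adele_mod_Q"
      using continuous_map_scale_class_Q[OF p0] C(1) unfolding E_def continuous_map_def by blast
    have "(E, pi_class p t) = pZ_act p n (C, pi_class p s)"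
      using C(2) ts by (simp add: pZ_act_pi_class[OF p] E_def)
    then have c: "c = pZ_orbit p (E, pi_class p t)" unfolding C(3) pZ_orbit_eq_iff[OF p] by blast
    then have "E \<noteq> D" using cd D(3) by auto
    then obtain U V where UV: "openin adele_mod_Q U" "openin adele_mod_Q V" "E \<in> U" "D \<in> V" "disjnt U V"
      using Hausdorff_space_adele_mod_Q E D(1) unfolding Hausdorff_space_def by blast
    \<comment> \<open>Two levels in this band have a ratio strictly between \<open>1/p\<close> and \<open>p\<close>, so that no power of \<open>p\<close>
      other than 1 takes one to the other.\<close>
    define I where "I = {B \<in> topspace (Pi_space p). Zhat_level B \<in> {t / sqrt p<..<t * sqrt p}}"
    have "openin (Pi_space p) I"
      unfolding I_def using continuous_Zhat_level by (rule openin_continuous_map_preimage) simp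
    then have op: "openin (Gamma_p p) (pZ_orbit p ` (W \<times> I))" if "openin adele_mod_Q W" for W
      using open_map_pZ_orbit[OF p] that unfolding open_map_def by (simp add: openin_prod_Times_iff)
    have "t / sqrt p < t" "t < t * sqrt p" using D(2) p1 by (simp_all add: field_simps)
    then have "pi_class p t \<in> I" using pi_class_in[OF p D(2)] by (simp add: I_def Zhat_level_pi_class[OF p])
    then have "c \<in> pZ_orbit p ` (U \<times> I)" "d \<in> pZ_orbit p ` (V \<times> I)" using c D(3) UV by auto
    moreover have "disjnt (pZ_orbit p ` (U \<times> I)) (pZ_orbit p ` (V \<times> I))"
    proof -
      have "pZ_orbit p (A, F) \<noteq> pZ_orbit p (B, G)" if AB: "A \<in> U" "B \<in> V" and FG: "F \<in> I" "G \<in> I" for A B F G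
      proof
        assume "pZ_orbit p (A, F) = pZ_orbit p (B, G)"
        then obtain m where m: "(B, G) = pZ_act p m (A, F)" using pZ_orbit_eq_iff[OF p] by blast
        define f g where "f = Zhat_level F" "g = Zhat_level G"
        have F: "f > 0" "F = pi_class p f" using FG(1) Pi_space_eq_pi_class[OF p] by (auto simp: I_def f_g_def)
        have bounds: "f > t / sqrt p" "f < t * sqrt p" "g > t / sqrt p" "g < t * sqrt p"
          using FG by (auto simp: I_def f_g_def)
        have "G = pi_class p (real p powi m * f)" using m F by (simp add: pZ_act_pi_class[OF p])
        then have g: "g = real p powi m * f" by (simp add: f_g_def(2) Zhat_level_pi_class[OF p])
        have "t * sqrt p = real p * (t / sqrt p)" using p1 by (simp add: field_simps)
        then have "g < real p * f" "f < real p * g"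
          using bounds p1 by (smt (verit) mult_less_cancel_left_pos)+
        then have "real p powi m < real p powi 1" "real p powi (- m) < real p powi 1"
          using g F(1) p1 by (simp_all add: power_int_minus field_simps)
        then have "m < 1" "- m < 1" using p1 by (metis not_less power_int_increasing less_imp_le)+
        then have "m = 0" by simp
        then have "A = B" using m by (simp add: pZ_act_0)
        then show False using AB UV(5) by (auto simp: disjnt_iff)
      qed
      then show ?thesis unfolding disjnt_def by blast
    qed
    ultimately show ?thesis using op UV by blast
  qed
qed

definition torus_map :: "nat \<Rightarrow> adele set \<times> real \<Rightarrow> (adele set \<times> adele set) set" where
  "torus_map p = (\<lambda>(C, s). pZ_orbit p (C, pi_class p (real p powr s)))"

abbreviation torus_cylinder :: "(adele set \<times> real) topology" where
  "torus_cylinder \<equiv> prod_topology adele_mod_Q (top_of_set {0..1})"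

lemma compact_space_torus_cylinder: "compact_space torus_cylinder"
  using compact_space_adele_mod_Q by (simp add: compact_space_prod_topology compact_space_subtopology)

lemma continuous_torus_map:
  assumes p: "prime p"
  shows "continuous_map torus_cylinder (Gamma_p p) (torus_map p)"
proof -
  have p0: "real p > 0" using prime_gt_0_nat[OF p] by simp
  have "continuous_on {0..1} (\<lambda>s. real p powr s)" using p0 by (intro continuous_intros) auto
  then have "continuous_map (top_of_set {0..1}) (top_of_set {0<..}) (\<lambda>s. real p powr s)"
    using p0 by (auto simp: continuous_map_in_subtopology)
  then have "continuous_map (top_of_set {0..1}) (Pi_space p) (pi_class p \<circ> (\<lambda>s. real p powr s))"
    using continuous_pi_class[OF p] by (rule continuous_map_compose)
  then have "continuous_map torus_cylinder (pZ_space p) (\<lambda>(C, s). (C, (pi_class p \<circ> (\<lambda>s. real p powr s)) s))"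
    using continuous_map_id[of adele_mod_Q, unfolded id_def] unfolding continuous_map_prod_top
    by (intro disjI2 conjI)
  then have "continuous_map torus_cylinder (Gamma_p p)
      (pZ_orbit p \<circ> (\<lambda>(C, s). (C, (pi_class p \<circ> (\<lambda>s. real p powr s)) s)))"
    using quotient_imp_continuous_map[OF quotient_map_pZ_orbit] by (rule continuous_map_compose)
  then show ?thesis by (simp add: torus_map_def comp_def case_prod_unfold)
qed

text \<open>Multiplying by a power of \<open>p\<close> changes the logarithm of the level by an integer.\<close>

lemma torus_map_surj:
  assumes p: "prime p"
  shows "torus_map p ` topspace torus_cylinder = topspace (Gamma_p p)"
proof
  show "torus_map p ` topspace torus_cylinder \<subseteq> topspace (Gamma_p p)"
    using continuous_torus_map[OF p] by (auto simp: continuous_map_def)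
  show "topspace (Gamma_p p) \<subseteq> torus_map p ` topspace torus_cylinder"
  proof
    fix c assume "c \<in> topspace (Gamma_p p)"
    then obtain C t where C: "C \<in> topspace adele_mod_Q" "t > 0" "c = pZ_orbit p (C, pi_class p t)"
      by (rule Gamma_p_cases[OF p])
    define n where "n = - \<lfloor>log (real p) t\<rfloor>"
    define s where "s = log (real p) t + of_int n"
    have s: "s \<in> {0..1}" unfolding s_def n_def by simp linarith
    have "real p powi n * t = real p powr s"
      using powi_times_powr[of p n "log (real p) t"] powr_log_prime[OF p C(2)] prime_gt_0_nat[OF p]
      by (simp add: s_def add.commute)
    then have "pZ_act p n (C, pi_class p t) = (scale_class (of_nat p powi n) C, pi_class p (real p powr s))"
      using C by (simp add: pZ_act_pi_class[OF p])
    then have "c = torus_map p (scale_class (of_nat p powi n) C, s)"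
      unfolding C(3) torus_map_def prod.case pZ_orbit_eq_iff[OF p] by metis
    moreover have "scale_class (of_nat p powi n) C \<in> topspace adele_mod_Q"
      using continuous_map_scale_class_Q[of "of_nat p powi n"] C(1) prime_gt_0_nat[OF p]
      unfolding continuous_map_def by auto
    ultimately show "c \<in> torus_map p ` topspace torus_cylinder" using s by auto
  qed
qed

lemma compact_space_Gamma_p:
  assumes p: "prime p"
  shows "compact_space (Gamma_p p)"
proof -
  have "compactin (Gamma_p p) (torus_map p ` topspace torus_cylinder)"
    using compact_space_torus_cylinder continuous_torus_map[OF p] unfolding compact_space_def
    by (rule image_compactin)
  then show ?thesis by (simp only: torus_map_surj[OF p] compact_space_def)
qed

text \<open>Levels \<open>p^s\<close> and \<open>p^t\<close> with \<open>s\<close> and \<open>t\<close> in \<open>[0,1]\<close> that occur in one orbit differ by a factor 1,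
\<open>p\<close> or \<open>1/p\<close>. The last two force \<open>{s, t} = {0, 1}\<close> and are the gluing of the torus, read in
one direction or the other.\<close>

lemma torus_map_eq_iff:
  assumes p: "prime p" and z: "z \<in> topspace torus_cylinder" and w: "w \<in> topspace torus_cylinder"
  defines "R \<equiv> torus_gluing adele_mod_Q (scale_class (of_nat p))"
  shows "torus_map p z = torus_map p w \<longleftrightarrow> (R \<union> R\<inverse>)\<^sup>* `` {z} = (R \<union> R\<inverse>)\<^sup>* `` {w}"
proof -
  have p1: "real p > 1" using prime_gt_1_nat[OF p] by simp
  have act1: "pZ_act p n (C, pi_class p (real p powr s))
      = (scale_class (of_nat p powi n) C, pi_class p (real p powr (of_int n + s)))" for n C s
    using powi_times_powr[of p n s] p1 by (simp add: pZ_act_pi_class[OF p])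
  have glue: "torus_map p a = torus_map p b" if "(a, b) \<in> R" for a b
  proof -
    obtain C where ab: "a = (C, 0)" "b = (scale_class (of_nat p) C, 1)"
      using \<open>(a, b) \<in> R\<close> by (auto simp: R_def torus_gluing_def)
    have "(scale_class (of_nat p) C, pi_class p (real p powr 1)) = pZ_act p 1 (C, pi_class p (real p powr 0))"
      unfolding act1 by (simp only: power_int_1_right add_0_right of_int_1)
    then show ?thesis
      unfolding ab torus_map_def prod.case pZ_orbit_eq_iff[OF p] by (rule exI)
  qed
  have "torus_map p a = torus_map p b" if "(a, b) \<in> (R \<union> R\<inverse>)\<^sup>*" for a b
    using that
  proof (induction rule: rtrancl_induct)
    case (step b c)
    show ?case
    proof (cases "(b, c) \<in> R")
      case True
      show ?thesis by (rule trans[OF step.IH glue[OF True]])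
    next
      case False
      then have "(c, b) \<in> R" using step.hyps(2) by blast
      show ?thesis by (rule trans[OF step.IH glue[OF \<open>(c, b) \<in> R\<close>, symmetric]])
    qed
  qed simp
  moreover have "(z, w) \<in> (R \<union> R\<inverse>)\<^sup>*" if eq: "torus_map p z = torus_map p w"
  proof -
    obtain C s where z': "z = (C, s)" "C \<in> topspace adele_mod_Q" "0 \<le> s" "s \<le> 1" using z by auto
    obtain D t where w': "w = (D, t)" "D \<in> topspace adele_mod_Q" "0 \<le> t" "t \<le> 1" using w by auto
    obtain n where n: "(D, pi_class p (real p powr t)) = pZ_act p n (C, pi_class p (real p powr s))"
      using eq unfolding z' w' torus_map_def prod.case pZ_orbit_eq_iff[OF p] by blast
    then have D: "D = scale_class (of_nat p powi n) C" and "real p powr t = real p powr (of_int n + s)"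
      unfolding act1 by (simp_all add: pi_class_inj[OF p])
    then have t: "t = of_int n + s" using p1 by (simp add: powr_inj)
    then have "n \<in> {-1, 0, 1}" using z' w' by auto
    then consider "n = 0" | "n = 1" | "n = -1" by auto
    then show ?thesis
    proof cases
      case 1
      then have "z = w" using D t z' w' by (simp add: scale_class_1)
      then show ?thesis by simp
    next
      case 2
      then have "(z, w) \<in> R" using D t z' w' by (auto simp: R_def torus_gluing_def)
      then show ?thesis by auto
    next
      case 3
      then have "scale_class (of_nat p) D = C"
        using D p1 by (simp add: scale_class_scale_class scale_class_1)
      then have "(w, z) \<in> R" using 3 t z' w' by (auto simp: R_def torus_gluing_def)
      then show ?thesis by auto
    qed
  qed
  moreover have "(R \<union> R\<inverse>)\<^sup>* `` {z} = (R \<union> R\<inverse>)\<^sup>* `` {w} \<longleftrightarrow> (z, w) \<in> (R \<union> R\<inverse>)\<^sup>*"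
  proof -
    have "equiv UNIV ((R \<union> R\<inverse>)\<^sup>*)"
      by (intro equivI refl_rtrancl trans_rtrancl sym_rtrancl sym_Un_converse) auto
    then show ?thesis by (simp add: eq_equiv_class_iff)
  qed
  ultimately show ?thesis by blast
qed

lemma Gamma_p_homeomorphic_mapping_torus:
  assumes p: "prime p"
  shows "Gamma_p p homeomorphic_space mapping_torus adele_mod_Q (scale_class (of_nat p))"
proof -
  let ?R = "torus_gluing adele_mod_Q (scale_class (of_nat p))"
  have q: "quotient_map torus_cylinder (Gamma_p p) (torus_map p)"
    using continuous_torus_map[OF p] compact_space_torus_cylinder Hausdorff_space_Gamma_p[OF p] torus_map_surj[OF p]
    by (rule continuous_imp_quotient_map)
  let ?r = "\<lambda>z. (?R \<union> ?R\<inverse>)\<^sup>* `` {z}"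
  show ?thesis
  proof (rule quotient_maps_same_fibres[OF q quotient_map_quotient_topology[of torus_cylinder ?r]])
    show "torus_map p z = torus_map p w \<longleftrightarrow> ?r z = ?r w"
      if "z \<in> topspace torus_cylinder" "w \<in> topspace torus_cylinder" for z w
      using torus_map_eq_iff[OF p that] .
    fix h assume "homeomorphic_map (Gamma_p p) (quotient_topology torus_cylinder ?r) h"
    then show ?thesis unfolding mapping_torus_def by (rule homeomorphic_map_imp_homeomorphic_space)
  qed
qed

theorem lemma5p5:
  fixes p :: nat
  assumes "prime p"
  shows "(\<exists>\<theta>.
            (\<forall>y x. Zhat_class y \<in> Pi_classes p \<longrightarrow>
               \<theta> (pZ_orbit p (Q_coset x, Zhat_class y)) = double_coset (P_matrix y x)) \<and>
            bij_betw \<theta> (topspace (Gamma_p p)) (double_coset ` P_bar_at p) \<and>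
            continuous_map (Gamma_p p) Gamma_Q \<theta> \<and>
            homeomorphic_map (Gamma_p p) (image_space p) \<theta>)
       \<and> compact_space (Gamma_p p) \<and> Hausdorff_space (Gamma_p p)
       \<and> homeomorphic_map adele_mod_Q adele_mod_Q (scale_class (of_nat p))
       \<and> (Gamma_p p) homeomorphic_space (mapping_torus adele_mod_Q (scale_class (of_nat p)))"
proof -
  obtain \<theta> where \<theta>: "homeomorphic_map (Gamma_p p) (image_space p) \<theta>"
    "\<And>y x. y \<in> Pi_adeles p \<Longrightarrow> \<theta> (pZ_orbit p (Q_coset x, Zhat_class y)) = double_coset (P_matrix y x)"
    using image_space_homeomorphism[OF assms] by blast
  have "bij_betw \<theta> (topspace (Gamma_p p)) (double_coset ` P_bar_at p)"
    using \<theta>(1) unfolding homeomorphic_eq_everything_map by (simp add: bij_betw_def image_space_def)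
  moreover have "continuous_map (Gamma_p p) Gamma_Q \<theta>"
    using continuous_map_compose[OF homeomorphic_imp_continuous_map[OF \<theta>(1)] continuous_map_image_space_Gamma_Q]
    by simp
  moreover have "homeomorphic_map adele_mod_Q adele_mod_Q (scale_class (of_nat p))"
    using homeomorphic_maps_scale_class_Q[of "of_nat p"] assms prime_gt_0_nat[OF assms]
    by (auto simp: homeomorphic_maps_map)
  ultimately show ?thesis
    using \<theta> Zhat_class_in_Pi_classes[OF assms] compact_space_Gamma_p[OF assms]
      Hausdorff_space_Gamma_p[OF assms] Gamma_p_homeomorphic_mapping_torus[OF assms] by auto
qed

end
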